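(* Let $\Bbbk$ be a field and $G$ a finite simple graph on $[n]$. If $G$ is chordal, claw-free, and tent-free, then the binomial edge ideal $J_G$ is Koszul, i.e. $R_G=S_G/J_G$ is a Koszul algebra.
   Context: $J_G=(x_iy_j-x_jy_i \mid \{i,j\}\in E(G))$ in the standard graded ring $S_G=\Bbbk[x_1,\dots,x_n,y_1,\dots,y_n]$, $R_G=S_G/J_G$. A graded quotient $Q=S/I$ is Koszul if $\Bbbk$ has a linear minimal free resolution over $Q$. A graph is chordal if it has no induced cycle of length at least $4$. The claw is $K_{1,3}$. The tent is the graph with vertices $v_1,v_2,v_3,w_1,w_2,w_3$, edges $v_1v_2,v_1v_3,v_2v_3$, $w_1v_1,w_1v_2,w_2v_2,w_2v_3,w_3v_3,w_3v_1$. "$H$-free" means no induced subgraph isomorphic to $H$. *)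

theory Defs
  imports Main "HOL-Library.Poly_Mapping"
begin

text \<open>Variables: Inl i stands for x_i and Inr i stands for y_i.
  Monomials are finitely supported exponent vectors, polynomials are finitely supported
  coefficient functions on monomials; multiplication is the convolution product of
  Poly_Mapping, so this is the polynomial ring in the variables (nat + nat).\<close>

type_synonym 'k mpoly = "((nat + nat) \<Rightarrow>\<^sub>0 nat) \<Rightarrow>\<^sub>0 'k"

definition Var :: "(nat + nat) \<Rightarrow> ('k::comm_ring_1) mpoly" where
  "Var v = Poly_Mapping.single (Poly_Mapping.single v 1) 1"

definition xv :: "nat \<Rightarrow> ('k::comm_ring_1) mpoly" where "xv i = Var (Inl i)"
definition yv :: "nat \<Rightarrow> ('k::comm_ring_1) mpoly" where "yv i = Var (Inr i)"

definition in_ring :: "(nat + nat) set \<Rightarrow> ('k::comm_ring_1) mpoly \<Rightarrow> bool" where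
  "in_ring V p \<longleftrightarrow> (\<forall>m \<in> Poly_Mapping.keys p. Poly_Mapping.keys (m :: (nat + nat) \<Rightarrow>\<^sub>0 nat) \<subseteq> V)"

definition mdeg :: "((nat + nat) \<Rightarrow>\<^sub>0 nat) \<Rightarrow> nat" where
  "mdeg m = (\<Sum>v \<in> Poly_Mapping.keys m. Poly_Mapping.lookup m v)"

definition linear_form :: "(nat + nat) set \<Rightarrow> ('k::comm_ring_1) mpoly \<Rightarrow> bool" where
  "linear_form V p \<longleftrightarrow> in_ring V p \<and> (\<forall>m \<in> Poly_Mapping.keys p. mdeg m = 1)"

definition ideal_gen :: "(nat + nat) set \<Rightarrow> ('k::comm_ring_1) mpoly set \<Rightarrow> 'k mpoly set" where
  "ideal_gen V A = {p. \<exists>F c. finite F \<and> F \<subseteq> A \<and> (\<forall>g\<in>F. in_ring V (c g))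
                           \<and> p = (\<Sum>g\<in>F. c g * g)}"

definition max_ideal :: "(nat + nat) set \<Rightarrow> ('k::comm_ring_1) mpoly set" where
  "max_ideal V = {p. in_ring V p \<and> Poly_Mapping.lookup p 0 = 0}"

text \<open>A graded quotient Q = k[V]/I is Koszul iff the residue field k has a linear
  (hence minimal) graded free resolution over Q:
    ... --> Q(-2)^(b 2) --d_2--> Q(-1)^(b 1) --d_1--> Q^(b 0) = Q --> k --> 0,
  where each differential d_i : Q^(b i) --> Q^(b (i-1)) is given by a b(i-1) x b(i)
  matrix M i of linear forms (entries of the matrix: M i r c).  Everything is computed
  with representatives in k[V]; congruence modulo I expresses equality in Q.
  The ranks b i are finite (finitely generated free modules).\<close>

definition mat_app :: "(nat \<Rightarrow> nat \<Rightarrow> ('k::comm_ring_1) mpoly) \<Rightarrow> nat \<Rightarrow> (nat \<Rightarrow> 'k mpoly) \<Rightarrow> nat \<Rightarrow> 'k mpoly" where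
  "mat_app A cols v r = (\<Sum>c<cols. A r c * v c)"

definition vec_in_ring :: "(nat + nat) set \<Rightarrow> nat \<Rightarrow> (nat \<Rightarrow> ('k::comm_ring_1) mpoly) \<Rightarrow> bool" where
  "vec_in_ring V k v \<longleftrightarrow> (\<forall>c<k. in_ring V (v c))"

definition linear_resolution_of_field ::
  "(nat + nat) set \<Rightarrow> ('k::comm_ring_1) mpoly set \<Rightarrow> (nat \<Rightarrow> nat) \<Rightarrow> (nat \<Rightarrow> nat \<Rightarrow> nat \<Rightarrow> 'k mpoly) \<Rightarrow> bool" where
  "linear_resolution_of_field V I b M \<longleftrightarrow>
     b 0 = 1 \<and>
     (\<forall>i\<ge>1. \<forall>r<b (i - 1). \<forall>c<b i. linear_form V (M i r c)) \<and>
     \<comment> \<open>exactness at F_0: the image of d_1 is the maximal ideal of Q = ker(Q --> k)\<close>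
     (\<forall>p. in_ring V p \<longrightarrow>
        ((p \<in> max_ideal V) \<longleftrightarrow>
         (\<exists>w. vec_in_ring V (b 1) w \<and> p - mat_app (M 1) (b 1) w 0 \<in> I))) \<and>
     \<comment> \<open>complex: d_i o d_(i+1) = 0 over Q\<close>
     (\<forall>i\<ge>1. \<forall>w. vec_in_ring V (b (i + 1)) w \<longrightarrow>
        (\<forall>r<b (i - 1). mat_app (M i) (b i) (mat_app (M (i + 1)) (b (i + 1)) w) r \<in> I)) \<and>
     \<comment> \<open>exactness at F_i for i >= 1: ker d_i \<subseteq> im d_(i+1) over Q\<close>
     (\<forall>i\<ge>1. \<forall>v. vec_in_ring V (b i) v \<longrightarrow>
        (\<forall>r<b (i - 1). mat_app (M i) (b i) v r \<in> I) \<longrightarrow>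
        (\<exists>w. vec_in_ring V (b (i + 1)) w \<and>
             (\<forall>r<b i. v r - mat_app (M (i + 1)) (b (i + 1)) w r \<in> I)))"

definition koszul :: "(nat + nat) set \<Rightarrow> ('k::comm_ring_1) mpoly set \<Rightarrow> bool" where
  "koszul V I \<longleftrightarrow> (\<exists>b M. linear_resolution_of_field V I b M)"

definition vars_S :: "nat \<Rightarrow> (nat + nat) set" where
  "vars_S n = Inl ` {1..n} \<union> Inr ` {1..n}"

definition binomial_edge_ideal :: "nat \<Rightarrow> (nat \<Rightarrow> nat \<Rightarrow> bool) \<Rightarrow> ('k::comm_ring_1) mpoly set" where
  "binomial_edge_ideal n E = ideal_gen (vars_S n)
     {xv i * yv j - xv j * yv i | i j. i \<in> {1..n} \<and> j \<in> {1..n} \<and> i < j \<and> E i j}"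

definition simple_graph_on :: "nat \<Rightarrow> (nat \<Rightarrow> nat \<Rightarrow> bool) \<Rightarrow> bool" where
  "simple_graph_on n E \<longleftrightarrow> (\<forall>i j. E i j \<longrightarrow> E j i) \<and> (\<forall>i. \<not> E i i) \<and>
     (\<forall>i j. E i j \<longrightarrow> i \<in> {1..n} \<and> j \<in> {1..n})"

definition has_induced :: "nat \<Rightarrow> (nat \<Rightarrow> nat \<Rightarrow> bool) \<Rightarrow> 'a set \<Rightarrow> ('a \<Rightarrow> 'a \<Rightarrow> bool) \<Rightarrow> bool" where
  "has_induced n E VH EH \<longleftrightarrow> (\<exists>f. inj_on f VH \<and> f ` VH \<subseteq> {1..n} \<and>
       (\<forall>a\<in>VH. \<forall>b\<in>VH. E (f a) (f b) \<longleftrightarrow> EH a b))"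

definition cycle_edges :: "nat \<Rightarrow> nat \<Rightarrow> nat \<Rightarrow> bool" where
  "cycle_edges k a b \<longleftrightarrow> b = (a + 1) mod k \<or> a = (b + 1) mod k"

definition chordal :: "nat \<Rightarrow> (nat \<Rightarrow> nat \<Rightarrow> bool) \<Rightarrow> bool" where
  "chordal n E \<longleftrightarrow> (\<forall>k\<ge>4. \<not> has_induced n E {0..<k} (cycle_edges k))"

definition claw_edges :: "nat \<Rightarrow> nat \<Rightarrow> bool" where
  "claw_edges a b \<longleftrightarrow> (a = 0 \<and> b \<noteq> 0) \<or> (b = 0 \<and> a \<noteq> 0)"

definition claw_free :: "nat \<Rightarrow> (nat \<Rightarrow> nat \<Rightarrow> bool) \<Rightarrow> bool" where
  "claw_free n E \<longleftrightarrow> \<not> has_induced n E {0..3::nat} claw_edges"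

text \<open>Tent: v1,v2,v3 = 0,1,2 and w1,w2,w3 = 3,4,5; edges v1v2, v1v3, v2v3,
  w1v1, w1v2, w2v2, w2v3, w3v3, w3v1.\<close>
definition tent_edge_list :: "(nat \<times> nat) set" where
  "tent_edge_list = {(0,1), (0,2), (1,2), (3,0), (3,1), (4,1), (4,2), (5,2), (5,0)}"

definition tent_edges :: "nat \<Rightarrow> nat \<Rightarrow> bool" where
  "tent_edges a b \<longleftrightarrow> (a, b) \<in> tent_edge_list \<or> (b, a) \<in> tent_edge_list"

definition tent_free :: "nat \<Rightarrow> (nat \<Rightarrow> nat \<Rightarrow> bool) \<Rightarrow> bool" where
  "tent_free n E \<longleftrightarrow> \<not> has_induced n E {0..5::nat} tent_edges"

end

theory Submission
  imports Defs
begin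

text \<open>
  All rings \<open>R = S/J\<close> below are quotients of one polynomial ring in all variables; the variables
  of deleted vertices are put into \<open>J\<close>. The proof is by induction on the number of vertices.

  A claw-free strongly chordal graph has a vertex \<open>v\<close> whose closed neighbourhood is a clique that
  can be listed as \<open>v = s\<^sub>0, s\<^sub>1, \<dots>\<close> so that each \<open>s\<^sub>j\<close> is simplicial after deletion of its predecessors.
  For a simplicial vertex \<open>s\<close> the variable \<open>x\<^sub>s\<close> is regular; hence \<open>0 : x\<^sub>v = 0\<close>,
  \<open>(x\<^sub>v) : y\<^sub>v = Q := (x\<^sub>s\<^sub>j)\<^sub>j\<close>, and \<open>Q\<close> has colon ideals
  \<open>(x\<^sub>s\<^sub>i : i < j) : x\<^sub>s\<^sub>j = (x\<^sub>s\<^sub>i, y\<^sub>s\<^sub>i : i < j)\<close>, whose quotient is the ring of an induced subgraph.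
  Such rings are algebra retracts of the ring \<open>R'\<close> of the graph without \<open>v\<close>, and an algebra retract
  of a Koszul algebra that is itself Koszul has a linear resolution. So the class of modules that are
  iterated extensions of \<open>R\<close>, \<open>R/Q\<close> and modules with a linear resolution over \<open>R'\<close>
  consists of modules generated in one degree by linear presentations whose syzygies are again in the
  class. Hence all of them, and in particular the residue field, have linear resolutions over \<open>R\<close>.
\<close>

section \<open>Linear resolutions over quotients of a graded ring\<close>

text \<open>Linearity over a retract cannot be quoted over R itself: it needs R to be Koszul, which
  is the claim. It is used over R', where the induction hypothesis covers all rings involved, and
  modules are carried from R' to R by adjoining the columns of x_v and y_v; the cost is that R/Q
  joins the class. The residue field is an R'-module, so its linear resolution over R' places it in
  the class.

  An order on the whole closed neighbourhood of v is forced by Q: the colon ideals in the filtration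
  of Q are computable because each variable is regular once the earlier vertices are deleted, and
  regularity is established for simplicial vertices. The existence of such a v is Farber's simple
  vertex property of strongly chordal graphs; among the suns that obstruct strong chordality, those
  with more than three tips contain a claw, which leaves the tent.

  A class closed under syzygies yields infinite resolutions by coinduction, so no module has to be
  resolved explicitly.\<close>

definition mapp :: "(nat \<Rightarrow> nat \<Rightarrow> 'a::comm_ring_1) \<Rightarrow> nat \<Rightarrow> (nat \<Rightarrow> 'a) \<Rightarrow> nat \<Rightarrow> 'a" where
  "mapp A c v r = (\<Sum>j<c. A r j * v j)"

lemma mapp_cong [cong]:
  "A = A' \<Longrightarrow> r = r' \<Longrightarrow> c = c' \<Longrightarrow> (\<And>j. j < c' \<Longrightarrow> v j = v' j) \<Longrightarrow> mapp A c v r = mapp A' c' v' r'"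
  unfolding mapp_def by simp

lemma mapp_0 [simp]: "mapp A 0 v r = 0" "mapp A c (\<lambda>_. 0) r = 0"
  by (simp_all add: mapp_def)

lemma mapp_add: "mapp A c (\<lambda>j. u j + v j) r = mapp A c u r + mapp A c v r"
  by (simp add: mapp_def algebra_simps sum.distrib)

lemma mapp_diff: "mapp A c (\<lambda>j. u j - v j) r = mapp A c u r - mapp A c v r"
  by (simp add: mapp_def algebra_simps sum_subtractf)

lemma mapp_scale: "mapp A c (\<lambda>j. k * v j) r = k * mapp A c v r"
  by (simp add: mapp_def sum_distrib_left algebra_simps)

lemma mapp_sum: "mapp A c (\<lambda>j. \<Sum>e\<in>X. w e j) r = (\<Sum>e\<in>X. mapp A c (w e) r)"
  unfolding mapp_def by (simp add: sum_distrib_left, subst sum.swap, simp)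

text \<open>The matrices act on different indices of the array \<open>z\<close>, so they commute.
  Below, one index belongs to a module and the other to a resolution of the residue field.\<close>

lemma mapp_mapp:
  "mapp B b (\<lambda>e. mapp A c (z e) r) s = mapp A c (\<lambda>j. mapp B b (\<lambda>e. z e j) s) r"
  unfolding mapp_def
  by (simp add: sum_distrib_left, subst sum.swap, simp add: mult_ac)

lemma mapp_unit:
  "a < c \<Longrightarrow> mapp A c (\<lambda>j. if j = a then k else 0) r = k * A r a"
  by (simp add: mapp_def if_distrib[of "\<lambda>x. _ * x"] mult.commute cong: if_cong)

abbreviation diffl :: "(nat \<Rightarrow> nat) \<Rightarrow> (nat \<Rightarrow> nat \<Rightarrow> nat \<Rightarrow> 'b::comm_ring_1) \<Rightarrow> nat \<Rightarrow> (nat \<Rightarrow> 'b) \<Rightarrow> nat \<Rightarrow> 'b" where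
  "diffl f F i \<equiv> mapp (F i) (f (Suc i))"

text \<open>\<open>hc d\<close> is the projection to the component of degree \<open>d\<close>;
  \<open>hc_unit\<close> makes the component of degree 0 a field.\<close>

locale graded =
  fixes hc :: "nat \<Rightarrow> 'a::comm_ring_1 \<Rightarrow> 'a"
  assumes hc_add: "hc d (p + q) = hc d p + hc d q"
    and hc_hc: "hc d (hc e p) = (if d = e then hc d p else 0)"
    and hc_sum_ex: "\<exists>D. p = (\<Sum>d\<le>D. hc d p)"
    and hc_mult: "hc e a = a \<Longrightarrow> hc d (a * p) = (if e \<le> d then a * hc (d - e) p else 0)"
    and hc_one: "hc 0 1 = 1"
    and hc_unit: "hc 0 p = p \<Longrightarrow> p \<noteq> 0 \<Longrightarrow> \<exists>q. hc 0 q = q \<and> q * p = 1"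
begin

lemma hc_0 [simp]: "hc d 0 = 0"
  using hc_add[of d 0 0] by simp

lemma hc_uminus: "hc d (- p) = - hc d p"
  using hc_add[of d p "- p"] by (simp add: eq_neg_iff_add_eq_0 add.commute)

lemma hc_diff: "hc d (p - q) = hc d p - hc d q"
  using hc_add[of d p "- q"] by (simp add: hc_uminus)

lemma hc_sum: "hc d (sum f X) = (\<Sum>x\<in>X. hc d (f x))"
  by (induction X rule: infinite_finite_induct) (auto simp: hc_add)

abbreviation "linear_mat A b c \<equiv> (\<forall>r<b. \<forall>j<c. hc 1 (A r j) = A r j)"

lemma hc_mapp:
  assumes "linear_mat A b c" "r < b"
  shows "hc (Suc d) (mapp A c v r) = mapp A c (\<lambda>j. hc d (v j)) r"
    and "hc 0 (mapp A c v r) = 0"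
  using assms by (simp_all add: mapp_def hc_sum hc_mult[of 1])

definition hideal :: "'a set \<Rightarrow> bool" where
  "hideal I \<longleftrightarrow> 0 \<in> I \<and> (\<forall>p\<in>I. \<forall>q\<in>I. p + q \<in> I) \<and> (\<forall>c. \<forall>p\<in>I. c * p \<in> I) \<and>
     (\<forall>p\<in>I. \<forall>d. hc d p \<in> I)"

lemma hidealD:
  assumes "hideal I"
  shows "0 \<in> I" "p \<in> I \<Longrightarrow> q \<in> I \<Longrightarrow> p + q \<in> I" "p \<in> I \<Longrightarrow> c * p \<in> I"
    "p \<in> I \<Longrightarrow> hc d p \<in> I" "p \<in> I \<Longrightarrow> - p \<in> I" "p \<in> I \<Longrightarrow> q \<in> I \<Longrightarrow> p - q \<in> I"
    "p \<in> I \<Longrightarrow> p * c \<in> I"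
proof -
  show *: "0 \<in> I" "p \<in> I \<Longrightarrow> q \<in> I \<Longrightarrow> p + q \<in> I" "p \<in> I \<Longrightarrow> c * p \<in> I"
    "p \<in> I \<Longrightarrow> hc d p \<in> I" for p q c d
    using assms unfolding hideal_def by auto
  show n: "p \<in> I \<Longrightarrow> - p \<in> I" for p using *(3)[of p "-1"] by simp
  show "p \<in> I \<Longrightarrow> q \<in> I \<Longrightarrow> p - q \<in> I" using *(2)[of p "-q"] n by simp
  show "p \<in> I \<Longrightarrow> p * c \<in> I" using *(3)[of p c] by (simp add: mult.commute)
qed

lemma hideal_sum: "hideal I \<Longrightarrow> (\<And>x. x \<in> X \<Longrightarrow> f x \<in> I) \<Longrightarrow> sum f X \<in> I"
  by (induction X rule: infinite_finite_induct) (auto intro: hidealD)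

lemma hideal_mapp: "hideal I \<Longrightarrow> (\<And>j. j < c \<Longrightarrow> v j \<in> I) \<Longrightarrow> mapp A c v r \<in> I"
  unfolding mapp_def by (rule hideal_sum) (auto intro: hidealD(3))

text \<open>A graded submodule of \<open>(S/I)\<^sup>b\<close>, given by its preimage among all sequences: membership only
  depends on the entries below \<open>b\<close>, and on these only modulo \<open>I\<close>.\<close>
definition submod :: "'a set \<Rightarrow> nat \<Rightarrow> (nat \<Rightarrow> 'a) set \<Rightarrow> bool" where
  "submod I b N \<longleftrightarrow> (\<lambda>_. 0) \<in> N \<and> (\<forall>u\<in>N. \<forall>v. (\<forall>i<b. v i - u i \<in> I) \<longrightarrow> v \<in> N) \<and>
     (\<forall>u\<in>N. \<forall>v\<in>N. (\<lambda>i. u i + v i) \<in> N) \<and> (\<forall>k. \<forall>u\<in>N. (\<lambda>i. k * u i) \<in> N) \<and>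
     (\<forall>u\<in>N. \<forall>d. (\<lambda>i. hc d (u i)) \<in> N)"

lemma submodD:
  assumes "submod I b N"
  shows "(\<lambda>_. 0) \<in> N" "u \<in> N \<Longrightarrow> (\<And>i. i < b \<Longrightarrow> v i - u i \<in> I) \<Longrightarrow> v \<in> N"
    "u \<in> N \<Longrightarrow> v \<in> N \<Longrightarrow> (\<lambda>i. u i + v i) \<in> N" "u \<in> N \<Longrightarrow> (\<lambda>i. k * u i) \<in> N"
    "u \<in> N \<Longrightarrow> (\<lambda>i. hc d (u i)) \<in> N" "u \<in> N \<Longrightarrow> v \<in> N \<Longrightarrow> (\<lambda>i. u i - v i) \<in> N"
proof -
  show *: "(\<lambda>_. 0) \<in> N" "u \<in> N \<Longrightarrow> (\<And>i. i < b \<Longrightarrow> v i - u i \<in> I) \<Longrightarrow> v \<in> N"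
    "u \<in> N \<Longrightarrow> v \<in> N \<Longrightarrow> (\<lambda>i. u i + v i) \<in> N" "u \<in> N \<Longrightarrow> (\<lambda>i. k * u i) \<in> N"
    "u \<in> N \<Longrightarrow> (\<lambda>i. hc d (u i)) \<in> N" for u v k d
    using assms unfolding submod_def by blast+
  show "u \<in> N \<Longrightarrow> v \<in> N \<Longrightarrow> (\<lambda>i. u i - v i) \<in> N"
    using *(3)[of u "\<lambda>i. -1 * v i"] *(4)[of v "-1"] by simp
qed

lemma submod_sum:
  assumes "submod I b N" "\<And>x. x \<in> X \<Longrightarrow> f x \<in> N"
  shows "(\<lambda>i. \<Sum>x\<in>X. f x i) \<in> N"
  using assms(2)
proof (induction X rule: infinite_finite_induct)
  case (insert x F)
  then show ?case using submodD(3)[OF assms(1), of "f x" "\<lambda>i. \<Sum>x\<in>F. f x i"] by simp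
qed (auto intro: submodD(1)[OF assms(1)])

definition pres :: "'a set \<Rightarrow> nat \<Rightarrow> (nat \<Rightarrow> 'a) set \<Rightarrow> nat \<Rightarrow> (nat \<Rightarrow> nat \<Rightarrow> 'a) \<Rightarrow> bool" where
  "pres I b N c A \<longleftrightarrow> linear_mat A b c \<and>
     (\<forall>u. u \<in> N \<longleftrightarrow> (\<exists>w. \<forall>r<b. u r - mapp A c w r \<in> I))"

text \<open>(S/I)^c modulo this kernel is the image of \<open>A\<close>, that is, the syzygy module
  of the module presented by \<open>A\<close>. Statements about \<open>kern\<close> as a module of
  relations are therefore statements about syzygy modules.\<close>

definition kern :: "'a set \<Rightarrow> nat \<Rightarrow> nat \<Rightarrow> (nat \<Rightarrow> nat \<Rightarrow> 'a) \<Rightarrow> (nat \<Rightarrow> 'a) set" where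
  "kern I b c A = {w. \<forall>r<b. mapp A c w r \<in> I}"

lemma submod_kern:
  assumes "hideal I" "linear_mat A b c"
  shows "submod I c (kern I b c A)"
  unfolding submod_def kern_def
proof (intro conjI ballI allI impI, goal_cases)
  case (2 u v)
  have "mapp A c v r = mapp A c (\<lambda>j. v j - u j) r + mapp A c u r" for r by (simp add: mapp_diff)
  moreover have "mapp A c (\<lambda>j. v j - u j) r \<in> I" for r
    using 2 by (intro hideal_mapp assms) auto
  ultimately show ?case using 2 assms by (auto intro: hidealD)
next
  case (5 u d)
  have "mapp A c (\<lambda>i. hc d (u i)) r \<in> I" if "r < b" for r
    using hidealD(4)[OF assms(1), of "mapp A c u r" "Suc d"] 5 that hc_mapp(1)[OF assms(2) that] by auto
  then show ?case by auto
qed (auto simp: mapp_add mapp_scale intro: hidealD[OF assms(1)])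

text \<open>The module \<open>(S/I)\<^sup>b/N\<close> has a linear resolution.\<close>
coinductive lin :: "'a set \<Rightarrow> nat \<Rightarrow> (nat \<Rightarrow> 'a) set \<Rightarrow> bool" for I where
  "pres I b N c A \<Longrightarrow> lin I c (kern I b c A) \<Longrightarrow> lin I b N"

text \<open>The closure of a class \<open>X\<close> of modules \<open>(S/I)\<^sup>b/N\<close> under extensions.\<close>
inductive exts :: "'a set \<Rightarrow> (nat \<Rightarrow> (nat \<Rightarrow> 'a) set \<Rightarrow> bool) \<Rightarrow> nat \<Rightarrow> (nat \<Rightarrow> 'a) set \<Rightarrow> bool"
  for I X where
  base: "X b N \<Longrightarrow> exts I X b N"
| ext: "exts I X b N1 \<Longrightarrow> exts I X c N2 \<Longrightarrow> submod I (b + c) N \<Longrightarrow>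
    (\<And>u. (\<forall>i<c. u (b + i) = 0) \<Longrightarrow> u \<in> N \<longleftrightarrow> u \<in> N1) \<Longrightarrow>
    (\<And>w. w \<in> N2 \<longleftrightarrow> (\<exists>u\<in>N. \<forall>i<c. u (b + i) = w i)) \<Longrightarrow> exts I X (b + c) N"

lemma mapp_append:
  "mapp A (c1 + c2) w r = mapp A c1 w r + mapp (\<lambda>r j. A r (c1 + j)) c2 (\<lambda>j. w (c1 + j)) r"
  by (induction c2) (simp_all add: mapp_def add_ac)

end

section \<open>Horseshoe lemma, syzygies of extensions, change of rings\<close>

context graded
begin

text \<open>The horseshoe lemma for one step of a linear resolution.\<close>
lemma pres_ext:
  assumes I: "hideal I" and p1: "pres I b N1 c1 A1" and p2: "pres I c N2 c2 A2"
    and N: "submod I (b + c) N"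
    and N1: "\<And>u. (\<forall>i<c. u (b + i) = 0) \<Longrightarrow> u \<in> N \<longleftrightarrow> u \<in> N1"
    and N2: "\<And>w. w \<in> N2 \<longleftrightarrow> (\<exists>u\<in>N. \<forall>i<c. u (b + i) = w i)"
  obtains A where "pres I (b + c) N (c1 + c2) A"
    "submod I (c1 + c2) (kern I (b + c) (c1 + c2) A)"
    "\<And>u. (\<forall>i<c2. u (c1 + i) = 0) \<Longrightarrow> u \<in> kern I (b + c) (c1 + c2) A \<longleftrightarrow> u \<in> kern I b c1 A1"
    "\<And>w. w \<in> kern I c c2 A2 \<longleftrightarrow> (\<exists>u\<in>kern I (b + c) (c1 + c2) A. \<forall>i<c2. u (c1 + i) = w i)"
proof -
  note I' = hidealD[OF I] and N' = submodD[OF N]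
  have A1: "linear_mat A1 b c1" and P1: "\<And>u. u \<in> N1 \<longleftrightarrow> (\<exists>w. \<forall>r<b. u r - mapp A1 c1 w r \<in> I)"
    using p1 unfolding pres_def by auto
  have A2: "linear_mat A2 c c2" and P2: "\<And>u. u \<in> N2 \<longleftrightarrow> (\<exists>w. \<forall>r<c. u r - mapp A2 c2 w r \<in> I)"
    using p2 unfolding pres_def by auto
  \<comment> \<open>Each column of \<open>A2\<close> lies in \<open>N2\<close> and so is the lower
    block of a vector of \<open>N\<close>. Its component of degree 1 stays in \<open>N\<close> and
    over the same column, which keeps the lifted columns linear.\<close>
  have "\<forall>j. j < c2 \<longrightarrow> (\<exists>u\<in>N. \<forall>i. (i < c \<longrightarrow> u (b + i) = A2 i j) \<and> hc 1 (u i) = u i)"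
  proof (intro allI impI)
    fix j assume j: "j < c2"
    have "(\<lambda>i. A2 i j) \<in> N2"
      unfolding P2
      by (rule exI[of _ "\<lambda>i. if i = j then 1 else 0"]) (use j I'(1) in \<open>simp add: mapp_unit\<close>)
    then obtain u where u: "u \<in> N" "\<forall>i<c. u (b + i) = A2 i j" unfolding N2 by auto
    show "\<exists>u\<in>N. \<forall>i. (i < c \<longrightarrow> u (b + i) = A2 i j) \<and> hc 1 (u i) = u i"
      by (rule bexI[OF _ N'(5)[OF u(1), of 1]]) (use u A2 j in \<open>auto simp: hc_hc\<close>)
  qed
  then obtain B where B: "\<And>j. j < c2 \<Longrightarrow> B j \<in> N" "\<And>j i. j < c2 \<Longrightarrow> i < c \<Longrightarrow> B j (b + i) = A2 i j"
    "\<And>j i. j < c2 \<Longrightarrow> hc 1 (B j i) = B j i" by metis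
  \<comment> \<open>Block triangular: the columns of \<open>A1\<close> padded by zeros, then the
    lifts \<open>B\<close> of the columns of \<open>A2\<close>.\<close>
  define A where "A r j = (if j < c1 then (if r < b then A1 r j else 0) else B (j - c1) r)" for r j
  let ?B = "\<lambda>w r. mapp (\<lambda>r j. B j r) c2 w r"
  have A: "mapp A (c1 + c2) w r = (if r < b then mapp A1 c1 w r else 0) + ?B (\<lambda>j. w (c1 + j)) r" for w r
    unfolding mapp_append by (auto simp: mapp_def A_def)
  have A': "?B w (b + i) = mapp A2 c2 w i" if "i < c" for w i
    using that B(2) by (auto simp: mapp_def intro!: sum.cong)
  have BN: "?B w \<in> N" for w
    unfolding mapp_def using B(1)
    by (intro submod_sum[OF N]) (auto simp: mult.commute[of _ "w _"] intro: N'(4))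
  have cut: "(\<lambda>r. if r < b then u r else 0) \<in> N1" if "u \<in> N" "\<forall>i<c. u (b + i) \<in> I" for u
  proof -
    have "(\<lambda>r. if r < b then u r else 0) \<in> N"
    proof (rule N'(2)[OF that(1)])
      fix i assume "i < b + c"
      then show "(if i < b then u i else 0) - u i \<in> I"
        using that(2)[rule_format, of "i - b"] I' by auto
    qed
    then show ?thesis by (subst N1[symmetric]) auto
  qed
  have lin: "linear_mat A (b + c) (c1 + c2)"
    unfolding A_def using A1 B(3) by auto
  have pres: "pres I (b + c) N (c1 + c2) A"
    unfolding pres_def
  proof (intro conjI lin, intro allI iffI)
    fix u assume u: "u \<in> N"
    then have "(\<lambda>i. u (b + i)) \<in> N2" unfolding N2 by auto
    then obtain w2 where w2: "\<forall>i<c. u (b + i) - mapp A2 c2 w2 i \<in> I" unfolding P2 by auto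
    have "(\<lambda>r. u r - ?B w2 r) \<in> N" by (rule N'(6)[OF u BN])
    from cut[OF this] w2 A' have "(\<lambda>r. if r < b then u r - ?B w2 r else 0) \<in> N1" by auto
    then obtain w1 where w1: "\<forall>r<b. (u r - ?B w2 r) - mapp A1 c1 w1 r \<in> I" unfolding P1 by auto
    let ?w = "\<lambda>j. if j < c1 then w1 j else w2 (j - c1)"
    have *: "mapp A (c1 + c2) ?w r = (if r < b then mapp A1 c1 w1 r else 0) + ?B w2 r" for r
      unfolding A by simp
    have "u r - mapp A (c1 + c2) ?w r \<in> I" if "r < b + c" for r
    proof (cases "r < b")
      case True
      then show ?thesis using w1 unfolding * by (simp add: algebra_simps)
    next
      case False
      then obtain i where "r = b + i" by (metis le_iff_add not_less)
      moreover have "i < c" using that calculation by simp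
      ultimately show ?thesis using w2 A'[of i w2] unfolding * by simp
    qed
    then show "\<exists>w. \<forall>r<b + c. u r - mapp A (c1 + c2) w r \<in> I" by blast
  next
    fix u assume "\<exists>w. \<forall>r<b + c. u r - mapp A (c1 + c2) w r \<in> I"
    then obtain w where w: "\<forall>r<b + c. u r - mapp A (c1 + c2) w r \<in> I" by auto
    have "\<forall>r<b. (\<lambda>r. if r < b then mapp A1 c1 w r else 0) r - mapp A1 c1 w r \<in> I" using I' by simp
    then have "(\<lambda>r. if r < b then mapp A1 c1 w r else 0) \<in> N1"
      unfolding P1 by blast
    then have "(\<lambda>r. if r < b then mapp A1 c1 w r else 0) \<in> N" by (subst N1) auto
    from N'(3)[OF this BN] have "mapp A (c1 + c2) w \<in> N" by (subst A[abs_def])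
    then show "u \<in> N" by (rule N'(2)) (use w in blast)
  qed
  show ?thesis
  proof (rule that[OF pres submod_kern[OF I lin]])
    fix u :: "nat \<Rightarrow> 'a" assume u: "\<forall>i<c2. u (c1 + i) = 0"
    have "mapp A (c1 + c2) u r = (if r < b then mapp A1 c1 u r else 0)" for r
      unfolding A using u by (simp add: mapp_def)
    then show "u \<in> kern I (b + c) (c1 + c2) A \<longleftrightarrow> u \<in> kern I b c1 A1"
      unfolding kern_def using I' by auto
  next
    fix w
    show "w \<in> kern I c c2 A2 \<longleftrightarrow> (\<exists>u\<in>kern I (b + c) (c1 + c2) A. \<forall>i<c2. u (c1 + i) = w i)"
    proof
      assume w: "w \<in> kern I c c2 A2"
      \<comment> \<open>For a syzygy \<open>w\<close> of \<open>A2\<close> the lower block of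
        \<open>?B w\<close> vanishes modulo \<open>I\<close>, so its upper block lies in
        \<open>N1\<close> and can be cancelled by columns of \<open>A1\<close>. This lifts
        \<open>w\<close> to a syzygy of \<open>A\<close>.\<close>
      have "(\<lambda>r. if r < b then ?B w r else 0) \<in> N1"
        using w by (intro cut[OF BN]) (auto simp: A' kern_def)
      then obtain v where v: "\<forall>r<b. ?B w r - mapp A1 c1 v r \<in> I" unfolding P1 by auto
      let ?w = "\<lambda>j. if j < c1 then - 1 * v j else w (j - c1)"
      have *: "mapp A (c1 + c2) ?w r = (if r < b then - 1 * mapp A1 c1 v r else 0) + ?B w r" for r
        unfolding A mapp_scale[symmetric] by simp
      have "mapp A (c1 + c2) ?w r \<in> I" if "r < b + c" for r
      proof (cases "r < b")
        case True
        then show ?thesis using v unfolding * by simp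
      next
        case False
        then obtain i where "r = b + i" by (metis le_iff_add not_less)
      moreover have "i < c" using that calculation by simp
      ultimately show ?thesis using w A'[of i w] unfolding * by (simp add: kern_def)
      qed
      then show "\<exists>u\<in>kern I (b + c) (c1 + c2) A. \<forall>i<c2. u (c1 + i) = w i"
        by (intro bexI[of _ ?w]) (auto simp: kern_def)
    next
      assume "\<exists>u\<in>kern I (b + c) (c1 + c2) A. \<forall>i<c2. u (c1 + i) = w i"
      then obtain u where u: "u \<in> kern I (b + c) (c1 + c2) A" "\<forall>i<c2. u (c1 + i) = w i" by auto
      have "mapp A2 c2 w i \<in> I" if "i < c" for i
      proof -
        have "mapp A (c1 + c2) u (b + i) = ?B (\<lambda>j. u (c1 + j)) (b + i)" unfolding A by simp
        also have "\<dots> = mapp A2 c2 (\<lambda>j. u (c1 + j)) i" using A' that by simp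
        also have "\<dots> = mapp A2 c2 w i" using u(2) by simp
        finally have eq: "mapp A (c1 + c2) u (b + i) = mapp A2 c2 w i" .
        have "mapp A (c1 + c2) u (b + i) \<in> I" using u(1) that by (simp add: kern_def)
        then show ?thesis by (simp only: eq)
      qed
      then show "w \<in> kern I c c2 A2" by (simp add: kern_def)
    qed
  qed
qed

lemma exts_pres:
  assumes I: "hideal I"
    and X: "\<And>b N. X b N \<Longrightarrow> \<exists>c A. pres I b N c A \<and> exts I X c (kern I b c A)"
    and "exts I X b N"
  shows "\<exists>c A. pres I b N c A \<and> exts I X c (kern I b c A)"
  using assms(3)
proof induction
  case (ext b N1 c N2 N)
  then obtain c1 A1 c2 A2 where
    p: "pres I b N1 c1 A1" "exts I X c1 (kern I b c1 A1)"
       "pres I c N2 c2 A2" "exts I X c2 (kern I c c2 A2)" by blast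
  from pres_ext[OF I p(1,3) ext.hyps(3-5)] obtain A where A: "pres I (b + c) N (c1 + c2) A"
    "submod I (c1 + c2) (kern I (b + c) (c1 + c2) A)"
    "\<And>u. (\<forall>i<c2. u (c1 + i) = 0) \<Longrightarrow> u \<in> kern I (b + c) (c1 + c2) A \<longleftrightarrow> u \<in> kern I b c1 A1"
    "\<And>w. w \<in> kern I c c2 A2 \<longleftrightarrow> (\<exists>u\<in>kern I (b + c) (c1 + c2) A. \<forall>i<c2. u (c1 + i) = w i)"
    by blast
  have "exts I X (c1 + c2) (kern I (b + c) (c1 + c2) A)"
    by (rule exts.ext[OF p(2,4) A(2-4)])
  with A(1) show ?case by blast
qed (rule X)

text \<open>By the horseshoe lemma the closure \<open>exts I X\<close> is stable under passing to
  syzygies, hence an invariant for the coinduction. Only the generating class \<open>X\<close> has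
  to be checked.\<close>

lemma exts_lin:
  assumes I: "hideal I"
    and X: "\<And>b N. X b N \<Longrightarrow> \<exists>c A. pres I b N c A \<and> exts I X c (kern I b c A)"
    and "exts I X b N"
  shows "lin I b N"
  using assms(3)
proof (coinduction arbitrary: b N)
  case (lin b N)
  from exts_pres[OF I X this] obtain c A where "pres I b N c A" "exts I X c (kern I b c A)" by blast
  then show ?case by blast
qed

lemma submod_power: "hideal I \<Longrightarrow> hideal Q \<Longrightarrow> I \<subseteq> Q \<Longrightarrow> submod I b {u. \<forall>i<b. u i \<in> Q}"
  unfolding submod_def
proof (intro conjI ballI allI impI CollectI, goal_cases)
  case (2 u v i)
  then have "(v i - u i) + u i \<in> Q" by (intro hidealD(2)) auto
  then show ?case by simp
qed (auto intro: hidealD)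

text \<open>Copies of S/Q are adjoined one at a time. In rank 0 the relations \<open>UNIV\<close>
  give the zero module, where the induction starts.\<close>

lemma exts_power:
  assumes I: "hideal I" "hideal Q" "I \<subseteq> Q" and X: "exts I X 0 UNIV" "exts I X 1 {u. u 0 \<in> Q}"
  shows "exts I X b {u. \<forall>i<b. u i \<in> Q}"
proof (induction b)
  case (Suc b)
  have "exts I X (b + 1) {u. \<forall>i<b+1. u i \<in> Q}"
  proof (rule exts.ext[OF Suc X(2)])
    show "submod I (b + 1) {u. \<forall>i<b + 1. u i \<in> Q}" by (rule submod_power[OF I])
    show "(w \<in> {u. u 0 \<in> Q}) = (\<exists>u\<in>{u. \<forall>i<b + 1. u i \<in> Q}. \<forall>i<1. u (b + i) = w i)" for w
    proof safe
      assume "w 0 \<in> Q"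
      then show "\<exists>u\<in>{u. \<forall>i<b + 1. u i \<in> Q}. \<forall>i<1. u (b + i) = w i"
        using hidealD(1)[OF I(2)] by (intro bexI[of _ "\<lambda>i. if i = b then w 0 else 0"]) auto
    qed auto
    show "(u \<in> {u. \<forall>i<b + 1. u i \<in> Q}) = (u \<in> {u. \<forall>i<b. u i \<in> Q})" if "\<forall>i<1. u (b + i) = 0" for u
      using that hidealD(1)[OF I(2)] by (auto simp: less_Suc_eq)
  qed
  then show ?case by simp
qed (use X in simp)

text \<open>The syzygies of a row \<open>a\<^sub>0, a\<^sub>1, \<dots>\<close> are filtered with quotients given by the colon
  ideals \<open>(a\<^sub>0, \<dots>, a\<^sub>j\<^sub>-\<^sub>1) : a\<^sub>j\<close>.\<close>
lemma exts_row:
  assumes I: "hideal I" and X: "exts I X 0 UNIV"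
    and a: "\<And>j. j < m \<Longrightarrow> hc 1 (a j) = a j"
    and c: "\<And>j. j < m \<Longrightarrow> exts I X 1 {u. \<exists>v. mapp (\<lambda>_ i. a i) j v 0 + a j * u 0 \<in> I}"
  shows "exts I X m (kern I 1 m (\<lambda>_ j. a j))"
  using a c
proof (induction m)
  case 0
  have "kern I 1 0 (\<lambda>_ j. a j) = UNIV" using hidealD[OF I] by (auto simp: kern_def)
  then show ?case using X by simp
next
  case (Suc m)
  have "exts I X (m + 1) (kern I 1 (m + 1) (\<lambda>_ j. a j))"
  proof (rule exts.ext[OF Suc.IH Suc.prems(2)])
    show "submod I (m + 1) (kern I 1 (m + 1) (\<lambda>_. a))"
      by (rule submod_kern[OF I]) (use Suc in auto)
    show "(w \<in> {u. \<exists>v. mapp (\<lambda>_. a) m v 0 + a m * u 0 \<in> I}) \<longleftrightarrow>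
         (\<exists>u\<in>kern I 1 (m + 1) (\<lambda>_. a). \<forall>i<1. u (m + i) = w i)" for w
    proof safe
      fix v assume v: "mapp (\<lambda>_. a) m v 0 + a m * w 0 \<in> I"
      have "mapp (\<lambda>_. a) (m+1) (\<lambda>i. if i < m then v i else w 0) 0 = mapp (\<lambda>_. a) m v 0 + a m * w 0"
        by (simp add: mapp_def)
      then show "\<exists>u\<in>kern I 1 (m + 1) (\<lambda>_. a). \<forall>i<1. u (m + i) = w i"
        using v by (intro bexI[of _ "\<lambda>i. if i < m then v i else w 0"]) (auto simp: kern_def)
    next
      fix u assume "u \<in> kern I 1 (m + 1) (\<lambda>_. a)" "\<forall>i<1. u (m + i) = w i"
      then have "mapp (\<lambda>_. a) m u 0 + a m * w 0 \<in> I" by (simp add: kern_def mapp_def)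
      then show "\<exists>v. mapp (\<lambda>_. a) m v 0 + a m * w 0 \<in> I" by blast
    qed
  qed (use Suc in \<open>auto simp: kern_def mapp_def\<close>)
  then show ?case by simp
qed

text \<open>A linear presentation over \<open>S/I'\<close>, where \<open>I' = I + (x, y)\<close>, becomes one over \<open>S/I\<close> by adjoining
  the columns \<open>x e\<^sub>r\<close> and \<open>y e\<^sub>r\<close>.\<close>
lemma pres_change_ring:
  assumes I: "hideal I" "hideal I'" "hideal Q" "I \<subseteq> Q" and xy: "hc 1 x = x" "hc 1 y = y"
    and I': "\<And>p. p \<in> I' \<longleftrightarrow> (\<exists>q1 q2. p - x * q1 - y * q2 \<in> I)"
    and x: "\<And>p. x * p \<in> I \<longleftrightarrow> p \<in> I"
    and Q: "\<And>q. q \<in> Q \<longleftrightarrow> (\<exists>p. x * p + y * q \<in> I)"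
    and X: "exts I X 0 UNIV" "exts I X 1 {u. u 0 \<in> I}" "exts I X 1 {u. u 0 \<in> Q}"
      "X c (kern I' b c A)"
    and p: "pres I' b N c A"
  shows "\<exists>c A. pres I b N c A \<and> exts I X c (kern I b c A)"
proof -
  note I1 = hidealD[OF I(1)]
  have A: "linear_mat A b c" and P: "\<And>u. u \<in> N \<longleftrightarrow> (\<exists>w. \<forall>r<b. u r - mapp A c w r \<in> I')"
    using p unfolding pres_def by auto
  define B where "B r j = (if j < b then (if j = r then x else 0) else
     if j < b + b then (if j = b + r then y else 0) else A r (j - (b + b)))" for r j
  have B: "mapp B (b + b + c) w r = x * w r + y * w (b + r) + mapp A c (\<lambda>j. w (b + b + j)) r"
    if "r < b" for w r
    unfolding mapp_append using that by (auto simp: mapp_def B_def if_distrib[of "\<lambda>x. x * _"] cong: if_cong)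
  have lin: "linear_mat B b (b + b + c)" using A xy by (auto simp: B_def)
  \<comment> \<open>Relations among the columns of \<open>x\<close> and \<open>y\<close> alone. The
    columns of \<open>x\<close> span a free module because \<open>x\<close> is regular; modulo
    these, the columns of \<open>y\<close> span a copy of (S/Q)^b.\<close>
  define xyrel where "xyrel = {w. \<forall>r<b. x * w r + y * w (b + r) \<in> I}"
  have "exts I X (b + b) xyrel"
  proof (rule exts.ext[OF exts_power[OF I(1) I(1) subset_refl X(1,2), of b]
        exts_power[OF I(1,3,4) X(1,3), of b]])
    have "xyrel = kern I b (b + b) B"
      unfolding xyrel_def kern_def mapp_append
      by (auto simp: mapp_def B_def if_distrib[of "\<lambda>x. x * _"] cong: if_cong)
    moreover have "linear_mat B b (b + b)" using lin by auto
    ultimately show "submod I (b + b) xyrel" using submod_kern[OF I(1)] by simp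
    show "(u \<in> xyrel) = (u \<in> {u. \<forall>i<b. u i \<in> I})" if "\<forall>i<b. u (b + i) = 0" for u
      using that x by (auto simp: xyrel_def)
    show "w \<in> {u. \<forall>i<b. u i \<in> Q} \<longleftrightarrow> (\<exists>u\<in>xyrel. \<forall>i<b. u (b + i) = w i)" for w
    proof safe
      assume "\<forall>i<b. w i \<in> Q"
      then obtain p where p: "\<forall>i<b. x * p i + y * w i \<in> I" unfolding Q by metis
      show "\<exists>u\<in>xyrel. \<forall>i<b. u (b + i) = w i"
        by (rule bexI[of _ "\<lambda>i. if i < b then p i else w (i - b)"]) (use p in \<open>auto simp: xyrel_def\<close>)
    next
      fix u i assume "u \<in> xyrel" "\<forall>i<b. u (b + i) = w i" "i < b"
      then have "x * u i + y * w i \<in> I" by (auto simp: xyrel_def)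
      then show "w i \<in> Q" unfolding Q by blast
    qed
  qed
  \<comment> \<open>Modulo the columns of \<open>x\<close> and \<open>y\<close>, a relation among
    the columns of \<open>A\<close> is a relation over S/I', so the remaining quotient is the syzygy
    module over S/I'.\<close>
  then have "exts I X (b + b + c) (kern I b (b + b + c) B)"
  proof (rule exts.ext[OF _ exts.base[of X, OF X(4)]])
    show "submod I (b + b + c) (kern I b (b + b + c) B)" by (rule submod_kern[OF I(1) lin])
    show "(u \<in> kern I b (b + b + c) B) = (u \<in> xyrel)" if "\<forall>i<c. u (b + b + i) = 0" for u
      using that by (simp add: kern_def xyrel_def B)
    show "w \<in> kern I' b c A \<longleftrightarrow> (\<exists>u\<in>kern I b (b + b + c) B. \<forall>i<c. u (b + b + i) = w i)" for w
    proof safe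
      assume "w \<in> kern I' b c A"
      then have "\<forall>r<b. \<exists>q1 q2. mapp A c w r - x * q1 - y * q2 \<in> I"
        unfolding kern_def I' by simp
      then obtain q1 q2 where q: "\<forall>r<b. mapp A c w r - x * q1 r - y * q2 r \<in> I" by metis
      let ?u = "\<lambda>j. if j < b then - q1 j else if j < b + b then - q2 (j - b) else w (j - (b + b))"
      have "mapp B (b + b + c) ?u r = mapp A c w r - x * q1 r - y * q2 r" if "r < b" for r
        unfolding B[OF that] using that by (simp add: algebra_simps)
      then show "\<exists>u\<in>kern I b (b + b + c) B. \<forall>i<c. u (b + b + i) = w i"
        using q by (intro bexI[of _ ?u]) (auto simp: kern_def)
    next
      fix u assume u: "u \<in> kern I b (b + b + c) B" "\<forall>i<c. u (b + b + i) = w i"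
      have "mapp A c w r \<in> I'" if "r < b" for r
      proof -
        have "mapp B (b + b + c) u r = mapp A c w r - x * - u r - y * - u (b + r)"
          unfolding B[OF that] using u(2) by simp
        moreover have "mapp B (b + b + c) u r \<in> I" using u(1) that by (simp add: kern_def)
        ultimately have "mapp A c w r - x * - u r - y * - u (b + r) \<in> I" by (simp only:)
        then show ?thesis unfolding I' by blast
      qed
      then show "w \<in> kern I' b c A" by (simp add: kern_def)
    qed
  qed
  moreover have "pres I b N (b + b + c) B"
    unfolding pres_def
  proof (intro conjI lin, intro allI iffI)
    fix u assume "u \<in> N"
    then obtain w where "\<forall>r<b. \<exists>q1 q2. u r - mapp A c w r - x * q1 - y * q2 \<in> I"
      unfolding P I' by auto
    then obtain q1 q2 where q: "\<forall>r<b. u r - mapp A c w r - x * q1 r - y * q2 r \<in> I" by metis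
    let ?u = "\<lambda>j. if j < b then q1 j else if j < b + b then q2 (j - b) else w (j - (b + b))"
    have "u r - mapp B (b + b + c) ?u r \<in> I" if "r < b" for r
    proof -
      have "u r - mapp B (b + b + c) ?u r = u r - mapp A c w r - x * q1 r - y * q2 r"
        unfolding B[OF that] using that by simp
      then show ?thesis using q that by (simp only:)
    qed
    then show "\<exists>w. \<forall>r<b. u r - mapp B (b + b + c) w r \<in> I" by blast
  next
    fix u assume "\<exists>w. \<forall>r<b. u r - mapp B (b + b + c) w r \<in> I"
    then obtain w where w: "\<forall>r<b. u r - mapp B (b + b + c) w r \<in> I" by blast
    have "u r - mapp A c (\<lambda>j. w (b + b + j)) r \<in> I'" if "r < b" for r
    proof -
      have "u r - mapp B (b + b + c) w r =
          u r - mapp A c (\<lambda>j. w (b + b + j)) r - x * w r - y * w (b + r)"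
        unfolding B[OF that] by simp
      then have "u r - mapp A c (\<lambda>j. w (b + b + j)) r - x * w r - y * w (b + r) \<in> I"
        using w that by metis
      then show ?thesis unfolding I' by blast
    qed
    then show "u \<in> N" unfolding P by blast
  qed
  ultimately show ?thesis by blast
qed

end

section \<open>Resolutions of the residue field and finite bases in degree 1\<close>

context graded
begin

text \<open>\<open>F i\<close> is the differential from homological degree \<open>Suc i\<close> to degree \<open>i\<close>.\<close>
definition reso :: "'a set \<Rightarrow> (nat \<Rightarrow> nat) \<Rightarrow> (nat \<Rightarrow> nat \<Rightarrow> nat \<Rightarrow> 'a) \<Rightarrow> bool" where
  "reso I f F \<longleftrightarrow> f 0 = 1 \<and> (\<forall>i. linear_mat (F i) (f i) (f (Suc i))) \<and>
     (\<forall>p. hc 0 p = 0 \<longleftrightarrow> (\<exists>w. p - mapp (F 0) (f 1) w 0 \<in> I)) \<and>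
     (\<forall>i w. \<forall>r<f i. diffl f F i (diffl f F (Suc i) w) r \<in> I) \<and>
     (\<forall>i v. (\<forall>r<f i. diffl f F i v r \<in> I) \<longrightarrow>
        (\<exists>w. \<forall>r<f (Suc i). v r - diffl f F (Suc i) w r \<in> I))"

abbreviation irrelevant_ideal :: "(nat \<Rightarrow> 'a) set" where
  "irrelevant_ideal \<equiv> {u. hc 0 (u 0) = 0}"

text \<open>\<open>lin\<close> promises one more step at each stage; dependent choice strings the
  steps into one sequence. A state consists of a rank, the relations, the next rank and the
  differential, and the clause for \<open>n = 0\<close> fixes the residue field as the
  start.\<close>

lemma lin_reso:
  assumes I: "hideal I" and "lin I 1 irrelevant_ideal"
  shows "\<exists>f F. reso I f F"
proof -
  define P where "P n s = (case s of (b, N, c, A) \<Rightarrow> pres I b N c A \<and> lin I c (kern I b c A) \<and>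
      (n = 0 \<longrightarrow> b = 1 \<and> N = irrelevant_ideal))"
    for n :: nat and s :: "nat \<times> (nat \<Rightarrow> 'a) set \<times> nat \<times> (nat \<Rightarrow> nat \<Rightarrow> 'a)"
  define Q where "Q n s s' = (case s of (b, N, c, A) \<Rightarrow> case s' of (b', N', c', A') \<Rightarrow>
      b' = c \<and> N' = kern I b c A)"
    for n :: nat and s s' :: "nat \<times> (nat \<Rightarrow> 'a) set \<times> nat \<times> (nat \<Rightarrow> nat \<Rightarrow> 'a)"
  have "\<exists>s. \<forall>n. P n (s n) \<and> Q n (s n) (s (Suc n))"
  proof (rule dependent_nat_choice)
    show "\<exists>s. P 0 s" using assms(2) by (cases rule: lin.cases) (auto simp: P_def)
  next
    fix s n assume s: "P n s"
    obtain b N c A where [simp]: "s = (b, N, c, A)" by (cases s)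
    from s have "lin I c (kern I b c A)" by (simp add: P_def)
    then show "\<exists>s'. P (Suc n) s' \<and> Q n s s'"
      by (cases rule: lin.cases) (auto simp: P_def Q_def)
  qed
  then obtain s where s: "\<And>n. P n (s n)" "\<And>n. Q n (s n) (s (Suc n))" by auto
  define f where "f n = fst (s n)" for n
  define N where "N n = fst (snd (s n))" for n
  define c where "c n = fst (snd (snd (s n)))" for n
  define F where "F n = snd (snd (snd (s n)))" for n
  have s': "s n = (f n, N n, c n, F n)" for n
    by (simp add: f_def N_def c_def F_def)
  have c: "c n = f (Suc n)" and NS: "N (Suc n) = kern I (f n) (f (Suc n)) (F n)" for n
    using s(2)[of n] by (auto simp: s' Q_def)
  have 0: "f 0 = 1" "N 0 = irrelevant_ideal" using s(1)[of 0] by (auto simp: s' P_def)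
  have p: "pres I (f n) (N n) (f (Suc n)) (F n)" for n using s(1)[of n] c by (simp add: s' P_def)
  have NE: "u \<in> N n \<longleftrightarrow> (\<exists>w. \<forall>r<f n. u r - diffl f F n w r \<in> I)" for u n
    using p[of n] unfolding pres_def by blast
  have "reso I f F"
    unfolding reso_def
  proof (intro conjI allI impI)
    fix p
    have "(\<lambda>_. p) \<in> N 0 \<longleftrightarrow> (\<exists>w. p - mapp (F 0) (f 1) w 0 \<in> I)" unfolding NE[of _ 0] 0(1) One_nat_def[symmetric] by (simp only: less_one simp_thms all_simps)
    then show "hc 0 p = 0 \<longleftrightarrow> (\<exists>w. p - mapp (F 0) (f 1) w 0 \<in> I)" unfolding 0 by simp
  next
    fix i w r assume r: "r < f i"
    have "\<forall>r<f (Suc i). diffl f F (Suc i) w r - diffl f F (Suc i) w r \<in> I"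
      using hidealD(1)[OF I] by simp
    then have "diffl f F (Suc i) w \<in> N (Suc i)" unfolding NE by blast
    then show "diffl f F i (diffl f F (Suc i) w) r \<in> I"
      unfolding NS kern_def using r by blast
  next
    fix i v assume "\<forall>r<f i. diffl f F i v r \<in> I"
    then have "v \<in> N (Suc i)" unfolding NS kern_def by blast
    then show "\<exists>w. \<forall>r<f (Suc i). v r - diffl f F (Suc i) w r \<in> I"
      unfolding NE .
  qed (use p 0 in \<open>auto simp: pres_def\<close>)
  then show ?thesis by blast
qed

abbreviation "const_vec w \<equiv> (\<forall>j. hc 0 (w j) = w j)"

lemma const_mult: "hc 0 k = k \<Longrightarrow> hc 0 l = l \<Longrightarrow> hc 0 (k * l) = k * l"
  by (simp add: hc_mult[of 0])

text \<open>Linear algebra over the field of degree 0 elements: modulo \<open>I\<close>,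
  \<open>P\<close> lies in the span of \<open>q\<close> columns, and a basis of it is produced. The
  vectors that can do without the last column form a subspace of codimension at most one, so each
  step adds at most one basis vector. Independence later makes generators minimal.\<close>

lemma finite_basis:
  assumes I: "hideal I"
    and P: "(\<lambda>_. 0) \<in> P" "\<And>u v k. hc 0 k = k \<Longrightarrow> u \<in> P \<Longrightarrow> v \<in> P \<Longrightarrow> (\<lambda>r. u r + k * v r) \<in> P"
    and T: "\<And>u. u \<in> P \<Longrightarrow> \<exists>w. const_vec w \<and> (\<forall>r<b. u r - mapp T q w r \<in> I)"
  shows "\<exists>c A. (\<forall>j<c. (\<lambda>r. A r j) \<in> P) \<and>
    (\<forall>u\<in>P. \<exists>w. const_vec w \<and> (\<forall>r<b. u r - mapp A c w r \<in> I)) \<and>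
    (\<forall>w. const_vec w \<longrightarrow> (\<forall>r<b. mapp A c w r \<in> I) \<longrightarrow> (\<forall>j<c. w j = 0))"
  using P T
proof (induction q arbitrary: P)
  case 0
  from 0(3) have "\<forall>u\<in>P. \<exists>w. const_vec w \<and> (\<forall>r<b. u r - mapp T 0 w r \<in> I)" by blast
  then show ?case by (intro exI[of _ 0]) auto
next
  case (Suc q)
  note I' = hidealD[OF I]
  define rep where "rep q u w \<longleftrightarrow> const_vec w \<and> (\<forall>r<b. u r - mapp T q w r \<in> I)" for q u w
  have rep_add: "rep q (\<lambda>r. u r + k * v r) (\<lambda>j. w j + k * w' j)"
    if "hc 0 k = k" "rep q u w" "rep q v w'" for q u v w w' k
  proof -
    have *: "u r + k * v r - mapp T q (\<lambda>j. w j + k * w' j) r =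
        (u r - mapp T q w r) + k * (v r - mapp T q w' r)" for r
      by (simp add: mapp_add mapp_scale algebra_simps)
    have "u r + k * v r - mapp T q (\<lambda>j. w j + k * w' j) r \<in> I" if "r < b" for r
      unfolding * using that \<open>rep q u w\<close> \<open>rep q v w'\<close> by (auto simp: rep_def intro!: I'(2) I'(3))
    then show ?thesis using that by (simp add: rep_def hc_add const_mult)
  qed
  have rep_Suc: "rep (Suc q) u w \<longleftrightarrow> rep q u w" if "w q = 0" for u w
    using that by (simp add: rep_def mapp_def)
  define P' where "P' = {u\<in>P. \<exists>w. rep q u w}"
  have P': "(\<lambda>_. 0) \<in> P'" "\<And>u v k. hc 0 k = k \<Longrightarrow> u \<in> P' \<Longrightarrow> v \<in> P' \<Longrightarrow> (\<lambda>r. u r + k * v r) \<in> P'"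
  proof -
    have "rep q (\<lambda>_. 0) (\<lambda>_. 0)" using I' by (auto simp: rep_def)
    then show "(\<lambda>_. 0) \<in> P'" using Suc.prems(1) unfolding P'_def by blast
    show "\<And>u v k. hc 0 k = k \<Longrightarrow> u \<in> P' \<Longrightarrow> v \<in> P' \<Longrightarrow> (\<lambda>r. u r + k * v r) \<in> P'"
      using rep_add Suc.prems(2) unfolding P'_def by blast
  qed
  have "\<exists>c A. (\<forall>j<c. (\<lambda>r. A r j) \<in> P') \<and>
    (\<forall>u\<in>P'. \<exists>w. const_vec w \<and> (\<forall>r<b. u r - mapp A c w r \<in> I)) \<and>
    (\<forall>w. const_vec w \<longrightarrow> (\<forall>r<b. mapp A c w r \<in> I) \<longrightarrow> (\<forall>j<c. w j = 0))"
    by (rule Suc.IH[OF P']) (auto simp: P'_def rep_def)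
  then obtain c A where A0: "\<forall>j<c. (\<lambda>r. A r j) \<in> P'"
    "\<forall>u\<in>P'. \<exists>w. const_vec w \<and> (\<forall>r<b. u r - mapp A c w r \<in> I)"
    "\<forall>w. const_vec w \<longrightarrow> (\<forall>r<b. mapp A c w r \<in> I) \<longrightarrow> (\<forall>j<c. w j = 0)"
    by (elim exE conjE) (rule that)
  have A: "j < c \<Longrightarrow> (\<lambda>r. A r j) \<in> P'"
    "u \<in> P' \<Longrightarrow> \<exists>w. const_vec w \<and> (\<forall>r<b. u r - mapp A c w r \<in> I)"
    "const_vec w \<Longrightarrow> (\<forall>r<b. mapp A c w r \<in> I) \<Longrightarrow> j < c \<Longrightarrow> w j = 0" for u w j
    using A0(1) A0(2) A0(3) by (simp_all only:) blast+
  have comb: "mapp A m w \<in> P'" if "const_vec w" "m \<le> c" for w m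
    using that(2)
  proof (induction m)
    case 0
    then show ?case using P'(1) by (simp add: mapp_def[abs_def])
  next
    case (Suc m)
    then show ?case using P'(2)[of "w m" "mapp A m w" "\<lambda>r. A r m"] that A(1)[of m]
      by (simp add: mapp_def[abs_def] mult.commute)
  qed
  show ?case
  proof (cases "P = P'")
    case True
    then show ?thesis using A0 unfolding True by (intro exI conjI)
  next
    case False
    then obtain u0 where u0: "u0 \<in> P" "u0 \<notin> P'" unfolding P'_def by blast
    from Suc.prems(3)[OF u0(1)] obtain w0 where w0: "rep (Suc q) u0 w0" unfolding rep_def by blast
    have "w0 q \<noteq> 0"
    proof
      assume "w0 q = 0"
      then have "rep q u0 w0" using w0 rep_Suc by blast
      then show False using u0 unfolding P'_def by blast
    qed
    then obtain e where e: "hc 0 e = e" "e * w0 q = 1" using hc_unit[of "w0 q"] w0 by (auto simp: rep_def)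
    define B where "B r j = (if j < c then A r j else u0 r)" for r j
    have B: "mapp B (Suc c) w r = mapp A c w r + u0 r * w c" for w r
      by (simp add: mapp_def B_def)
    show ?thesis
    proof (intro exI[of _ "Suc c"] exI[of _ B] conjI allI impI ballI)
      show "(\<lambda>r. B r j) \<in> P" if "j < Suc c" for j
        using that A(1)[of j] u0 by (cases "j < c") (simp_all add: B_def P'_def)
    next
      fix u assume u: "u \<in> P"
      from Suc.prems(3)[OF this] obtain w where w: "rep (Suc q) u w" unfolding rep_def by blast
      \<comment> \<open>\<open>e\<close> inverts the last coefficient of \<open>u0\<close>, so
        adding this multiple of \<open>u0\<close> removes the last column from
        \<open>u\<close>.\<close>
      let ?k = "- (w q * e)"
      have k: "hc 0 ?k = ?k" using w e by (simp add: hc_uminus const_mult rep_def)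
      have "rep (Suc q) (\<lambda>r. u r + ?k * u0 r) (\<lambda>j. w j + ?k * w0 j)"
        by (rule rep_add[OF k w w0])
      moreover have "(\<lambda>j. w j + ?k * w0 j) q = 0" using e by (simp add: mult.assoc)
      ultimately have "rep q (\<lambda>r. u r + ?k * u0 r) (\<lambda>j. w j + ?k * w0 j)"
        by (simp only: rep_Suc)
      with Suc.prems(2)[OF k u u0(1)] have "(\<lambda>r. u r + ?k * u0 r) \<in> P'" unfolding P'_def by blast
      from A(2)[OF this] obtain w1 where w1: "const_vec w1"
        "\<forall>r<b. u r + ?k * u0 r - mapp A c w1 r \<in> I" by blast
      let ?w = "\<lambda>j. if j = c then w q * e else w1 j"
      have *: "u r - mapp B (Suc c) ?w r = u r + ?k * u0 r - mapp A c w1 r" for r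
        unfolding B by (simp add: algebra_simps)
      have "\<forall>r<b. u r - mapp B (Suc c) ?w r \<in> I" unfolding * using w1(2) .
      then show "\<exists>w. const_vec w \<and> (\<forall>r<b. u r - mapp B (Suc c) w r \<in> I)"
        using w1 w e by (intro exI[of _ ?w]) (auto simp: const_mult rep_def)
    next
      fix w j assume w: "const_vec w" "\<forall>r<b. mapp B (Suc c) w r \<in> I" "j < Suc c"
      have "w c = 0"
      proof (rule ccontr)
        \<comment> \<open>The relation could then be solved for \<open>u0\<close>, which would need
          only the first \<open>q\<close> columns.\<close>
        assume "w c \<noteq> 0"
        then obtain e where e: "hc 0 e = e" "e * w c = 1" using hc_unit w(1) by blast
        have "mapp A c w \<in> P'" by (rule comb[OF w(1) order_refl])
        then obtain w' where w': "rep q (mapp A c w) w'" unfolding P'_def by blast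
        have "rep q (\<lambda>r. 0 + (- e) * mapp A c w r) (\<lambda>j. 0 + (- e) * w' j)"
          by (rule rep_add[OF _ _ w']) (use e I' in \<open>auto simp: rep_def hc_uminus\<close>)
        then have r: "rep q (\<lambda>r. - e * mapp A c w r) (\<lambda>j. - e * w' j)" by simp
        have "u0 r - mapp T q (\<lambda>j. - e * w' j) r \<in> I" if "r < b" for r
        proof -
          have "u0 r = (e * w c) * u0 r" using e by simp
          also have "\<dots> = - e * mapp A c w r + e * mapp B (Suc c) w r"
            unfolding B by (simp add: algebra_simps)
          finally have "u0 r - mapp T q (\<lambda>j. - e * w' j) r =
              (- e * mapp A c w r - mapp T q (\<lambda>j. - e * w' j) r) + e * mapp B (Suc c) w r"
            by simp
          then show ?thesis using r w(2) that I'(2,3) unfolding rep_def by presburger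
        qed
        then have "rep q u0 (\<lambda>j. - e * w' j)" using r by (simp add: rep_def)
        then show False using u0 by (auto simp: P'_def)
      qed
      then have "\<forall>r<b. mapp A c w r \<in> I" using w(2) unfolding B by simp
      with A(3)[OF w(1)] \<open>w c = 0\<close> w(3) show "w j = 0" by (cases "j = c") auto
    qed
  qed
qed

text \<open>In other words, (S/I)_1 is finite dimensional over the degree 0 field. In the
  application S has infinitely many variables, and the finite ranks in resolutions depend on
  this.\<close>

definition fin_gen1 :: "'a set \<Rightarrow> bool" where
  "fin_gen1 I \<longleftrightarrow> (\<exists>q t. \<forall>p. hc 1 p = p \<longrightarrow>
     (\<exists>w. const_vec w \<and> p - mapp (\<lambda>_. t) q w 0 \<in> I))"

lemma fin_gen1_vec:
  assumes "fin_gen1 I"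
  shows "\<exists>q T. \<forall>u. (\<forall>r<b. hc 1 (u r) = u r) \<longrightarrow>
    (\<exists>w. const_vec w \<and> (\<forall>r<b. u r - mapp T q w r \<in> I))"
proof (induction b)
  case 0
  show ?case by (auto intro!: exI[of _ "\<lambda>_. 0"])
next
  case (Suc b)
  then obtain q T where T: "\<And>u. (\<forall>r<b. hc 1 (u r) = u r) \<Longrightarrow>
    (\<exists>w. const_vec w \<and> (\<forall>r<b. u r - mapp T q w r \<in> I))" by blast
  from assms obtain q' t where t: "\<And>p. hc 1 p = p \<Longrightarrow>
     (\<exists>w. const_vec w \<and> p - mapp (\<lambda>_. t) q' w 0 \<in> I)" unfolding fin_gen1_def by blast
  define U where "U r j = (if j < q then (if r < b then T r j else 0) else (if r = b then t (j - q) else 0))"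
    for r j
  have U: "mapp U (q + q') w r = (if r < b then mapp T q w r else 0) +
      (if r = b then mapp (\<lambda>_. t) q' (\<lambda>j. w (q + j)) 0 else 0)" for w r
    unfolding mapp_append by (simp add: mapp_def U_def)
  show ?case
  proof (intro exI[of _ "q + q'"] exI[of _ U] allI impI)
    fix u assume u: "\<forall>r<Suc b. hc 1 (u r) = u r"
    then obtain w where w: "const_vec w" "\<forall>r<b. u r - mapp T q w r \<in> I" using T[of u] by auto
    from u obtain w' where w': "const_vec w'" "u b - mapp (\<lambda>_. t) q' w' 0 \<in> I"
      using t[of "u b"] by auto
    let ?w = "\<lambda>j. if j < q then w j else w' (j - q)"
    have "mapp U (q + q') ?w r = (if r < b then mapp T q w r else 0) +
      (if r = b then mapp (\<lambda>_. t) q' w' 0 else 0)" for r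
      unfolding U by simp
    then show "\<exists>w. const_vec w \<and> (\<forall>r<Suc b. u r - mapp U (q + q') w r \<in> I)"
      using w w' by (intro exI[of _ ?w]) (auto simp: less_Suc_eq)
  qed
qed

end

section \<open>Linearity of Tor against the residue field\<close>

context graded
begin

lemma resoD:
  assumes "reso I f F"
  shows "f 0 = 1" "r < f i \<Longrightarrow> j < f (Suc i) \<Longrightarrow> hc 1 (F i r j) = F i r j"
    "hc 0 p = 0 \<Longrightarrow> \<exists>w. p - mapp (F 0) (f 1) w 0 \<in> I"
    "p - mapp (F 0) (f 1) w 0 \<in> I \<Longrightarrow> hc 0 p = 0"
    "r < f i \<Longrightarrow> diffl f F i (diffl f F (Suc i) w) r \<in> I"
    "(\<And>r. r < f i \<Longrightarrow> diffl f F i v r \<in> I) \<Longrightarrow>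
      \<exists>w. \<forall>r<f (Suc i). v r - diffl f F (Suc i) w r \<in> I"
  using assms unfolding reso_def by blast+

lemma reso_cycle_mod:
  assumes I: "hideal I" and F: "reso I f F"
    and v: "\<And>s. s < f (Suc i) \<Longrightarrow> v s - diffl f F (Suc i) w s \<in> I" and r: "r < f i"
  shows "diffl f F i v r \<in> I"
proof -
  let ?d = "diffl f F (Suc i) w"
  have "diffl f F i (\<lambda>s. v s - ?d s) r \<in> I" by (rule hideal_mapp[OF I v])
  then have "diffl f F i (\<lambda>s. v s - ?d s) r + diffl f F i ?d r \<in> I"
    by (rule hidealD(2)[OF I]) (rule resoD(5)[OF F r])
  then show ?thesis by (simp add: mapp_diff)
qed

text \<open>For a resolution \<open>F\<close> of the residue field, \<open>Tor\<^sub>i((S/I)\<^sup>b/N, k)\<close> lives in internal degree \<open>i\<close>: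
  cycles of \<open>(S/I)\<^sup>b/N \<otimes> F\<close> with coefficients of positive degree are boundaries.\<close>
definition dlin :: "'a set \<Rightarrow> (nat \<Rightarrow> nat) \<Rightarrow> (nat \<Rightarrow> nat \<Rightarrow> nat \<Rightarrow> 'a) \<Rightarrow> nat \<Rightarrow> (nat \<Rightarrow> 'a) set \<Rightarrow> bool" where
  "dlin I f F b N \<longleftrightarrow> submod I b N \<and> (\<forall>u\<in>N. \<forall>e<b. hc 0 (u e) = 0) \<and>
    (\<forall>i z. (\<forall>e<b. \<forall>c<f (Suc i). hc 0 (z e c) = 0) \<longrightarrow>
       (\<forall>c<f i. (\<lambda>e. diffl f F i (z e) c) \<in> N) \<longrightarrow>
       (\<exists>w. \<forall>c<f (Suc i). (\<lambda>e. z e c - diffl f F (Suc i) (w e) c) \<in> N))"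

text \<open>This is the case of Tor_1. A homogeneous \<open>u\<close> in \<open>N\<close> of degree
  at least 2 is the image of some \<open>z\<close> of positive degree under the first differential
  of \<open>F\<close>, and \<open>z\<close> is a cycle modulo \<open>N\<close>. As \<open>z\<close>
  is a boundary up to elements of \<open>N\<close>, \<open>u\<close> is a combination, with linear
  coefficients, of elements of \<open>N\<close> of degree one less, and induction descends to degree
  1.\<close>

lemma dlin_generated:
  assumes I: "hideal I" and F: "reso I f F" and d: "dlin I f F b N"
    and A: "\<And>u. u \<in> N \<Longrightarrow> (\<And>r. r < b \<Longrightarrow> hc 1 (u r) = u r) \<Longrightarrow> \<exists>w. \<forall>r<b. u r - mapp A c w r \<in> I"
    and "u \<in> N"
  shows "\<exists>w. \<forall>r<b. u r - mapp A c w r \<in> I"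
proof -
  note I' = hidealD[OF I]
  have N: "submod I b N" and N0: "\<And>u e. u \<in> N \<Longrightarrow> e < b \<Longrightarrow> hc 0 (u e) = 0"
    and ex: "\<And>i z. (\<And>e c. e < b \<Longrightarrow> c < f (Suc i) \<Longrightarrow> hc 0 (z e c) = 0) \<Longrightarrow>
       (\<And>c. c < f i \<Longrightarrow> (\<lambda>e. diffl f F i (z e) c) \<in> N) \<Longrightarrow>
       \<exists>w. \<forall>c<f (Suc i). (\<lambda>e. z e c - diffl f F (Suc i) (w e) c) \<in> N"
    using d unfolding dlin_def by blast+
  note N' = submodD[OF N]
  have hom: "\<exists>w. \<forall>r<b. u r - mapp A c w r \<in> I"
    if "u \<in> N" "\<And>r. r < b \<Longrightarrow> hc (Suc d) (u r) = u r" for u d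
    using that
  proof (induction d arbitrary: u)
    case 0
    then show ?case using A by simp
  next
    case (Suc d)
    have "\<exists>w. u r - mapp (F 0) (f 1) w 0 \<in> I" if "r < b" for r
      using resoD(3)[OF F N0[OF Suc.prems(1) that]] .
    then obtain W where W: "\<And>r. r < b \<Longrightarrow> u r - mapp (F 0) (f 1) (W r) 0 \<in> I" by metis
    define z where "z e j = hc (Suc d) (W e j)" for e j
    have lin: "linear_mat (F 0) 1 (f 1)" using resoD(1)[OF F] resoD(2)[OF F, of _ 0] by simp
    have z: "u r - mapp (F 0) (f 1) (z r) 0 \<in> I" if "r < b" for r
      using I'(4)[OF W[OF that], of "Suc (Suc d)"] hc_mapp(1)[OF lin, where r = 0 and d = "Suc d" and v = "W r"] Suc.prems(2)[OF that]
      by (simp add: hc_diff z_def[abs_def])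
    have "\<exists>w. \<forall>c<f (Suc 0). (\<lambda>e. z e c - diffl f F (Suc 0) (w e) c) \<in> N"
    proof (rule ex)
      fix c assume c: "c < f 0"
      show "(\<lambda>e. diffl f F 0 (z e) c) \<in> N"
      proof (rule N'(2)[OF Suc.prems(1)])
        fix i assume "i < b"
        from I'(5)[OF z[OF this]] c show "diffl f F 0 (z i) c - u i \<in> I"
          using resoD(1)[OF F] by simp
      qed
    qed (simp add: z_def hc_hc)
    then obtain y where y: "\<And>c. c < f 1 \<Longrightarrow> (\<lambda>e. z e c - diffl f F 1 (y e) c) \<in> N" by auto
    define n where "n c e = hc (Suc d) (z e c - diffl f F 1 (y e) c)" for c e
    have "\<exists>w. \<forall>r<b. n j r - mapp A c w r \<in> I" if "j < f 1" for j
    proof (rule Suc.IH)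
      show "n j \<in> N" using N'(5)[OF y[OF that]] unfolding n_def[abs_def] .
    qed (simp add: n_def hc_hc)
    then obtain V where V: "\<And>j r. j < f 1 \<Longrightarrow> r < b \<Longrightarrow> n j r - mapp A c (V j) r \<in> I" by metis
    have n: "u r - mapp (F 0) (f 1) (\<lambda>j. n j r) 0 \<in> I" if r: "r < b" for r
    proof -
      let ?y = "diffl f F 1 (y r)"
      have dd: "mapp (F 0) (f 1) ?y 0 \<in> I" using resoD(5)[OF F, of 0 0 "y r"] resoD(1)[OF F] by simp
      have "u r - mapp (F 0) (f 1) (\<lambda>j. z r j - ?y j) 0 =
          (u r - mapp (F 0) (f 1) (z r) 0) + mapp (F 0) (f 1) ?y 0"
        by (simp add: mapp_diff)
      then have "u r - mapp (F 0) (f 1) (\<lambda>j. z r j - ?y j) 0 \<in> I" using I'(2)[OF z[OF r] dd] by metis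
      from I'(4)[OF this, of "Suc (Suc d)"] hc_mapp(1)[OF lin, where r = 0 and d = "Suc d"] Suc.prems(2)[OF r]
      show ?thesis by (simp add: hc_diff n_def)
    qed
    show ?case
    proof (intro exI allI impI)
      fix r assume r: "r < b"
      let ?w = "\<lambda>l. mapp (F 0) (f 1) (\<lambda>j. V j l) 0"
      have "mapp A c ?w r = mapp (F 0) (f 1) (\<lambda>j. mapp A c (V j) r) 0"
        by (subst mapp_mapp) rule
      then have eq: "u r - mapp A c ?w r = (u r - mapp (F 0) (f 1) (\<lambda>j. n j r) 0) +
          mapp (F 0) (f 1) (\<lambda>j. n j r - mapp A c (V j) r) 0"
        by (simp add: mapp_diff)
      show "u r - mapp A c ?w r \<in> I"
        unfolding eq by (rule I'(2)[OF n[OF r] hideal_mapp[OF I]]) (use V r in blast)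
    qed
  qed
  have hom': "\<exists>w. \<forall>r<b. hc d (u r) - mapp A c w r \<in> I" for d
  proof (cases d)
    case 0
    then show ?thesis using N0[OF \<open>u \<in> N\<close>] I' by (intro exI[of _ "\<lambda>_. 0"]) simp
  next
    case (Suc d')
    show ?thesis unfolding Suc
    proof (rule hom[of "\<lambda>r. hc (Suc d') (u r)" d'])
      show "(\<lambda>r. hc (Suc d') (u r)) \<in> N" by (rule N'(5)[OF \<open>u \<in> N\<close>])
    qed (simp add: hc_hc)
  qed
  then obtain W where W: "\<And>d r. r < b \<Longrightarrow> hc d (u r) - mapp A c (W d) r \<in> I" by metis
  have "\<forall>r. \<exists>D. u r = (\<Sum>d\<le>D. hc d (u r))" using hc_sum_ex by blast
  then obtain D where D: "\<And>r. u r = (\<Sum>d\<le>D r. hc d (u r))" by metis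
  \<comment> \<open>A common degree bound for the finitely many coordinates, so that
    \<open>u\<close> is a finite sum of homogeneous vectors.\<close>
  define M where "M = Max (insert 0 (D ` {..<b}))"
  have u: "u r = (\<Sum>d\<le>M. hc d (u r))" if "r < b" for r
  proof -
    have "D r \<le> M" unfolding M_def using that by (intro Max_ge) auto
    have "hc d (u r) = 0" if "d > D r" for d
      by (subst D) (use that in \<open>simp add: hc_sum hc_hc\<close>)
    then have "(\<Sum>d\<le>M. hc d (u r)) = (\<Sum>d\<le>D r. hc d (u r))"
      using \<open>D r \<le> M\<close> by (intro sum.mono_neutral_right) auto
    then show ?thesis using D by simp
  qed
  show ?thesis
  proof (intro exI allI impI)
    fix r assume r: "r < b"
    have "u r - mapp A c (\<lambda>j. \<Sum>d\<le>M. W d j) r = (\<Sum>d\<le>M. hc d (u r) - mapp A c (W d) r)"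
      unfolding mapp_sum sum_subtractf using u[OF r] by simp
    also have "\<dots> \<in> I" by (rule hideal_sum[OF I W[OF r]])
    finally show "u r - mapp A c (\<lambda>j. \<Sum>d\<le>M. W d j) r \<in> I" .
  qed
qed

text \<open>Dimension shift: Tor_(i+2) of a module is Tor_(i+1) of its syzygy module. The generators
  are a basis of the linear part of \<open>N\<close>; they generate \<open>N\<close> by
  \<open>dlin_generated\<close>, and their independence forces the syzygies into positive
  degree.\<close>

lemma dlin_pres:
  assumes I: "hideal I" "fin_gen1 I" and F: "reso I f F" and d: "dlin I f F b N"
  shows "\<exists>c A. pres I b N c A \<and> dlin I f F c (kern I b c A)"
proof -
  note I' = hidealD[OF I(1)]
  have N: "submod I b N" and N0: "\<And>u e. u \<in> N \<Longrightarrow> e < b \<Longrightarrow> hc 0 (u e) = 0"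
    and ex: "\<And>i z. (\<And>e c. e < b \<Longrightarrow> c < f (Suc i) \<Longrightarrow> hc 0 (z e c) = 0) \<Longrightarrow>
       (\<And>c. c < f i \<Longrightarrow> (\<lambda>e. diffl f F i (z e) c) \<in> N) \<Longrightarrow>
       \<exists>w. \<forall>c<f (Suc i). (\<lambda>e. z e c - diffl f F (Suc i) (w e) c) \<in> N"
    using d unfolding dlin_def by blast+
  note N' = submodD[OF N]
  define P where "P = {u\<in>N. \<forall>r<b. hc 1 (u r) = u r}"
  obtain q T where T: "\<And>u. (\<forall>r<b. hc 1 (u r) = u r) \<Longrightarrow>
    (\<exists>w. const_vec w \<and> (\<forall>r<b. u r - mapp T q w r \<in> I))"
    using fin_gen1_vec[OF I(2), of b] by blast
  have "\<exists>c A. (\<forall>j<c. (\<lambda>r. A r j) \<in> P) \<and>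
    (\<forall>u\<in>P. \<exists>w. const_vec w \<and> (\<forall>r<b. u r - mapp A c w r \<in> I)) \<and>
    (\<forall>w. const_vec w \<longrightarrow> (\<forall>r<b. mapp A c w r \<in> I) \<longrightarrow> (\<forall>j<c. w j = 0))"
  proof (rule finite_basis[OF I(1)])
    show "(\<lambda>_. 0) \<in> P" using N'(1) by (simp add: P_def)
    show "(\<lambda>r. u r + k * v r) \<in> P" if "hc 0 k = k" "u \<in> P" "v \<in> P" for u v k
      using that N'(3)[of u "\<lambda>r. k * v r"] N'(4)[of v k] by (simp add: P_def hc_add hc_mult[of 0])
    show "\<exists>w. const_vec w \<and> (\<forall>r<b. u r - mapp T q w r \<in> I)" if "u \<in> P" for u
      using T that by (simp add: P_def)
  qed
  then obtain c A where A0: "\<forall>j<c. (\<lambda>r. A r j) \<in> P"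
    "\<forall>u\<in>P. \<exists>w. const_vec w \<and> (\<forall>r<b. u r - mapp A c w r \<in> I)"
    "\<forall>w. const_vec w \<longrightarrow> (\<forall>r<b. mapp A c w r \<in> I) \<longrightarrow> (\<forall>j<c. w j = 0)"
    by (elim exE conjE) (rule that)
  have A: "\<And>j. j < c \<Longrightarrow> (\<lambda>r. A r j) \<in> N" "linear_mat A b c"
    using A0(1) unfolding P_def by auto
  have A3: "\<exists>w. \<forall>r<b. u r - mapp A c w r \<in> I"
    if "u \<in> N" "\<And>r. r < b \<Longrightarrow> hc 1 (u r) = u r" for u
  proof -
    have "u \<in> P" using that by (simp add: P_def)
    then show ?thesis using A0(2) by blast
  qed
  have A4: "w j = 0" if "\<And>j. hc 0 (w j) = w j" "\<And>r. r < b \<Longrightarrow> mapp A c w r \<in> I" "j < c" for w j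
    using A0(3)[rule_format, of w j] that by simp
  have AN: "mapp A c w \<in> N" for w
    unfolding mapp_def using A(1)
    by (intro submod_sum[OF N]) (auto simp: mult.commute[of _ "w _"] intro: N'(4))
  have gen: "\<exists>w. \<forall>r<b. u r - mapp A c w r \<in> I" if "u \<in> N" for u
    by (rule dlin_generated[OF I(1) F d A3 that])
  have pres: "pres I b N c A"
    unfolding pres_def
  proof (intro conjI A(2), intro allI iffI)
    fix u assume "\<exists>w. \<forall>r<b. u r - mapp A c w r \<in> I"
    then obtain w where w: "\<forall>r<b. u r - mapp A c w r \<in> I" by blast
    show "u \<in> N" by (rule N'(2)[OF AN[of w]]) (use w in blast)
  qed (rule gen)
  have "dlin I f F c (kern I b c A)"
    unfolding dlin_def
  proof (intro conjI ballI allI impI)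
    show K: "submod I c (kern I b c A)" by (rule submod_kern[OF I(1) A(2)])
    show "hc 0 (u e) = 0" if "u \<in> kern I b c A" "e < c" for u e
    proof (rule A4[of "\<lambda>j. hc 0 (u j)"])
      show "mapp A c (\<lambda>j. hc 0 (u j)) r \<in> I" if "r < b" for r
        using submodD(5)[OF K \<open>u \<in> kern I b c A\<close>, of 0] that unfolding kern_def by blast
    qed (use that in \<open>simp_all add: hc_hc\<close>)
  next
    fix i z assume z: "\<forall>e<c. \<forall>l<f (Suc i). hc 0 (z e l) = 0"
      and dz: "\<forall>l<f i. (\<lambda>e. diffl f F i (z e) l) \<in> kern I b c A"
    have lin: "linear_mat (F n) (f n) (f (Suc n))" for n using resoD(2)[OF F] by blast
    let ?d = "\<lambda>n. diffl f F n"
    \<comment> \<open>Pushed forward along \<open>A\<close>, the cycle \<open>z\<close> becomes a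
      cycle over S/I, hence the boundary of some \<open>w0\<close>, which is a cycle modulo
      \<open>N\<close> one homological degree higher.\<close>
    define Az where "Az r l = mapp A c (\<lambda>e. z e l) r" for r l
    have "\<exists>w. \<forall>l<f (Suc i). Az r l - ?d (Suc i) w l \<in> I" if r: "r < b" for r
    proof (rule resoD(6)[OF F])
      fix l assume "l < f i"
      then have "mapp A c (\<lambda>e. ?d i (z e) l) r \<in> I" using dz r unfolding kern_def by blast
      then show "?d i (Az r) l \<in> I" unfolding Az_def by (subst mapp_mapp[symmetric])
    qed
    then obtain w0 where w0: "\<And>r l. r < b \<Longrightarrow> l < f (Suc i) \<Longrightarrow> Az r l - ?d (Suc i) (w0 r) l \<in> I" by metis
    define w where "w r s = w0 r s - hc 0 (w0 r s)" for r s
    have w: "Az r l - ?d (Suc i) (w r) l \<in> I" if r: "r < b" and l: "l < f (Suc i)" for r l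
    proof -
      have "hc 1 (Az r l) = mapp A c (\<lambda>e. hc 0 (z e l)) r"
        unfolding Az_def using hc_mapp(1)[OF A(2) r, of 0] by simp
      also have "\<dots> = 0" using z l by simp
      finally have "hc 1 (Az r l - ?d (Suc i) (w0 r) l) = - ?d (Suc i) (\<lambda>s. hc 0 (w0 r s)) l"
        using hc_mapp(1)[OF lin l, of 0 "w0 r"] by (simp add: hc_diff)
      then have "- ?d (Suc i) (\<lambda>s. hc 0 (w0 r s)) l \<in> I" using I'(4)[OF w0[OF r l], of 1] by metis
      from I'(6)[OF w0[OF r l] this] show ?thesis by (simp add: w_def mapp_diff diff_diff_eq2 algebra_simps)
    qed
    have "\<exists>y. \<forall>l<f (Suc (Suc i)). (\<lambda>r. w r l - ?d (Suc (Suc i)) (y r) l) \<in> N"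
    proof (rule ex)
      show "hc 0 (w e l) = 0" for e l by (simp add: w_def hc_diff hc_hc)
      fix l assume l: "l < f (Suc i)"
      have "(\<lambda>r. Az r l) \<in> N" unfolding Az_def using AN by simp
      then show "(\<lambda>r. ?d (Suc i) (w r) l) \<in> N"
        by (rule N'(2)) (use I'(5)[OF w[OF _ l]] in simp)
    qed
    then obtain y where y: "\<And>l. l < f (Suc (Suc i)) \<Longrightarrow> (\<lambda>r. w r l - ?d (Suc (Suc i)) (y r) l) \<in> N" by blast
    \<comment> \<open>Elements of \<open>N\<close> are \<open>A\<close> applied to coefficient
      vectors; these coefficients \<open>Q\<close> form the chain whose boundary corrects
      \<open>z\<close>.\<close>
    from gen[OF y] obtain Q where Q: "\<And>l r. l < f (Suc (Suc i)) \<Longrightarrow> r < b \<Longrightarrow>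
      w r l - ?d (Suc (Suc i)) (y r) l - mapp A c (Q l) r \<in> I" by metis
    show "\<exists>q. \<forall>l<f (Suc i). (\<lambda>e. z e l - ?d (Suc i) (q e) l) \<in> kern I b c A"
    proof (intro exI allI impI)
      fix l assume l: "l < f (Suc i)"
      have "mapp A c (\<lambda>e. z e l - ?d (Suc i) (\<lambda>s. Q s e) l) r \<in> I" if r: "r < b" for r
      proof -
        let ?n = "\<lambda>s. w r s - ?d (Suc (Suc i)) (y r) s - mapp A c (Q s) r"
        have 1: "?d (Suc i) ?n l \<in> I" by (rule hideal_mapp[OF I(1) Q[OF _ r]])
        have 2: "?d (Suc i) (?d (Suc (Suc i)) (y r)) l \<in> I" by (rule resoD(5)[OF F l])
        have "mapp A c (\<lambda>e. ?d (Suc i) (\<lambda>s. Q s e) l) r = ?d (Suc i) (\<lambda>s. mapp A c (Q s) r) l"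
          by (rule mapp_mapp)
        then have "mapp A c (\<lambda>e. z e l - ?d (Suc i) (\<lambda>s. Q s e) l) r =
            (Az r l - ?d (Suc i) (w r) l) + (?d (Suc i) ?n l + ?d (Suc i) (?d (Suc (Suc i)) (y r)) l)"
          by (simp add: mapp_diff Az_def)
        moreover have "\<dots> \<in> I" by (intro I'(2) w r l 1 2)
        ultimately show ?thesis by metis
      qed
      then show "(\<lambda>e. z e l - ?d (Suc i) (\<lambda>s. Q s e) l) \<in> kern I b c A" by (simp add: kern_def)
    qed
  qed
  with pres show ?thesis by blast
qed

lemma dlin_lin:
  assumes I: "hideal I" "fin_gen1 I" and F: "reso I f F" and "dlin I f F b N"
  shows "lin I b N"
  using assms(4)
proof (coinduction arbitrary: b N)
  case (lin b N)
  from dlin_pres[OF I F this] obtain c A where "pres I b N c A" "dlin I f F c (kern I b c A)" by blast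
  then show ?case by blast
qed

end

section \<open>A chain map from the tensor product of two resolutions\<close>

definition unit_vec :: "nat \<Rightarrow> nat \<Rightarrow> 'a::comm_ring_1" where
  "unit_vec c j = (if j = c then 1 else 0)"

lemma mapp_unit_vec: "c < m \<Longrightarrow> mapp A m (unit_vec c) r = A r c"
  unfolding unit_vec_def[abs_def] by (simp add: mapp_unit)

text \<open>Linearity together with dependence on the first \<open>m\<close> coordinates only. Chain
  maps can then be built and verified on basis vectors.\<close>

definition lin_op :: "nat \<Rightarrow> ((nat \<Rightarrow> 'a::comm_ring_1) \<Rightarrow> 'a) \<Rightarrow> bool" where
  "lin_op m L \<longleftrightarrow> (\<forall>x. L x = (\<Sum>c<m. x c * L (unit_vec c)))"

lemma lin_opI_mapp: "lin_op m (\<lambda>x. mapp A m x r)"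
  unfolding lin_op_def
proof
  fix x
  have "(\<Sum>c<m. x c * mapp A m (unit_vec c) r) = (\<Sum>c<m. x c * A r c)"
    by (intro sum.cong) (simp_all add: mapp_unit_vec)
  then show "mapp A m x r = (\<Sum>c<m. x c * mapp A m (unit_vec c) r)"
    by (simp add: mapp_def mult.commute)
qed

lemma lin_op_comp:
  assumes "\<And>s. lin_op m (\<lambda>x. L x s)"
  shows "lin_op m (\<lambda>x. mapp A b (L x) r)"
  unfolding lin_op_def
proof
  fix x
  have "mapp A b (L x) r = mapp A b (\<lambda>s. \<Sum>c<m. x c * L (unit_vec c) s) r"
    by (rule mapp_cong) (simp_all only: assms[unfolded lin_op_def, THEN spec, symmetric])
  also have "\<dots> = (\<Sum>c<m. x c * mapp A b (L (unit_vec c)) r)" by (simp add: mapp_sum mapp_scale)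
  finally show "mapp A b (L x) r = (\<Sum>c<m. x c * mapp A b (L (unit_vec c)) r)" .
qed

lemma lin_op_0: "lin_op m (\<lambda>_. 0)" by (simp add: lin_op_def)

lemma lin_op_diff:
  assumes "lin_op m L" "lin_op m K"
  shows "lin_op m (\<lambda>x. L x - K x)"
  unfolding lin_op_def
proof
  fix x
  have "L x - K x = (\<Sum>c<m. x c * L (unit_vec c)) - (\<Sum>c<m. x c * K (unit_vec c))"
    by (rule arg_cong2[where f = minus]) (use assms in \<open>unfold lin_op_def, blast+\<close>)
  then show "L x - K x = (\<Sum>c<m. x c * (L (unit_vec c) - K (unit_vec c)))"
    by (simp only: sum_subtractf right_diff_distrib)
qed

lemma lin_op_scale:
  assumes "lin_op m L"
  shows "lin_op m (\<lambda>x. k * L x)"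
  unfolding lin_op_def
proof
  fix x
  have "k * L x = k * (\<Sum>c<m. x c * L (unit_vec c))"
    by (rule arg_cong[where f = "(*) k"]) (use assms in \<open>unfold lin_op_def, blast\<close>)
  then show "k * L x = (\<Sum>c<m. x c * (k * L (unit_vec c)))"
    by (simp only: sum_distrib_left mult.left_commute)
qed

lemma lin_op_sum: "(\<And>a. a \<in> X \<Longrightarrow> lin_op m (L a)) \<Longrightarrow> lin_op m (\<lambda>x. \<Sum>a\<in>X. L a x)"
proof (induction X rule: infinite_finite_induct)
  case (insert a X)
  then show ?case using lin_op_diff[of m "L a" "\<lambda>x. - 1 * (\<Sum>a\<in>X. L a x)"]
      lin_op_scale[of m "\<lambda>x. \<Sum>a\<in>X. L a x" "-1"] by simp
qed (simp_all add: lin_op_0)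

text \<open>\<open>F\<close> resolves the residue field over \<open>S/I\<close> and \<open>G\<close> resolves it over \<open>S/I'\<close>; that \<open>G\<close> is
  a complex already modulo \<open>I\<close> is how the section of \<open>S/I \<rightarrow> S/I'\<close> enters. The maps \<open>mu k j a\<close> are the
  components \<open>F\<^sub>j \<rightarrow> F\<^sub>k\<^sub>+\<^sub>j\<close> of a chain map \<open>G \<otimes> F \<rightarrow> F\<close> at the \<open>a\<close>-th basis element of \<open>G\<^sub>k\<close>,
  with \<open>mu 0 j 0\<close> the identity.\<close>
locale retract = graded hc for hc :: "nat \<Rightarrow> 'a::comm_ring_1 \<Rightarrow> 'a" +
  fixes I I' :: "'a set" and f F g G
  assumes I: "hideal I" and I': "hideal I'" and II': "I \<subseteq> I'"
    and F: "reso I f F" and G: "reso I' g G"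
    and GG: "\<And>k a c. a < g k \<Longrightarrow> c < g (Suc (Suc k)) \<Longrightarrow>
      (\<Sum>b<g (Suc k). G k a b * G (Suc k) b c) \<in> I"
begin

abbreviation dF where "dF \<equiv> diffl f F"

text \<open>The value on a basis vector is any solution of the chain map equation. \<open>M\<close>
  supplies the components of smaller G-degree and \<open>P\<close> those of smaller F-degree,
  already composed with the differential of \<open>F\<close>; hence an outer recursion in
  \<open>k\<close> and an inner one in \<open>j\<close>.\<close>

definition mu_step :: "nat \<Rightarrow> nat \<Rightarrow> (nat \<Rightarrow> nat \<Rightarrow> nat \<Rightarrow> 'a) \<Rightarrow> (nat \<Rightarrow> nat \<Rightarrow> nat \<Rightarrow> 'a) \<Rightarrow>
    nat \<Rightarrow> nat \<Rightarrow> nat \<Rightarrow> 'a" where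
  "mu_step k j M P a r c = (SOME y. \<forall>r<f (k + j). dF (k + j) y r -
     ((\<Sum>a'<g k. G k a' a * mapp (M a') (f j) (unit_vec c) r) + (-1) ^ Suc k * P a c r) \<in> I) r"

primrec mu_row :: "nat \<Rightarrow> (nat \<Rightarrow> nat \<Rightarrow> nat \<Rightarrow> nat \<Rightarrow> 'a) \<Rightarrow> nat \<Rightarrow> nat \<Rightarrow> nat \<Rightarrow> nat \<Rightarrow> 'a" where
  "mu_row k M 0 = mu_step k 0 (M 0) (\<lambda>a c r. 0)"
| "mu_row k M (Suc j) = mu_step k (Suc j) (M (Suc j))
     (\<lambda>a c r. mapp (mu_row k M j a) (f j) (dF j (unit_vec c)) r)"

primrec mu :: "nat \<Rightarrow> nat \<Rightarrow> nat \<Rightarrow> nat \<Rightarrow> nat \<Rightarrow> 'a" where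
  "mu 0 = (\<lambda>j a r c. if r = c then 1 else 0)"
| "mu (Suc k) = mu_row k (mu k)"

definition h :: "nat \<Rightarrow> nat \<Rightarrow> nat \<Rightarrow> (nat \<Rightarrow> 'a) \<Rightarrow> nat \<Rightarrow> 'a" where
  "h k j a x = mapp (mu k j a) (f j) x"

definition hd :: "nat \<Rightarrow> nat \<Rightarrow> nat \<Rightarrow> (nat \<Rightarrow> 'a) \<Rightarrow> nat \<Rightarrow> 'a" where
  "hd k j a x = (case j of 0 \<Rightarrow> (\<lambda>_. 0) | Suc j' \<Rightarrow> h k j' a (dF j' x))"

text \<open>The value of the chain map on the total differential of G \<otimes> F, taken at the
  basis element \<open>a\<close> of G-degree \<open>Suc k\<close> and at \<open>x\<close> of
  F-degree \<open>j\<close>; the sign comes from the G-degree.\<close>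

definition rhs :: "nat \<Rightarrow> nat \<Rightarrow> nat \<Rightarrow> (nat \<Rightarrow> 'a) \<Rightarrow> nat \<Rightarrow> 'a" where
  "rhs k j a x r = (\<Sum>a'<g k. G k a' a * h k j a' x r) + (-1) ^ Suc k * hd (Suc k) j a x r"

lemma h_0: "r < f j \<Longrightarrow> h 0 j a x r = x r"
  by (simp add: h_def mapp_def mu.simps if_distrib[of "\<lambda>x. x * _"] cong: if_cong)

lemma lin_op_h: "lin_op (f j) (\<lambda>x. h k j a x r)"
  unfolding h_def by (rule lin_opI_mapp)

lemma lin_op_hd: "lin_op (f j) (\<lambda>x. hd k j a x r)"
proof (cases j)
  case (Suc j')
  show ?thesis unfolding hd_def h_def Suc nat.case
    by (rule lin_op_comp) (rule lin_opI_mapp)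
qed (simp add: hd_def lin_op_0)

lemma lin_op_rhs: "lin_op (f j) (\<lambda>x. rhs k j a x r)"
proof -
  have "lin_op (f j) (\<lambda>x. (\<Sum>a'<g k. G k a' a * h k j a' x r) - (-1) ^ k * hd (Suc k) j a x r)"
    by (intro lin_op_diff lin_op_sum lin_op_scale lin_op_h lin_op_hd)
  then show ?thesis by (simp add: rhs_def)
qed

definition homotopy_law :: "nat \<Rightarrow> nat \<Rightarrow> bool" where
  "homotopy_law k j \<longleftrightarrow> (\<forall>a<g (Suc k). \<forall>x. \<forall>r<f (k + j).
     dF (k + j) (h (Suc k) j a x) r - rhs k j a x r \<in> I)"

text \<open>Both sides are linear in \<open>x\<close>, so unit vectors suffice, and there the choice
  in \<open>mu_step\<close> succeeds as soon as a solution exists.\<close>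

lemma homotopy_lawI:
  assumes "\<And>a x. a < g (Suc k) \<Longrightarrow> \<exists>y. \<forall>r<f (k + j). dF (k + j) y r - rhs k j a x r \<in> I"
  shows "homotopy_law k j"
  unfolding homotopy_law_def
proof (intro allI impI)
  fix a x r assume a: "a < g (Suc k)" and r: "r < f (k + j)"
  let ?L = "\<lambda>x. dF (k + j) (h (Suc k) j a x) r - rhs k j a x r"
  have mu: "mu (Suc k) j a r c =
      (SOME y. \<forall>r<f (k + j). dF (k + j) y r - rhs k j a (unit_vec c) r \<in> I) r" for c r
    unfolding rhs_def h_def hd_def by (cases j) (simp_all add: mu_step_def)
  have unit: "?L (unit_vec c) \<in> I" if c: "c < f j" for c
  proof -
    let ?y = "SOME y. \<forall>r<f (k + j). dF (k + j) y r - rhs k j a (unit_vec c) r \<in> I"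
    have "\<forall>r<f (k + j). dF (k + j) ?y r - rhs k j a (unit_vec c) r \<in> I"
      by (rule someI_ex[OF assms[OF a]])
    moreover have "h (Suc k) j a (unit_vec c) = ?y"
      unfolding h_def mapp_unit_vec[OF c] using mu by auto
    ultimately show ?thesis using r by simp
  qed
  have "lin_op (f j) ?L"
    by (intro lin_op_diff lin_op_comp lin_op_h lin_op_rhs)
  then have "?L x = (\<Sum>c<f j. x c * ?L (unit_vec c))" unfolding lin_op_def by (rule spec)
  also have "\<dots> \<in> I" using unit by (intro hideal_sum[OF I] hidealD(3)[OF I]) auto
  finally show "?L x \<in> I" .
qed

lemma h_ideal:
  "(\<And>s. s < f j \<Longrightarrow> x s \<in> I) \<Longrightarrow> h k j a x r \<in> I"
  "(\<And>s. s < f j \<Longrightarrow> x s \<in> I') \<Longrightarrow> h k j a x r \<in> I'"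
  unfolding h_def using hideal_mapp I I' by blast+

lemma h_dF_dF: "hd k j a (dF j x) r \<in> I"
proof (cases j)
  case (Suc j')
  have "h k j' a (dF j' (dF (Suc j') x)) r \<in> I"
    by (rule h_ideal(1)) (rule resoD(5)[OF F])
  then show ?thesis by (simp add: hd_def Suc)
qed (simp add: hd_def hidealD(1)[OF I])

text \<open>Expanding by the laws in lower total degree leaves the squares of the two differentials,
  which vanish modulo \<open>I\<close> by \<open>GG\<close> and \<open>h_dF_dF\<close>, and two
  mixed terms of opposite sign.\<close>

lemma rhs_cycle:
  assumes IH: "\<And>k' j'. k' + j' < k + j \<Longrightarrow> homotopy_law k' j'"
    and n: "k + j = Suc n" and a: "a < g (Suc k)" and r: "r < f n"
  shows "dF n (rhs k j a x) r \<in> I"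
proof -
  note Id = hidealD[OF I]
  have alg1: "(\<Sum>a<m. u a * (x a - (y a + e * z a))) + (\<Sum>a<m. u a * y a) =
      (\<Sum>a<m. u a * x a) - e * (\<Sum>a<m. u a * z a)" for u x y z :: "nat \<Rightarrow> 'a" and e m
    by (simp add: sum_distrib_left sum_subtractf[symmetric] sum.distrib[symmetric] algebra_simps)
  \<comment> \<open>\<open>s\<close> stands for the mixed term, in which each differential is
    applied once.\<close>
  have alg2: "p + (-1) ^ Suc k * q = (p - (-1) ^ k * s) + (-1) ^ Suc k * (q - s)" for p q s :: 'a
    by (simp add: algebra_simps)
  have split: "dF n (rhs k j a x) r =
      (\<Sum>a'<g k. G k a' a * dF n (h k j a' x) r) + (-1) ^ Suc k * dF n (hd (Suc k) j a x) r"
    unfolding rhs_def[abs_def] mapp_add mapp_scale mapp_sum ..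
  have second: "dF n (hd (Suc k) j a x) r - (case j of 0 \<Rightarrow> 0 | Suc j' \<Rightarrow>
      (\<Sum>a'<g k. G k a' a * h k j' a' (dF j' x) r)) \<in> I"
  proof (cases j)
    case 0
    then show ?thesis using Id by (simp add: hd_def mapp_def)
  next
    case (Suc j')
    have n': "k + j' = n" using n Suc by simp
    have "dF (k + j') (h (Suc k) j' a (dF j' x)) r - rhs k j' a (dF j' x) r \<in> I"
      using IH[of k j'] a r n' Suc unfolding homotopy_law_def by simp
    moreover have "(-1) ^ Suc k * hd (Suc k) j' a (dF j' x) r \<in> I" by (intro Id(3) h_dF_dF)
    ultimately have "dF (k + j') (h (Suc k) j' a (dF j' x)) r - rhs k j' a (dF j' x) r +
      (-1) ^ Suc k * hd (Suc k) j' a (dF j' x) r \<in> I" by (rule Id(2))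
    then show ?thesis unfolding n' by (simp add: rhs_def hd_def Suc algebra_simps)
  qed
  have first: "(\<Sum>a'<g k. G k a' a * dF n (h k j a' x) r) - (-1) ^ k *
      (\<Sum>a'<g k. G k a' a * (case j of 0 \<Rightarrow> 0 | Suc j' \<Rightarrow> h k j' a' (dF j' x) r)) \<in> I"
  proof (cases k)
    case 0
    then have j: "j = Suc n" using n by simp
    have "dF n (h 0 j a' x) r = h 0 n a' (dF n x) r" for a'
      using h_0 r j by (auto intro!: mapp_cong)
    then show ?thesis using Id by (simp add: 0 j)
  next
    case (Suc k')
    have n': "k' + j = n" using n Suc by simp
    let ?hd = "\<lambda>a'. case j of 0 \<Rightarrow> 0 | Suc j' \<Rightarrow> h k j' a' (dF j' x) r"
    have hd: "hd k j a' x r = ?hd a'" for a' by (cases j) (simp_all add: hd_def)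
    have "dF n (h k j a' x) r - ((\<Sum>a''<g k'. G k' a'' a' * h k' j a'' x r) + (-1) ^ k * ?hd a') \<in> I"
      if "a' < g k" for a'
    proof -
      have "dF (k' + j) (h (Suc k') j a' x) r - rhs k' j a' x r \<in> I"
        using IH[of k' j] that r n' Suc unfolding homotopy_law_def by simp
      then show ?thesis unfolding n' rhs_def Suc[symmetric] hd .
    qed
    then have "(\<Sum>a'<g k. G k a' a * (dF n (h k j a' x) r -
      ((\<Sum>a''<g k'. G k' a'' a' * h k' j a'' x r) + (-1) ^ k * ?hd a'))) \<in> I"
      by (intro hideal_sum[OF I] Id(3)) auto
    moreover have "(\<Sum>a'<g k. G k a' a * (\<Sum>a''<g k'. G k' a'' a' * h k' j a'' x r)) \<in> I"
    proof -
      have "(\<Sum>a'<g k. G k a' a * (\<Sum>a''<g k'. G k' a'' a' * h k' j a'' x r)) =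
          (\<Sum>a''<g k'. (\<Sum>a'<g k. G k' a'' a' * G k a' a) * h k' j a'' x r)"
        by (simp add: sum_distrib_left sum_distrib_right, subst sum.swap, simp add: mult_ac)
      also have "\<dots> \<in> I"
      proof (rule hideal_sum[OF I], rule Id(7))
        fix a'' assume "a'' \<in> {..<g k'}"
        then show "(\<Sum>a'<g k. G k' a'' a' * G k a' a) \<in> I" using GG[of a'' k' a] a Suc by simp
      qed
      finally show ?thesis .
    qed
    ultimately have "(\<Sum>a'<g k. G k a' a * (dF n (h k j a' x) r -
      ((\<Sum>a''<g k'. G k' a'' a' * h k' j a'' x r) + (-1) ^ k * ?hd a'))) +
      (\<Sum>a'<g k. G k a' a * (\<Sum>a''<g k'. G k' a'' a' * h k' j a'' x r)) \<in> I" by (rule Id(2))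
    also have "(\<Sum>a'<g k. G k a' a * (dF n (h k j a' x) r -
      ((\<Sum>a''<g k'. G k' a'' a' * h k' j a'' x r) + (-1) ^ k * ?hd a'))) +
      (\<Sum>a'<g k. G k a' a * (\<Sum>a''<g k'. G k' a'' a' * h k' j a'' x r)) =
      (\<Sum>a'<g k. G k a' a * dF n (h k j a' x) r) - (-1) ^ k * (\<Sum>a'<g k. G k a' a * ?hd a')"
      by (rule alg1)
    finally show ?thesis .
  qed
  have "(\<Sum>a'<g k. G k a' a * (case j of 0 \<Rightarrow> 0 | Suc j' \<Rightarrow> h k j' a' (dF j' x) r)) =
      (case j of 0 \<Rightarrow> 0 | Suc j' \<Rightarrow> (\<Sum>a'<g k. G k a' a * h k j' a' (dF j' x) r))"
    by (cases j) simp_all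
  note first' = first[unfolded this]
  show ?thesis
    unfolding split by (subst alg2) (rule Id(2)[OF first' Id(3)[OF second]])
qed

text \<open>In total degree 0 the right-hand side is \<open>G 0 0 a * x 0\<close>; it has no
  constant part and so lies in the image of the first differential of \<open>F\<close>. In higher
  degrees it is a cycle, and \<open>F\<close> is exact.\<close>

lemma homotopy_law: "homotopy_law k j"
proof (induction "k + j" arbitrary: k j rule: less_induct)
  case less
  note Id = hidealD[OF I]
  show ?case
  proof (rule homotopy_lawI)
    fix a x assume a: "a < g (Suc k)"
    show "\<exists>y. \<forall>r<f (k + j). dF (k + j) y r - rhs k j a x r \<in> I"
    proof (cases "k + j")
      case 0
      then have kj: "k = 0" "j = 0" by auto
      have f0: "f 0 = 1" and g0: "g 0 = 1" using resoD(1)[OF F] resoD(1)[OF G] by auto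
      have rhs: "rhs 0 0 a x 0 = G 0 0 a * x 0"
        by (simp add: rhs_def hd_def g0 h_0 f0)
      have "hc 1 (G 0 0 a) = G 0 0 a" using resoD(2)[OF G, of 0 0 a] a g0 kj by simp
      then have "hc 0 (rhs 0 0 a x 0) = 0" unfolding rhs by (simp add: hc_mult[of 1])
      from resoD(3)[OF F this] obtain w where "rhs 0 0 a x 0 - dF 0 w 0 \<in> I" by auto
      from Id(5)[OF this] have "\<forall>r<f 0. dF 0 w r - rhs 0 0 a x r \<in> I" using f0 by simp
      then show ?thesis unfolding kj by auto
    next
      case (Suc n)
      have "\<exists>w. \<forall>r<f (Suc n). rhs k j a x r - dF (Suc n) w r \<in> I"
        by (rule resoD(6)[OF F], rule rhs_cycle[OF _ Suc a]) (use less in blast)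
      then obtain w where w: "\<forall>r<f (Suc n). rhs k j a x r - dF (Suc n) w r \<in> I" ..
      have "dF (Suc n) w r - rhs k j a x r \<in> I" if "r < f (Suc n)" for r
        using Id(5)[OF w[rule_format, OF that]] by simp
      then show ?thesis unfolding Suc by blast
    qed
  qed
qed

text \<open>Exactness of \<open>G\<close> modulo \<open>I'\<close> lifts \<open>V\<close> to
  \<open>Z\<close>; in G-degree 0 the cycle condition is the absence of constants, hence the two
  hypotheses. The chain map law at \<open>Z\<close> then expresses the image of
  \<open>V\<close>.\<close>

lemma zigzag_step:
  assumes "\<And>c. c < f j \<Longrightarrow> k = 0 \<Longrightarrow> hc 0 (V 0 c) = 0"
    and "\<And>k' a' c. k = Suc k' \<Longrightarrow> a' < g k' \<Longrightarrow> c < f j \<Longrightarrow> mapp (G k') (g k) (\<lambda>a. V a c) a' \<in> I'"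
  shows "\<exists>Z. (\<forall>a<g k. \<forall>c<f j. V a c - diffl g G k (\<lambda>b. Z b c) a \<in> I') \<and>
    (\<forall>r<f (k + j). (\<Sum>a<g k. h k j a (V a) r) -
       (dF (k + j) (\<lambda>s. \<Sum>b<g (Suc k). h (Suc k) j b (Z b) s) r -
        (-1) ^ Suc k * (\<Sum>b<g (Suc k). hd (Suc k) j b (Z b) r)) \<in> I')"
proof -
  note Id = hidealD[OF I']
  have "\<exists>z. \<forall>a<g k. V a c - diffl g G k z a \<in> I'" if "c < f j" for c
  proof (cases k)
    case 0
    from resoD(3)[OF G assms(1)[OF that 0]] show ?thesis
      unfolding 0 using resoD(1)[OF G] by simp
  next
    case (Suc k')
    show ?thesis unfolding Suc
      by (rule resoD(6)[OF G]) (use assms(2) Suc that in auto)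
  qed
  then obtain z where z: "\<And>a c. a < g k \<Longrightarrow> c < f j \<Longrightarrow> V a c - diffl g G k (z c) a \<in> I'"
    by metis
  define Z where "Z b c = z c b" for b c
  let ?GZ = "\<lambda>a c. diffl g G k (\<lambda>b. Z b c) a"
  have Z: "V a c - ?GZ a c \<in> I'" if "a < g k" "c < f j" for a c
    using z[OF that] by (simp add: Z_def)
  show ?thesis
  proof (intro exI[of _ Z] conjI allI impI)
    fix r assume r: "r < f (k + j)"
    have 1: "(\<Sum>a<g k. h k j a (\<lambda>c. V a c - ?GZ a c) r) \<in> I'"
      by (intro hideal_sum[OF I'] h_ideal(2)) (use Z in auto)
    have "dF (k + j) (h (Suc k) j b (Z b)) r - rhs k j b (Z b) r \<in> I'" if "b < g (Suc k)" for b
      using homotopy_law[of k j] that r II' unfolding homotopy_law_def by blast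
    then have 2: "(\<Sum>b<g (Suc k). dF (k + j) (h (Suc k) j b (Z b)) r - rhs k j b (Z b) r) \<in> I'"
      by (intro hideal_sum[OF I']) auto
    have "(\<Sum>b<g (Suc k). \<Sum>a<g k. G k a b * h k j a (Z b) r) =
        (\<Sum>a<g k. \<Sum>b<g (Suc k). G k a b * h k j a (Z b) r)" by (rule sum.swap)
    also have "\<dots> = (\<Sum>a<g k. h k j a (?GZ a) r)"
      unfolding h_def by (subst mapp_mapp) (simp add: mapp_def)
    finally have swap: "(\<Sum>b<g (Suc k). \<Sum>a<g k. G k a b * h k j a (Z b) r) = (\<Sum>a<g k. h k j a (?GZ a) r)" .
    have 3: "(\<Sum>b<g (Suc k). rhs k j b (Z b) r) = (\<Sum>a<g k. h k j a (?GZ a) r) +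
        (-1) ^ Suc k * (\<Sum>b<g (Suc k). hd (Suc k) j b (Z b) r)"
      by (simp only: rhs_def sum.distrib swap sum_distrib_left)
    have 4: "(\<Sum>a<g k. h k j a (\<lambda>c. V a c - ?GZ a c) r) =
        (\<Sum>a<g k. h k j a (V a) r) - (\<Sum>a<g k. h k j a (?GZ a) r)"
      unfolding h_def by (simp add: mapp_diff sum_subtractf)
    have 5: "(\<Sum>b<g (Suc k). dF (k + j) (h (Suc k) j b (Z b)) r - rhs k j b (Z b) r) =
        dF (k + j) (\<lambda>s. \<Sum>b<g (Suc k). h (Suc k) j b (Z b) s) r - ((\<Sum>a<g k. h k j a (?GZ a) r) +
        (-1) ^ Suc k * (\<Sum>b<g (Suc k). hd (Suc k) j b (Z b) r))"
      unfolding sum_subtractf mapp_sum 3 ..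
    have "(x - y) - (d - (y + t)) \<in> I' \<Longrightarrow> x - (d - t) \<in> I'" for x y d t
      by (simp add: algebra_simps)
    from this[OF Id(6)[OF 1[unfolded 4] 2[unfolded 5]]]
    show "(\<Sum>a<g k. h k j a (V a) r) -
       (dF (k + j) (\<lambda>s. \<Sum>b<g (Suc k). h (Suc k) j b (Z b) s) r -
        (-1) ^ Suc k * (\<Sum>b<g (Suc k). hd (Suc k) j b (Z b) r)) \<in> I'" .
  qed (rule Z)
qed

text \<open>Write a cycle \<open>V\<close> as \<open>\<partial>Z\<close> with \<open>\<partial>\<close> the differential of \<open>G\<close>. Up to sign, the image of \<open>V\<close> under the
  chain map is the boundary of the image of \<open>Z\<close> plus the image of the \<open>F\<close>-differential of \<open>Z\<close>, which
  is a cycle of lower \<open>F\<close>-degree.\<close>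
lemma zigzag:
  assumes "\<And>c. c < f j \<Longrightarrow> k = 0 \<Longrightarrow> hc 0 (V 0 c) = 0"
    and "\<And>k' a' c. k = Suc k' \<Longrightarrow> a' < g k' \<Longrightarrow> c < f j \<Longrightarrow> mapp (G k') (g k) (\<lambda>a. V a c) a' \<in> I'"
    and "\<And>j' a c. j = Suc j' \<Longrightarrow> a < g k \<Longrightarrow> c < f j' \<Longrightarrow> dF j' (V a) c \<in> I'"
  shows "\<exists>w. \<forall>r<f (k + j). (\<Sum>a<g k. h k j a (V a) r) - dF (k + j) w r \<in> I'"
  using assms
proof (induction j arbitrary: k V)
  case (0 k V)
  have "\<exists>Z. (\<forall>a<g k. \<forall>c<f 0. V a c - diffl g G k (\<lambda>b. Z b c) a \<in> I') \<and>
    (\<forall>r<f (k + 0). (\<Sum>a<g k. h k 0 a (V a) r) -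
       (dF (k + 0) (\<lambda>s. \<Sum>b<g (Suc k). h (Suc k) 0 b (Z b) s) r -
        (-1) ^ Suc k * (\<Sum>b<g (Suc k). hd (Suc k) 0 b (Z b) r)) \<in> I')"
    by (rule zigzag_step) (fact 0)+
  then obtain Z where "\<forall>r<f (k + 0). (\<Sum>a<g k. h k 0 a (V a) r) -
       (dF (k + 0) (\<lambda>s. \<Sum>b<g (Suc k). h (Suc k) 0 b (Z b) s) r -
        (-1) ^ Suc k * (\<Sum>b<g (Suc k). hd (Suc k) 0 b (Z b) r)) \<in> I'"
    by (elim exE conjE) (rule that)
  then have "\<forall>r<f (k + 0). (\<Sum>a<g k. h k 0 a (V a) r) -
       dF (k + 0) (\<lambda>s. \<Sum>b<g (Suc k). h (Suc k) 0 b (Z b) s) r \<in> I'"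
    by (simp add: hd_def)
  then show ?case by blast
next
  case (Suc j k V)
  note Id = hidealD[OF I']
  have "\<exists>Z. (\<forall>a<g k. \<forall>c<f (Suc j). V a c - diffl g G k (\<lambda>b. Z b c) a \<in> I') \<and>
    (\<forall>r<f (k + Suc j). (\<Sum>a<g k. h k (Suc j) a (V a) r) -
       (dF (k + Suc j) (\<lambda>s. \<Sum>b<g (Suc k). h (Suc k) (Suc j) b (Z b) s) r -
        (-1) ^ Suc k * (\<Sum>b<g (Suc k). hd (Suc k) (Suc j) b (Z b) r)) \<in> I')"
    by (rule zigzag_step) (fact Suc.prems(1,2))+
  then obtain Z where Z0: "\<forall>a<g k. \<forall>c<f (Suc j). V a c - diffl g G k (\<lambda>b. Z b c) a \<in> I'"
    and E0: "\<forall>r<f (k + Suc j). (\<Sum>a<g k. h k (Suc j) a (V a) r) -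
       (dF (k + Suc j) (\<lambda>s. \<Sum>b<g (Suc k). h (Suc k) (Suc j) b (Z b) s) r -
        (-1) ^ Suc k * (\<Sum>b<g (Suc k). hd (Suc k) (Suc j) b (Z b) r)) \<in> I'"
    by (elim exE conjE) (rule that)
  note Z = Z0[rule_format] and E = E0[rule_format]
  define V' where "V' b = dF j (Z b)" for b
  have "\<exists>w. \<forall>r<f (Suc k + j). (\<Sum>b<g (Suc k). h (Suc k) j b (V' b) r) - dF (Suc k + j) w r \<in> I'"
  proof (rule Suc.IH)
    fix k' a' c assume "Suc k = Suc k'" and a': "a' < g k'" and c: "c < f j"
    then have k': "k' = k" by simp
    have "diffl g G k (\<lambda>b. V' b c) a' =
        dF j (\<lambda>s. diffl g G k (\<lambda>b. Z b s) a') c"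
      unfolding V'_def by (rule mapp_mapp)
    also have "\<dots> = dF j (V a') c - dF j (\<lambda>s. V a' s - diffl g G k (\<lambda>b. Z b s) a') c"
      by (simp add: mapp_diff)
    also have "\<dots> \<in> I'"
      using a' c k' by (intro Id(6) Suc.prems(3) hideal_mapp[OF I' Z]) auto
    finally show "mapp (G k') (g (Suc k)) (\<lambda>b. V' b c) a' \<in> I'" unfolding k' .
  next
    fix j' a c assume "j = Suc j'" "c < f j'"
    then show "dF j' (V' a) c \<in> I'"
      unfolding V'_def using resoD(5)[OF F, of c j'] II' by blast
  qed simp
  then obtain w1 where w1: "\<And>r. r < f (k + Suc j) \<Longrightarrow>
      (\<Sum>b<g (Suc k). hd (Suc k) (Suc j) b (Z b) r) - dF (k + Suc j) w1 r \<in> I'"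
    by (auto simp: hd_def V'_def)
  let ?w0 = "\<lambda>s. \<Sum>b<g (Suc k). h (Suc k) (Suc j) b (Z b) s"
  show ?case
  proof (intro exI allI impI)
    fix r assume r: "r < f (k + Suc j)"
    have "x - (d - e * t) \<in> I' \<Longrightarrow> t - d' \<in> I' \<Longrightarrow> x - (d - e * d') \<in> I'" for x d e t d'
    proof -
      assume 1: "x - (d - e * t) \<in> I'" and 2: "t - d' \<in> I'"
      have "x - (d - e * d') = (x - (d - e * t)) - e * (t - d')" by (simp add: algebra_simps)
      also have "\<dots> \<in> I'" by (intro Id(6)[OF 1] Id(3)[OF 2])
      finally show ?thesis .
    qed
    from this[OF E[OF r] w1[OF r]]
    have "(\<Sum>a<g k. h k (Suc j) a (V a) r) - (dF (k + Suc j) ?w0 r - (-1) ^ Suc k * dF (k + Suc j) w1 r) \<in> I'" .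
    then show "(\<Sum>a<g k. h k (Suc j) a (V a) r) - dF (k + Suc j) (\<lambda>s. ?w0 s - (-1) ^ Suc k * w1 s) r \<in> I'"
      by (simp only: mapp_diff mapp_scale)
  qed
qed

text \<open>As \<open>mu 0\<close> is the identity, a cycle of S/I' \<otimes> F placed in G-degree 0
  is its own image under the chain map, and \<open>zigzag\<close> makes it a boundary.\<close>

lemma dlin_retract: "dlin I f F 1 {u. u 0 \<in> I'}"
  unfolding dlin_def
proof (intro conjI ballI allI impI)
  note Id = hidealD[OF I']
  show "submod I 1 {u. u 0 \<in> I'}" using submod_power[OF I I' II', of 1] by simp
  show "hc 0 (u e) = 0" if "u \<in> {u. u 0 \<in> I'}" "e < 1" for u and e :: nat
  proof -
    have "hc 0 (u 0) = 0" by (rule resoD(4)[OF G, of _ "\<lambda>_. 0"]) (use that in simp)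
    moreover have "e = 0" using that(2) by simp
    ultimately show ?thesis by simp
  qed
  fix i and z :: "nat \<Rightarrow> nat \<Rightarrow> 'a" assume z: "\<forall>e<1. \<forall>c<f (Suc i). hc 0 (z e c) = 0"
    and dz: "\<forall>c<f i. (\<lambda>e. dF i (z e) c) \<in> {u. u 0 \<in> I'}"
  have "\<exists>w. \<forall>r<f (0 + Suc i). (\<Sum>a<g 0. h 0 (Suc i) a (z 0) r) - dF (0 + Suc i) w r \<in> I'"
    by (rule zigzag) (use z dz in auto)
  then obtain w where "\<forall>r<f (Suc i). z 0 r - dF (Suc i) w r \<in> I'"
    using resoD(1)[OF G] by (auto simp: h_0)
  then show "\<exists>w. \<forall>c<f (Suc i). (\<lambda>e. z e c - dF (Suc i) (w e) c) \<in> {u. u 0 \<in> I'}"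
    by (intro exI[of _ "\<lambda>_. w"]) simp
qed

end

context graded
begin

text \<open>The map \<rho> induces a section of S/I \<rightarrow> S/I'. Applied to the entries of a
  resolution over S/I', it changes nothing modulo \<open>I'\<close>, but it moves the products of
  consecutive matrices from \<open>I'\<close> into \<open>I\<close>, which is the condition
  \<open>GG\<close>.\<close>

lemma lin_retract:
  assumes I: "hideal I" "fin_gen1 I" "hideal I'" "I \<subseteq> I'"
    and k: "lin I 1 irrelevant_ideal" "lin I' 1 irrelevant_ideal"
    and \<rho>: "\<And>p q. \<rho> (p + q) = \<rho> p + \<rho> q" "\<And>p q. \<rho> (p * q) = \<rho> p * \<rho> q"
      "\<And>p. p \<in> I' \<Longrightarrow> \<rho> p \<in> I" "\<And>p. p - \<rho> p \<in> I'" "\<And>p. hc 1 (\<rho> p) = \<rho> (hc 1 p)"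
  shows "lin I 1 {u. u 0 \<in> I'}"
proof -
  note Id = hidealD[OF I(3)] and I0 = I(1,2)
  obtain f F where F: "reso I f F" using lin_reso[OF I(1) k(1)] by blast
  obtain g G where G: "reso I' g G" using lin_reso[OF I(3) k(2)] by blast
  define H where "H k a b = \<rho> (G k a b)" for k a b
  have \<rho>0: "\<rho> 0 = 0" using \<rho>(1)[of 0 0] by simp
  have \<rho>sum: "\<rho> (sum t X) = (\<Sum>x\<in>X. \<rho> (t x))" for t :: "nat \<Rightarrow> 'a" and X
    by (induction X rule: infinite_finite_induct) (simp_all add: \<rho> \<rho>0)
  have GH: "mapp (G k) m w r - mapp (H k) m w r \<in> I'" for k m w r
    unfolding mapp_def sum_subtractf[symmetric] H_def
    by (intro hideal_sum[OF I(3)]) (simp add: left_diff_distrib[symmetric] Id(7) \<rho>(4))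
  have iff1: "x - mapp (H k) m w r \<in> I' \<longleftrightarrow> x - mapp (G k) m w r \<in> I'" for x k m w r
    using Id(2)[OF _ GH, of "x - mapp (G k) m w r" k m w r]
      Id(6)[OF _ GH, of "x - mapp (H k) m w r" k m w r] by auto
  have iff2: "mapp (H k) m w r \<in> I' \<longleftrightarrow> mapp (G k) m w r \<in> I'" for k m w r
    using Id(6)[OF _ GH, of "mapp (G k) m w r" k m w r]
      Id(2)[OF GH, of "mapp (H k) m w r" k m w r] by auto
  have H: "reso I' g H"
    unfolding reso_def
  proof (intro conjI allI impI)
    show "g 0 = 1" by (rule resoD(1)[OF G])
    show "hc 1 (H i r j) = H i r j" if "r < g i" "j < g (Suc i)" for i r j
      unfolding H_def \<rho>(5) using resoD(2)[OF G that] by (simp only:)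
    show "hc 0 p = 0 \<longleftrightarrow> (\<exists>w. p - mapp (H 0) (g 1) w 0 \<in> I')" for p
      unfolding iff1 using resoD(3,4)[OF G] by blast
    show "diffl g H i (diffl g H (Suc i) w) r \<in> I'" if "r < g i" for i w r
      unfolding iff2
    proof (rule reso_cycle_mod[OF I(3) G _ that])
      show "diffl g H (Suc i) w s - diffl g G (Suc i) w s \<in> I'" for s
        unfolding iff1[symmetric] using Id(1) by simp
    qed
    show "\<exists>w. \<forall>r<g (Suc i). v r - diffl g H (Suc i) w r \<in> I'"
      if "\<forall>r<g i. diffl g H i v r \<in> I'" for i v
      unfolding iff1 by (rule resoD(6)[OF G]) (use that iff2 in auto)
  qed
  have "(\<Sum>b<g (Suc k). H k a b * H (Suc k) b c) \<in> I" if "a < g k" "c < g (Suc (Suc k))" for k a c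
  proof -
    have "diffl g G k (diffl g G (Suc k) (unit_vec c)) a \<in> I'"
      by (rule resoD(5)[OF G that(1)])
    then have "(\<Sum>b<g (Suc k). G k a b * G (Suc k) b c) \<in> I'"
      unfolding mapp_unit_vec[OF that(2)] by (simp add: mapp_def)
    from \<rho>(3)[OF this] show ?thesis unfolding H_def by (simp add: \<rho>sum \<rho>)
  qed
  then interpret retract hc I I' f F g H
    by unfold_locales (use I F H in auto)
  show ?thesis by (rule dlin_lin[OF I0 F dlin_retract])
qed

end

section \<open>Elimination orders\<close>

definition simplicial :: "(nat \<Rightarrow> nat \<Rightarrow> bool) \<Rightarrow> nat set \<Rightarrow> nat \<Rightarrow> bool" where
  "simplicial E A v \<longleftrightarrow> (\<forall>a\<in>A. \<forall>b\<in>A. E v a \<longrightarrow> E v b \<longrightarrow> a \<noteq> b \<longrightarrow> E a b)"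

locale strongly_chordal_claw_free =
  fixes n :: nat and E :: "nat \<Rightarrow> nat \<Rightarrow> bool"
  assumes graph: "simple_graph_on n E" and chordal: "chordal n E"
    and claw_free: "claw_free n E" and tent_free: "tent_free n E"
begin

lemma sym: "E a b \<Longrightarrow> E b a" and irrefl: "\<not> E a a" and verts: "E a b \<Longrightarrow> a \<in> {1..n}" "E a b \<Longrightarrow> b \<in> {1..n}"
  using graph unfolding simple_graph_on_def by blast+

lemma sym_iff: "E a b \<longleftrightarrow> E b a" using sym by blast

lemma no_claw:
  assumes "E v a" "E v b" "E v c" "a \<noteq> b" "a \<noteq> c" "b \<noteq> c"
  shows "E a b \<or> E a c \<or> E b c"
proof (rule ccontr)
  assume n: "\<not> ?thesis"
  let ?f = "\<lambda>i. [v, a, b, c] ! i"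
  have s: "{0..3::nat} = {0, 1, 2, 3}" by auto
  have "v \<noteq> a" "v \<noteq> b" "v \<noteq> c" using assms irrefl by auto
  then have "has_induced n E {0..3::nat} claw_edges"
    unfolding has_induced_def s using assms n irrefl verts[OF assms(1)] verts[OF assms(2)] verts[OF assms(3)]
    by (intro exI[of _ ?f]) (auto simp: claw_edges_def inj_on_def sym_iff[of b a] sym_iff[of c a]
        sym_iff[of c b] intro: sym)
  then show False using claw_free unfolding claw_free_def by simp
qed

lemma no_square:
  assumes "E a b" "E b c" "E c d" "E d a" "a \<noteq> c" "b \<noteq> d"
  shows "E a c \<or> E b d"
proof (rule ccontr)
  assume n: "\<not> ?thesis"
  let ?f = "\<lambda>i. [a, b, c, d] ! i"
  have s: "{0..<4::nat} = {0, 1, 2, 3}" by auto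
  have "a \<noteq> b" "b \<noteq> c" "c \<noteq> d" "d \<noteq> a" using assms irrefl by auto
  then have "has_induced n E {0..<4::nat} (cycle_edges 4)"
    unfolding has_induced_def s using assms n irrefl verts[OF assms(1)] verts[OF assms(3)]
    by (intro exI[of _ ?f]) (auto simp: cycle_edges_def inj_on_def sym_iff[of c a] sym_iff[of d b] intro: sym)
  then show False using chordal unfolding chordal_def by (meson order_refl)
qed

lemma no_tent:
  assumes "E v u" "E v u'" "E u u'" "E u w" "E u' w" "E a u" "E a w" "E a' u'" "E a' w"
    "\<not> E v w" "\<not> E v a" "\<not> E v a'" "\<not> E a u'" "\<not> E a' u" "\<not> E a a'"
    "a \<noteq> v" "a' \<noteq> v" "v \<noteq> w" "a \<noteq> u'" "a' \<noteq> u"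
  shows False
proof -
  \<comment> \<open>The triangle \<open>u\<close>, \<open>u'\<close>, \<open>w\<close> comes first,
    then the tips \<open>v\<close>, \<open>a'\<close>, \<open>a\<close>, opposite to
    \<open>w\<close>, \<open>u\<close>, \<open>u'\<close> respectively.\<close>
  let ?f = "\<lambda>i. [u, u', w, v, a', a] ! i"
  have s: "{0..5::nat} = {0, 1, 2, 3, 4, 5}" by auto
  have d: "v \<noteq> u" "v \<noteq> u'" "u \<noteq> u'" "u \<noteq> w" "u' \<noteq> w" "a \<noteq> u" "a \<noteq> w" "a' \<noteq> u'" "a' \<noteq> w" "a \<noteq> a'"
    using assms irrefl by auto
  have n: "\<not> E w v" "\<not> E a v" "\<not> E a' v" "\<not> E u' a" "\<not> E u a'" "\<not> E a' a"
    using assms(10-15) sym by blast+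
  have e: "E u v" "E u' v" "E u' u" "E w u" "E w u'" "E u a" "E w a" "E u' a'" "E w a'"
    using assms(1-9) sym by blast+
  have "has_induced n E {0..5::nat} tent_edges"
    unfolding has_induced_def
  proof (intro exI[of _ ?f] conjI)
    show "inj_on ?f {0..5}" unfolding s inj_on_def using d assms(16-20) by auto
    show "?f ` {0..5} \<subseteq> {1..n}" unfolding s
      using verts[OF assms(1)] verts[OF assms(5)] verts[OF assms(6)] verts[OF assms(8)] by auto
    show "\<forall>a\<in>{0..5}. \<forall>b\<in>{0..5}. E (?f a) (?f b) = tent_edges a b"
      unfolding s by (simp add: tent_edges_def tent_edge_list_def assms(1-15) n e irrefl)
  qed
  then show False using tent_free unfolding tent_free_def by simp
qed

text \<open>A closed set of vertices of \<open>A\<close> outside the closed neighbourhood of \<open>w\<close>: a union of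
  connected components of the graph obtained by deleting that neighbourhood.\<close>
definition off_closed :: "nat set \<Rightarrow> nat \<Rightarrow> nat set \<Rightarrow> bool" where
  "off_closed A w C \<longleftrightarrow> w \<in> A \<and> C \<subseteq> A \<and> C \<noteq> {} \<and> (\<forall>c\<in>C. c \<noteq> w \<and> \<not> E w c) \<and>
     (\<forall>c\<in>C. \<forall>d\<in>A. E c d \<longrightarrow> d \<noteq> w \<longrightarrow> \<not> E w d \<longrightarrow> d \<in> C)"

text \<open>A shortest path from \<open>b\<close> to \<open>b'\<close> with interior in
  \<open>C\<close> is chordless, and \<open>w\<close> sees only its ends; closed up through
  \<open>w\<close> it is an induced cycle of length at least 4. Minimality of \<open>C\<close>
  ensures that such a path exists.\<close>

lemma boundary_clique:
  assumes A: "finite A" and C: "off_closed A w C"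
    and min: "\<And>C'. off_closed A w C' \<Longrightarrow> card C \<le> card C'"
    and b: "b \<in> A" "E w b" "\<exists>c\<in>C. E b c" and b': "b' \<in> A" "E w b'" "\<exists>c\<in>C. E b' c" and ne: "b \<noteq> b'"
  shows "E b b'"
proof (rule ccontr)
  assume nE: "\<not> E b b'"
  have CA: "C \<subseteq> A" "\<And>c. c \<in> C \<Longrightarrow> c \<noteq> w" "\<And>c. c \<in> C \<Longrightarrow> \<not> E w c" "w \<in> A"
    "\<And>c d. c \<in> C \<Longrightarrow> d \<in> A \<Longrightarrow> E c d \<Longrightarrow> d \<noteq> w \<Longrightarrow> \<not> E w d \<Longrightarrow> d \<in> C"
    using C unfolding off_closed_def by blast+
  have fC: "finite C" using CA(1) A finite_subset by blast
  \<comment> \<open>The part of \<open>C\<close> reached by walks from \<open>b\<close>. It is again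
    closed, so it is all of \<open>C\<close>.\<close>
  define T where "T = {c. \<exists>p k. p (0::nat) = b \<and> p k = c \<and> k \<ge> 1 \<and> (\<forall>i. 0 < i \<longrightarrow> i \<le> k \<longrightarrow> p i \<in> C) \<and>
    (\<forall>i<k. E (p i) (p (Suc i)))}"
  have TC: "T \<subseteq> C" unfolding T_def by auto
  obtain c0 where c0: "c0 \<in> C" "E b c0" using b(3) by blast
  have "c0 \<in> T" unfolding T_def
    by (intro CollectI exI[of _ "\<lambda>i. if i = 0 then b else c0"] exI[of _ 1]) (use c0 in auto)
  moreover have "d \<in> T" if "c \<in> T" "d \<in> A" "E c d" "d \<noteq> w" "\<not> E w d" for c d
  proof -
    obtain p k where p: "p (0::nat) = b" "p k = c" "k \<ge> 1" "\<forall>i. 0 < i \<longrightarrow> i \<le> k \<longrightarrow> p i \<in> C"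
      "\<forall>i<k. E (p i) (p (Suc i))" using \<open>c \<in> T\<close> unfolding T_def by blast
    have "c \<in> C" using \<open>c \<in> T\<close> TC by blast
    then have "d \<in> C" using CA(5) that by blast
    then show ?thesis unfolding T_def
      using p \<open>E c d\<close> by (intro CollectI exI[of _ "p(Suc k := d)"] exI[of _ "Suc k"])
        (auto simp: le_Suc_eq less_Suc_eq)
  qed
  ultimately have "off_closed A w T"
    using TC CA(1-4) unfolding off_closed_def by blast
  then have TC': "T = C" using min TC card_seteq[OF fC] by blast
  define Q where "Q p k \<longleftrightarrow> p (0::nat) = b \<and> p k = b' \<and> (\<forall>i. 0 < i \<longrightarrow> i < k \<longrightarrow> p i \<in> C) \<and>
    (\<forall>i<k. E (p i) (p (Suc i)))" for p :: "nat \<Rightarrow> nat" and k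
  obtain c1 where c1: "c1 \<in> C" "E b' c1" using b'(3) by blast
  then have "c1 \<in> T" using TC' by simp
  then obtain p1 k1 where p1: "p1 (0::nat) = b" "p1 k1 = c1" "k1 \<ge> 1" "\<forall>i. 0 < i \<longrightarrow> i \<le> k1 \<longrightarrow> p1 i \<in> C"
      "\<forall>i<k1. E (p1 i) (p1 (Suc i))" unfolding T_def by (elim CollectE exE conjE) (rule that)
  have "Q (p1(Suc k1 := b')) (Suc k1)"
    unfolding Q_def using p1 sym[OF c1(2)] by (auto simp: less_Suc_eq)
  then have ex: "\<exists>k p. Q p k" by blast
  define k where "k = (LEAST k. \<exists>p. Q p k)"
  obtain p where Q: "Q p k" using LeastI_ex[OF ex] unfolding k_def by blast
  have kmin: "k \<le> k'" if "Q p' k'" for p' k' unfolding k_def by (rule Least_le) (use that in blast)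
  have p: "p 0 = b" "p k = b'" "\<And>i. 0 < i \<Longrightarrow> i < k \<Longrightarrow> p i \<in> C" "\<And>i. i < k \<Longrightarrow> E (p i) (p (Suc i))"
    using Q unfolding Q_def by blast+
  have k2: "k \<ge> 2"
  proof (rule ccontr)
    assume "\<not> k \<ge> 2"
    then consider "k = 0" | "k = 1" by linarith
    then show False using p(1,2) p(4)[of 0] ne nE by cases auto
  qed
  have chordless: "j = Suc i" if "i < j" "j \<le> k" "E (p i) (p j)" for i j
  proof (rule ccontr)
    assume "j \<noteq> Suc i"
    \<comment> \<open>The number of vertices skipped by a chord; cutting them out contradicts the
      minimal length \<open>k\<close>.\<close>
    define m where "m = j - i - 1"
    have m: "m > 0" "j = i + 1 + m" using that \<open>j \<noteq> Suc i\<close> by (auto simp: m_def)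
    let ?p = "\<lambda>t. if t \<le> i then p t else p (t + m)"
    have "Q ?p (k - m)"
      unfolding Q_def
    proof (intro conjI allI impI)
      show "?p 0 = b" using p by simp
      show "?p (k - m) = b'" using m that p by auto
      show "?p t \<in> C" if "0 < t" "t < k - m" for t using that p(3) \<open>j \<le> k\<close> m by auto
      show "E (?p t) (?p (Suc t))" if "t < k - m" for t
      proof (cases "t = i")
        case True
        then show ?thesis using \<open>E (p i) (p j)\<close> m by (simp add: add.commute)
      next
        case False
        then show ?thesis using p(4)[of t] p(4)[of "t + m"] that \<open>j \<le> k\<close> m by auto
      qed
    qed
    then have "k \<le> k - m" by (rule kmin)
    then show False using m that by linarith
  qed
  have bC: "b \<notin> C" "b' \<notin> C" using CA(3) b b' by blast+
  have dist: "p i \<noteq> p j" if "i < j" "j \<le> k" for i j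
  proof
    assume eq: "p i = p j"
    show False
    proof (cases "j = k")
      case True
      then show False using eq p(1,2) p(3)[of i] ne bC that by (cases "i = 0") auto
    next
      case False
      then have "E (p i) (p (Suc j))" using p(4)[of j] eq that by simp
      then show False using chordless[of i "Suc j"] that False by auto
    qed
  qed
  have pw: "p i \<noteq> w" "E w (p i) \<longleftrightarrow> i = 0 \<or> i = k" if "i \<le> k" for i
  proof -
    consider "i = 0" | "i = k" | "0 < i" "i < k" using \<open>i \<le> k\<close> by linarith
    then show "p i \<noteq> w" "E w (p i) \<longleftrightarrow> i = 0 \<or> i = k"
      using p(1,2) p(3)[of i] b(2) b'(2) CA(2,3) irrefl by (cases; force)+
  qed
  define f where "f i = (if i \<le> k then p i else w)" for i
  have "has_induced n E {0..<k + 2} (cycle_edges (k + 2))"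
    unfolding has_induced_def
  proof (intro exI[of _ f] conjI ballI)
    show "inj_on f {0..<k + 2}"
    proof (rule inj_onI)
      fix x y assume xy: "x \<in> {0..<k + 2}" "y \<in> {0..<k + 2}" "f x = f y"
      show "x = y"
      proof (rule ccontr)
        assume "x \<noteq> y"
        then have "x < y \<or> y < x" by linarith
        then show False using xy dist[of x y] dist[of y x] pw(1)[of x] pw(1)[of y]
          by (auto simp: f_def split: if_splits)
      qed
    qed
    show "f ` {0..<k + 2} \<subseteq> {1..n}"
    proof
      fix y assume "y \<in> f ` {0..<k + 2}"
      then obtain i where "y = f i" by blast
      then consider "y = w" | "i \<le> k" "y = p i" unfolding f_def by (auto split: if_splits)
      then show "y \<in> {1..n}"
      proof cases
        case 2
        then show ?thesis using p(4)[of i] p(2) b'(2) verts by (cases "i = k") auto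
      qed (use verts(1)[OF b(2)] in simp)
    qed
    fix x y assume xy: "x \<in> {0..<k + 2}" "y \<in> {0..<k + 2}"
    have pp: "E (p i) (p j) \<longleftrightarrow> j = Suc i \<or> i = Suc j" if "i \<le> k" "j \<le> k" for i j
    proof
      assume e: "E (p i) (p j)"
      then have "i \<noteq> j" using irrefl by metis
      then show "j = Suc i \<or> i = Suc j" using chordless[of i j] chordless[of j i] e sym[OF e] that by linarith
    next
      assume "j = Suc i \<or> i = Suc j"
      then show "E (p i) (p j)" using p(4)[of i] p(4)[of j] that sym by auto
    qed
    have wp: "E (p i) w \<longleftrightarrow> i = 0 \<or> i = k" if "i \<le> k" for i using pw(2)[OF that] sym_iff by blast
    consider "x \<le> k" "y \<le> k" | "x = k + 1" "y \<le> k" | "x \<le> k" "y = k + 1" | "x = k + 1" "y = k + 1"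
      using xy by fastforce
    then show "E (f x) (f y) = cycle_edges (k + 2) x y"
      by cases (auto simp: f_def cycle_edges_def pp pw wp irrefl)
  qed
  moreover have "k + 2 \<ge> 4" using k2 by simp
  ultimately show False using chordal unfolding chordal_def by blast
qed

text \<open>If the graph is not complete, take a smallest \<open>off_closed\<close> set
  \<open>C\<close> over all \<open>w\<close>, with boundary \<open>B\<close> among the neighbours of
  \<open>w\<close>. Minimality, chordality and claw-freeness turn C \<union> B into a clique, so
  every \<open>v\<close> in \<open>C\<close> is simplicial and only vertices of \<open>B\<close>
  have further neighbours. If two of these outer neighbourhoods were incomparable, \<open>w\<close>,
  which lies in both, would complete a tent.\<close>

lemma simple_vertex_exists:
  assumes A: "finite A" "A \<noteq> {}"
  shows "\<exists>v\<in>A. simplicial E A v \<and> (\<forall>u\<in>A. \<forall>u'\<in>A. E v u \<longrightarrow> E v u' \<longrightarrow>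
    (let D = \<lambda>u. {a\<in>A. E u a \<and> a \<noteq> v \<and> \<not> E v a} in D u \<subseteq> D u' \<or> D u' \<subseteq> D u))"
proof (cases "\<exists>w C. off_closed A w C")
  case False
  obtain v where v: "v \<in> A" using A by blast
  have complete: "E a b" if "a \<in> A" "b \<in> A" "a \<noteq> b" for a b
  proof (rule ccontr)
    assume "\<not> E a b"
    then have "off_closed A a {c\<in>A. c \<noteq> a \<and> \<not> E a c}"
      using that unfolding off_closed_def by blast
    then show False using False by blast
  qed
  have "{a\<in>A. E u a \<and> a \<noteq> v \<and> \<not> E v a} = {}" for u using complete[OF v] by auto
  then show ?thesis using v complete by (intro bexI[OF _ v]) (auto simp: simplicial_def Let_def)
next
  case True
  define m where "m = (LEAST m. \<exists>w C. off_closed A w C \<and> card C = m)"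
  have ex: "\<exists>m w C. off_closed A w C \<and> card C = m" using True by blast
  obtain w C where C: "off_closed A w C" "card C = m" using LeastI_ex[OF ex] unfolding m_def by blast
  have min: "card C \<le> card C'" if "off_closed A w' C'" for w' C'
    unfolding C(2) m_def by (rule Least_le) (use that in blast)
  have CA: "C \<subseteq> A" "\<And>c. c \<in> C \<Longrightarrow> c \<noteq> w" "\<And>c. c \<in> C \<Longrightarrow> \<not> E w c" "w \<in> A" "C \<noteq> {}"
    "\<And>c d. c \<in> C \<Longrightarrow> d \<in> A \<Longrightarrow> E c d \<Longrightarrow> d \<noteq> w \<Longrightarrow> \<not> E w d \<Longrightarrow> d \<in> C"
    using C(1) unfolding off_closed_def by blast+
  have fC: "finite C" using CA(1) A finite_subset by blast
  define B where "B = {b\<in>A. E w b \<and> (\<exists>c\<in>C. E b c)}"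
  have Bclique: "E b b'" if "b \<in> B" "b' \<in> B" "b \<noteq> b'" for b b'
    by (rule boundary_clique[OF A(1) C(1) min]) (use that in \<open>auto simp: B_def\<close>)
  have nbr: "d \<in> C \<union> B" if "c \<in> C" "d \<in> A" "E c d" for c d
    using CA(3,6) that sym unfolding B_def by blast
  have smaller: False if w': "w' \<in> A" and C': "C' \<subset> C" "C' \<noteq> {}" "\<And>c. c \<in> C' \<Longrightarrow> c \<noteq> w' \<and> \<not> E w' c"
    and cl: "\<And>c d. c \<in> C' \<Longrightarrow> d \<in> A \<Longrightarrow> E c d \<Longrightarrow> d \<noteq> w' \<Longrightarrow> \<not> E w' d \<Longrightarrow> d \<in> C'" for w' C'
  proof -
    have "off_closed A w' C'" unfolding off_closed_def using w' C' cl CA(1) by blast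
    from min[OF this] psubset_card_mono[OF fC C'(1)] show False by simp
  qed
  have BC: "E b c" if "b \<in> B" "c \<in> C" for b c
  proof (rule ccontr)
    assume "\<not> E b c"
    \<comment> \<open>The part of \<open>C\<close> missed by \<open>b\<close> would be a smaller
      closed set, now relative to \<open>b\<close> in place of \<open>w\<close>.\<close>
    let ?C' = "{c\<in>C. \<not> E b c}"
    show False
    proof (rule smaller[of b ?C'])
      show "b \<in> A" using that by (simp add: B_def)
      obtain c' where "c' \<in> C" "E b c'" using \<open>b \<in> B\<close> unfolding B_def by blast
      then show "?C' \<subset> C" by blast
      show "?C' \<noteq> {}" using \<open>\<not> E b c\<close> that by blast
      show "c \<noteq> b \<and> \<not> E b c" if "c \<in> ?C'" for c
        using that CA(3) \<open>b \<in> B\<close> unfolding B_def by blast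
      show "d \<in> ?C'" if "c \<in> ?C'" "d \<in> A" "E c d" "d \<noteq> b" "\<not> E b d" for c d
        using nbr[of c d] that Bclique[OF \<open>b \<in> B\<close>, of d] by blast
    qed
  qed
  have CC: "E c c'" if "c \<in> C" "c' \<in> C" "c \<noteq> c'" for c c'
  proof (cases "B = {}")
    case False
    then obtain b where b: "b \<in> B" by blast
    then have "E b w" using sym unfolding B_def by blast
    from no_claw[OF this BC[OF b that(1)] BC[OF b that(2)]] that CA(2,3) show ?thesis by metis
  next
    case True
    show ?thesis
    proof (rule ccontr)
      assume "\<not> E c c'"
      show False
      proof (rule smaller[of c "{d\<in>C. d \<noteq> c \<and> \<not> E c d}"])
        show "d \<in> {d\<in>C. d \<noteq> c \<and> \<not> E c d}" if "e \<in> {d\<in>C. d \<noteq> c \<and> \<not> E c d}" "d \<in> A" "E e d" "d \<noteq> c" "\<not> E c d" for e d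
          using nbr[of e d] that True by blast
      qed (use that CA(1) \<open>\<not> E c c'\<close> in auto)
    qed
  qed
  obtain v where v: "v \<in> C" using CA(5) by blast
  have Nv: "E v u \<longleftrightarrow> u \<noteq> v \<and> u \<in> C \<union> B" if "u \<in> A" for u
    using nbr[OF v that] CC[OF v] BC[OF _ v] sym irrefl by blast
  have clique: "E a b" if "a \<in> C \<union> B" "b \<in> C \<union> B" "a \<noteq> b" for a b
    using that CC BC Bclique sym by blast
  define D where "D u = {a\<in>A. E u a \<and> a \<noteq> v \<and> \<not> E v a}" for u
  have BA: "C \<union> B \<subseteq> A" using CA(1) unfolding B_def by blast
  have DC: "D u = {}" if "u \<in> C" for u
    using nbr[OF that] Nv unfolding D_def by blast
  have nested: "D u \<subseteq> D u' \<or> D u' \<subseteq> D u" if u: "u \<in> A" "E v u" and u': "u' \<in> A" "E v u'" for u u'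
  proof (rule ccontr)
    assume nn: "\<not> ?thesis"
    then obtain a a' where a: "a \<in> D u" "a \<notin> D u'" and a': "a' \<in> D u'" "a' \<notin> D u" by blast
    have uB: "u \<in> B" "u' \<in> B" using nn DC Nv[OF u(1)] Nv[OF u'(1)] u u' by auto
    have "u \<noteq> u'" using nn by blast
    have uu': "E u u'" using Bclique uB \<open>u \<noteq> u'\<close> by blast
    have vw: "\<not> E v w" "v \<noteq> w" using CA(2,3) v sym by blast+
    have uw: "E u w" "E u' w" using uB sym unfolding B_def by blast+
    have wD: "w \<in> D u" "w \<in> D u'" using vw uw CA(4) unfolding D_def by blast+
    \<comment> \<open>Nonadjacent members of \<open>D t\<close> would form a claw at
      \<open>t\<close> with \<open>v\<close> as third leaf.\<close>
    have Dcl: "E x y" if "x \<in> D t" "y \<in> D t" "x \<noteq> y" "E v t" for x y t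
    proof -
      have "E t v" "E t x" "E t y" "v \<noteq> x" "v \<noteq> y" "\<not> E v x" "\<not> E v y"
        using that sym unfolding D_def by blast+
      then show ?thesis using no_claw[of t v x y] that(3) by blast
    qed
    have aw: "E a w" "E a' w"
      using Dcl[OF a(1) wD(1) _ u(2)] Dcl[OF a'(1) wD(2) _ u'(2)] a a' wD by blast+
    have au: "E a u" "E a' u'" "\<not> E v a" "\<not> E v a'" "a \<noteq> v" "a' \<noteq> v" "\<not> E a u'" "\<not> E a' u"
      using a a' sym unfolding D_def by blast+
    have anu: "a \<noteq> u'" "a' \<noteq> u" using au u u' by blast+
    have "\<not> E a a'"
    proof
      assume "E a a'"
      from no_square[OF this au(2) sym[OF uu'] sym[OF au(1)]] anu au show False by metis
    qed
    from no_tent[OF u(2) u'(2) uu' uw au(1) aw(1) au(2) aw(2) vw(1) au(3,4,7,8) this au(5,6) vw(2) anu]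
    show False .
  qed
  have "simplicial E A v"
    unfolding simplicial_def using Nv clique by blast
  then show ?thesis using v CA(1) nested unfolding D_def Let_def by blast
qed

text \<open>The neighbours of \<open>v\<close> are sorted by the number of their neighbours outside
  N[v]; since these outer sets are nested, size orders them by inclusion. The remaining neighbours
  of \<open>s j\<close> are later members of the clique N[v], which see every outer neighbour of
  \<open>s j\<close>, and outer vertices, which are pairwise adjacent by the claw at
  \<open>s j\<close> with leaf \<open>v\<close>.\<close>

lemma simple_elimination_order:
  assumes A: "finite A" "A \<noteq> {}"
  obtains s :: "nat \<Rightarrow> nat" and m where "0 < m" "s 0 \<in> A" "inj_on s {..<m}"
    "s ` {..<m} = {u\<in>A. u = s 0 \<or> E (s 0) u}"
    "\<And>j. j < m \<Longrightarrow> simplicial E (A - s ` {..<j}) (s j)"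
proof -
  obtain v where v: "v \<in> A" "simplicial E A v"
    and nest0: "\<forall>u\<in>A. \<forall>u'\<in>A. E v u \<longrightarrow> E v u' \<longrightarrow>
    (let D = \<lambda>u. {a\<in>A. E u a \<and> a \<noteq> v \<and> \<not> E v a} in D u \<subseteq> D u' \<or> D u' \<subseteq> D u)"
    using simple_vertex_exists[OF A] by blast
  define D where "D u = {a\<in>A. E u a \<and> a \<noteq> v \<and> \<not> E v a}" for u
  have nest: "D u \<subseteq> D u' \<or> D u' \<subseteq> D u" if "u \<in> A" "u' \<in> A" "E v u" "E v u'" for u u'
    using nest0 that unfolding D_def Let_def by blast
  have fD: "finite (D u)" for u using A unfolding D_def by simp
  define Nv where "Nv = {u\<in>A. u = v \<or> E v u}"
  \<comment> \<open>The successor reserves the key 0 for \<open>v\<close>, which is thus sorted to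
    the front.\<close>
  define key where "key u = (if u = v then 0 else Suc (card (D u)))" for u
  have "finite Nv" using A by (simp add: Nv_def)
  then obtain ys where ys: "set ys = Nv" "distinct ys" using finite_distinct_list by blast
  define xs where "xs = sort_key key ys"
  have xs: "set xs = Nv" "distinct xs" "sorted (map key xs)" using ys by (auto simp: xs_def)
  define m where "m = length xs"
  have m: "0 < m" using xs(1) v(1) by (auto simp: m_def Nv_def intro: Nat.gr0I)
  have key_mono: "key (xs ! i) \<le> key (xs ! j)" if "i \<le> j" "j < m" for i j
    using sorted_nth_mono[OF xs(3), of i j] that by (simp add: m_def)
  have 0: "xs ! 0 = v"
  proof -
    obtain i where "i < m" "xs ! i = v" using xs(1) v(1) by (metis (mono_tags, lifting) Nv_def in_set_conv_nth m_def mem_Collect_eq)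
    then have "key (xs ! 0) = 0" using key_mono[of 0 i] by (simp add: key_def)
    then show ?thesis by (auto simp: key_def split: if_splits)
  qed
  have inj: "inj_on ((!) xs) {..<m}" using xs(2) by (simp add: inj_on_nth m_def)
  have im: "(!) xs ` {..<m} = Nv" using xs(1) unfolding m_def by (auto simp: set_conv_nth)
  show ?thesis
  proof (rule that[of m "(!) xs"])
    fix j assume j: "j < m"
    let ?s = "(!) xs"
    have sj: "?s j \<in> Nv" using im j by blast
    have split: "a \<in> D (?s j) \<or> (\<exists>i. j < i \<and> i < m \<and> a = ?s i)"
      if "a \<in> A - ?s ` {..<j}" "E (?s j) a" for a
    proof (cases "a \<in> Nv")
      case True
      then obtain i where "i < m" "a = ?s i" using im by blast
      moreover have "i \<noteq> j" using that \<open>a = ?s i\<close> irrefl by metis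
      ultimately show ?thesis using that by (metis DiffD2 image_eqI lessThan_iff linorder_neqE_nat)
    next
      case False
      then show ?thesis using that unfolding D_def Nv_def by blast
    qed
    have DD: "E (?s i) a" if "j < i" "i < m" "a \<in> D (?s j)" for i a
    proof -
      have "?s i \<in> Nv" using im that by blast
      have "?s i \<noteq> v" using inj_onD[OF inj, of i 0] 0 that m by auto
      moreover have "?s j \<noteq> v" using that(3) unfolding D_def by auto
      ultimately have "card (D (?s j)) \<le> card (D (?s i))" using key_mono[of j i] that by (simp add: key_def)
      moreover have "?s i \<in> A" "?s j \<in> A" "E v (?s i)" "E v (?s j)"
        using \<open>?s i \<in> Nv\<close> sj \<open>?s i \<noteq> v\<close> \<open>?s j \<noteq> v\<close> unfolding Nv_def by auto
      ultimately have "D (?s j) \<subseteq> D (?s i)" using nest[of "?s i" "?s j"] card_seteq[OF fD, of "D (?s i)" "?s j"] by blast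
      then show ?thesis using that(3) unfolding D_def by blast
    qed
    show "simplicial E (A - ?s ` {..<j}) (?s j)"
      unfolding simplicial_def
    proof (intro ballI impI)
      fix a b assume a: "a \<in> A - ?s ` {..<j}" "E (?s j) a" and b: "b \<in> A - ?s ` {..<j}" "E (?s j) b" and "a \<noteq> b"
      have NN: "E x y" if "x \<in> Nv" "y \<in> Nv" "x \<noteq> y" for x y
        using v(2) that sym unfolding simplicial_def Nv_def by blast
      consider "a \<in> D (?s j)" "b \<in> D (?s j)" | i where "j < i" "i < m" "a = ?s i" "b \<in> D (?s j)"
        | i where "j < i" "i < m" "b = ?s i" "a \<in> D (?s j)" | "a \<in> Nv" "b \<in> Nv"
        using split[OF a] split[OF b] im by blast
      then show "E a b"
      proof cases
        case 1
        have "?s j \<noteq> v" using 1 unfolding D_def by auto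
        then have "E (?s j) v" using sj sym unfolding Nv_def by blast
        from no_claw[OF this a(2) b(2)] 1 \<open>a \<noteq> b\<close> show ?thesis unfolding D_def by blast
      qed (use DD sym NN \<open>a \<noteq> b\<close> in blast)+
    qed
  qed (use m v(1) inj im 0 in \<open>auto simp: Nv_def\<close>)
qed

end

section \<open>Polynomials and ideals\<close>

abbreviation "single \<equiv> Poly_Mapping.single"
abbreviation "lookup \<equiv> Poly_Mapping.lookup"
abbreviation "keys \<equiv> Poly_Mapping.keys"

lemma mpoly_sum_single: "p = (\<Sum>m\<in>keys p. single m (lookup p m))"
  by (rule poly_mapping_eqI)
    (simp add: lookup_sum lookup_single when_def in_keys_iff)

lemma mpoly_induct [case_names zero single add]:
  assumes "P 0" "\<And>m c. P (single m c)" "\<And>p q. P p \<Longrightarrow> P q \<Longrightarrow> P (p + q)"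
  shows "P (p :: 'a \<Rightarrow>\<^sub>0 'b::comm_monoid_add)"
proof -
  have "P (\<Sum>m\<in>X. single m (lookup p m))" for X
    by (induction X rule: infinite_finite_induct) (auto intro: assms)
  then show ?thesis using mpoly_sum_single[of p] by metis
qed

text \<open>Homogeneous components and the substitution of 0 for variables are both of this form,
  with \<open>P\<close> a condition on degrees or on variables.\<close>

definition flt :: "('a \<Rightarrow> bool) \<Rightarrow> ('a \<Rightarrow>\<^sub>0 'b::zero) \<Rightarrow> 'a \<Rightarrow>\<^sub>0 'b" where
  "flt P p = Poly_Mapping.Abs_poly_mapping (\<lambda>m. if P m then lookup p m else 0)"

lemma lookup_flt: "lookup (flt P p) m = (if P m then lookup p m else 0)"
proof -
  have "finite {m. (if P m then lookup p m else 0) \<noteq> 0}"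
    by (rule finite_subset[OF _ finite_lookup[of p]]) auto
  then show ?thesis by (simp add: flt_def lookup_Abs_poly_mapping)
qed

lemma flt_add: "flt P (p + q) = flt P p + flt P (q :: _ \<Rightarrow>\<^sub>0 'b::monoid_add)"
  by (rule poly_mapping_eqI) (simp add: lookup_flt lookup_add)

lemma flt_zero [simp]: "flt P 0 = 0"
  by (rule poly_mapping_eqI) (simp add: lookup_flt)

lemma flt_single: "flt P (single m c) = (if P m then single m c else 0)"
  by (rule poly_mapping_eqI) (auto simp: lookup_flt lookup_single when_def)

lemma flt_flt: "flt P (flt Q p) = flt (\<lambda>m. P m \<and> Q m) p"
  by (rule poly_mapping_eqI) (simp add: lookup_flt)

lemma flt_sum: "flt P (sum f X) = (\<Sum>x\<in>X. flt P (f x :: _ \<Rightarrow>\<^sub>0 'b::comm_monoid_add))"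
  by (induction X rule: infinite_finite_induct) (simp_all add: flt_add)

lemma flt_diff: "flt P (p - q) = flt P p - flt P (q :: _ \<Rightarrow>\<^sub>0 'b::ab_group_add)"
  by (rule poly_mapping_eqI) (simp add: lookup_flt lookup_minus)

lemma flt_eq_self_iff: "flt P p = p \<longleftrightarrow> (\<forall>m\<in>keys p. P m)"
proof
  assume eq: "flt P p = p"
  show "\<forall>m\<in>keys p. P m"
  proof
    fix m assume "m \<in> keys p"
    then show "P m" using lookup_flt[of P p m] unfolding eq by (cases "P m") (simp_all add: in_keys_iff)
  qed
next
  assume "\<forall>m\<in>keys p. P m"
  then show "flt P p = p" by (intro poly_mapping_eqI) (auto simp: lookup_flt in_keys_iff)
qed

text \<open>Both sides are biadditive, so it is enough to compare them on monomials.\<close>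
lemma biadditive_eqI:
  fixes f g :: "('k::comm_ring_1) mpoly \<Rightarrow> 'k mpoly \<Rightarrow> 'c::comm_monoid_add"
  assumes "\<And>p p' q. f (p + p') q = f p q + f p' q" "\<And>p q q'. f p (q + q') = f p q + f p q'"
    "\<And>p p' q. g (p + p') q = g p q + g p' q" "\<And>p q q'. g p (q + q') = g p q + g p q'"
    "\<And>q. f 0 q = 0" "\<And>p. f p 0 = 0" "\<And>q. g 0 q = 0" "\<And>p. g p 0 = 0"
    "\<And>m c m' c'. f (single m c) (single m' c') =
       g (single m c) (single m' c')"
  shows "f p q = g p q"
proof (induction p rule: mpoly_induct)
  case (single m c)
  show ?case by (induction q rule: mpoly_induct) (simp_all add: assms)
qed (simp_all add: assms)

lemma keys_add_nat: "keys (m + m') = keys m \<union> keys (m' :: 'a \<Rightarrow>\<^sub>0 nat)"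
  by (auto simp: in_keys_iff lookup_add)

lemma mdeg_eq_sum:
  "finite X \<Longrightarrow> keys m \<subseteq> X \<Longrightarrow> mdeg m = (\<Sum>v\<in>X. lookup m v)"
  unfolding mdeg_def by (rule sum.mono_neutral_left) (auto simp: in_keys_iff)

lemma mdeg_add: "mdeg (m + m') = mdeg m + mdeg m'"
proof -
  let ?X = "keys m \<union> keys m'"
  show ?thesis
    using mdeg_eq_sum[of ?X m] mdeg_eq_sum[of ?X m'] mdeg_eq_sum[of ?X "m + m'"]
    by (simp add: keys_add_nat lookup_add sum.distrib)
qed

lemma mdeg_zero [simp]: "mdeg 0 = 0" and mdeg_single [simp]: "mdeg (single v k) = k"
  by (simp_all add: mdeg_def)

lemma mdeg_eq_0_iff: "mdeg m = 0 \<longleftrightarrow> m = 0"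
  by (auto simp: mdeg_def poly_mapping_eq_iff fun_eq_iff in_keys_iff)

lemma mdeg_eq_1: "mdeg m = 1 \<Longrightarrow> \<exists>v. m = single v 1"
proof -
  assume "mdeg m = 1"
  then have "m \<noteq> 0" by auto
  then obtain v where v: "v \<in> keys m"
    by (metis ex_in_conv keys_eq_empty)
  have "m = single v 1 + (m - single v 1)"
    by (rule poly_mapping_eqI) (use v in \<open>auto simp: lookup_add lookup_minus lookup_single when_def in_keys_iff\<close>)
  moreover from this have "mdeg m = 1 + mdeg (m - single v 1)" by (metis mdeg_add mdeg_single)
  ultimately show ?thesis using \<open>mdeg m = 1\<close> mdeg_eq_0_iff by (metis add_cancel_right_right add_0_right)
qed

definition homc :: "nat \<Rightarrow> ('k::comm_ring_1) mpoly \<Rightarrow> 'k mpoly" where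
  "homc d = flt (\<lambda>m. mdeg m = d)"

lemma homc_mult: "homc d (homc e p * q) = (if e \<le> d then homc e p * homc (d - e) q else 0)"
  by (rule biadditive_eqI[of "\<lambda>p q. homc d (homc e p * q)"
        "\<lambda>p q. if e \<le> d then homc e p * homc (d - e) q else 0"])
    (auto simp: homc_def flt_add algebra_simps flt_single mult_single mdeg_add)

lemma graded_homc: "graded (homc :: nat \<Rightarrow> ('k::field) mpoly \<Rightarrow> _)"
proof
  fix d e :: nat and p q a :: "'k mpoly"
  show "homc d (p + q) = homc d p + homc d q" by (simp add: homc_def flt_add)
  show "homc d (homc e p) = (if d = e then homc d p else 0)"
    by (rule poly_mapping_eqI) (auto simp: homc_def lookup_flt)
  show "\<exists>D. p = (\<Sum>d\<le>D. homc d p)"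
  proof (intro exI poly_mapping_eqI)
    fix m
    let ?D = "Max (mdeg ` keys p)"
    have "mdeg m \<le> ?D" if "lookup p m \<noteq> 0"
      using that by (intro Max_ge) (auto simp: in_keys_iff)
    then show "lookup p m = lookup (\<Sum>d\<le>?D. homc d p) m"
      by (auto simp: lookup_sum homc_def lookup_flt)
  qed
  show "homc d (a * p) = (if e \<le> d then a * homc (d - e) p else 0)" if "homc e a = a"
    using homc_mult[of d e a p] that by simp
  show "homc 0 (1 :: 'k mpoly) = 1"
    by (simp add: homc_def flt_single flip: single_one)
  show "\<exists>q. homc 0 q = q \<and> q * p = 1" if "homc 0 p = p" "p \<noteq> 0"
  proof -
    have "\<forall>m\<in>keys p. m = 0"
      using that(1) unfolding homc_def flt_eq_self_iff by (simp add: mdeg_eq_0_iff)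
    then have p: "p = single 0 (lookup p 0)"
      by (intro poly_mapping_eqI) (auto simp: lookup_single when_def in_keys_iff)
    then have "lookup p 0 \<noteq> 0" using that(2) by (metis single_zero)
    then have "single 0 (inverse (lookup p 0)) * p = 1"
      by (subst p) (simp add: mult_single)
    then show ?thesis by (intro exI[of _ "single 0 (inverse (lookup p 0))"])
        (simp add: homc_def flt_single)
  qed
qed

text \<open>The ring endomorphism that substitutes 0 for the variables in \<open>U\<close>; it
  provides the sections of the algebra retracts.\<close>

definition elim :: "(nat + nat) set \<Rightarrow> ('k::comm_ring_1) mpoly \<Rightarrow> 'k mpoly" where
  "elim U = flt (\<lambda>m. keys m \<inter> U = {})"

lemma elim_add: "elim U (p + q) = elim U p + elim U q"
  and elim_diff: "elim U (p - q) = elim U p - elim U q"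
  and elim_zero [simp]: "elim U 0 = 0"
  and elim_elim: "elim U (elim U p) = elim U p"
  by (simp_all add: elim_def flt_add flt_diff flt_flt)

lemma elim_mult: "elim U (p * q) = elim U p * elim U q"
  by (rule biadditive_eqI[of "\<lambda>p q. elim U (p * q)" "\<lambda>p q. elim U p * elim U q"])
    (auto simp: elim_def flt_add algebra_simps flt_single mult_single keys_add_nat)

lemma elim_Var: "elim U (Var v) = (if v \<in> U then 0 else Var v)"
  by (simp add: elim_def Var_def flt_single)

lemma elim_homc: "homc d (elim U p) = elim U (homc d p)"
  by (simp add: homc_def elim_def flt_flt conj_commute)

lemma homc_Var: "homc 1 (Var v) = Var v"
  by (simp add: homc_def Var_def flt_single)

inductive_set idl :: "('k::comm_ring_1) mpoly set \<Rightarrow> 'k mpoly set" for A where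
  zero: "0 \<in> idl A"
| step: "a \<in> A \<Longrightarrow> p \<in> idl A \<Longrightarrow> c * a + p \<in> idl A"

lemma idl_gen: "a \<in> A \<Longrightarrow> a \<in> idl A"
  using idl.step[of a A 0 1] by (simp add: idl.zero)

lemma idl_add: "p \<in> idl A \<Longrightarrow> q \<in> idl A \<Longrightarrow> p + q \<in> idl A"
  by (induction p rule: idl.induct) (auto intro: idl.step simp: add.assoc)

lemma idl_mult: "p \<in> idl A \<Longrightarrow> c * p \<in> idl A"
proof (induction p rule: idl.induct)
  case (step a p d)
  then show ?case using idl.step[of a A "c * p" "c * d"] by (simp add: algebra_simps)
qed (simp add: idl.zero)

lemma idl_uminus: "p \<in> idl A \<Longrightarrow> - p \<in> idl A"
  using idl_mult[of p A "-1"] by simp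

lemma idl_diff: "p \<in> idl A \<Longrightarrow> q \<in> idl A \<Longrightarrow> p - q \<in> idl A"
  using idl_add[of p A "- q"] by (simp add: idl_uminus)

lemma idl_diff_iff: "p - q \<in> idl A \<Longrightarrow> p \<in> idl A \<longleftrightarrow> q \<in> idl A"
  using idl_add[of "p - q" A q] idl_diff[of p A "p - q"] by auto

lemma idl_sum: "(\<And>x. x \<in> X \<Longrightarrow> f x \<in> idl A) \<Longrightarrow> sum f X \<in> idl A"
  by (induction X rule: infinite_finite_induct) (auto intro: idl_add idl.zero)

lemma idl_mult_subset: "p \<in> idl A \<Longrightarrow> (\<And>a. a \<in> A \<Longrightarrow> f * a \<in> idl B) \<Longrightarrow> f * p \<in> idl B"
proof (induction p rule: idl.induct)
  case (step a p c)
  then show ?case using idl_add[OF idl_mult[of "f * a" B c], of "f * p"] by (simp add: algebra_simps)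
qed (simp add: idl.zero)

lemma idl_subset: "(\<And>a. a \<in> A \<Longrightarrow> a \<in> idl B) \<Longrightarrow> idl A \<subseteq> idl B"
  using idl_mult_subset[of _ A 1 B] by auto

lemma idl_mono: "A \<subseteq> B \<Longrightarrow> idl A \<subseteq> idl B"
  by (rule idl_subset) (auto intro: idl_gen)

lemma idl_elim:
  "p \<in> idl A \<Longrightarrow> (\<And>a. a \<in> A \<Longrightarrow> elim U a \<in> idl B) \<Longrightarrow> elim U p \<in> idl B"
  by (induction p rule: idl.induct) (auto simp: elim_add elim_mult intro: idl_add idl_mult idl.zero)

lemma elim_decomp: "p - elim U p \<in> idl (Var ` U)"
proof (induction p rule: mpoly_induct)
  case (single m c)
  show ?case
  proof (cases "keys m \<inter> U = {}")
    case False
    then obtain v where v: "v \<in> keys m" "v \<in> U" by blast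
    have "m = (m - single v 1) + single v 1"
      by (rule poly_mapping_eqI) (use v in \<open>auto simp: lookup_add lookup_minus lookup_single when_def in_keys_iff\<close>)
    then have "single m c = single (m - single v 1) c * Var v"
      by (simp add: Var_def mult_single)
    then have "single m c \<in> idl (Var ` U)"
      using v idl_mult[OF idl_gen[of "Var v" "Var ` U"]] by simp
    then show ?thesis using False by (simp add: elim_def flt_single)
  qed (simp add: elim_def flt_single idl.zero)
next
  case (add p q)
  have eq: "p + q - elim U (p + q) = (p - elim U p) + (q - elim U q)" by (simp add: elim_add)
  show ?case unfolding eq by (rule idl_add[OF add])
qed (simp add: idl.zero)

lemma idl_union_iff: "p \<in> idl (A \<union> B) \<longleftrightarrow> (\<exists>q\<in>idl B. p - q \<in> idl A)"
proof
  assume "p \<in> idl (A \<union> B)"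
  then show "\<exists>q\<in>idl B. p - q \<in> idl A"
  proof (induction p rule: idl.induct)
    case (step a p c)
    then obtain q where q: "q \<in> idl B" "p - q \<in> idl A" by blast
    show ?case
    proof (cases "a \<in> A")
      case True
      then show ?thesis using q idl.step[OF True q(2), of c] by (intro bexI[of _ q]) (simp_all add: algebra_simps)
    next
      case False
      then show ?thesis using q idl.step[of a B q c] step(1)
        by (intro bexI[of _ "c * a + q"]) (simp_all add: algebra_simps)
    qed
  next
    case zero
    show ?case by (rule bexI[of _ 0]) (simp_all add: idl.zero)
  qed
next
  assume "\<exists>q\<in>idl B. p - q \<in> idl A"
  then obtain q where "q \<in> idl B" "p - q \<in> idl A" by blast
  then have "q \<in> idl (A \<union> B)" "p - q \<in> idl (A \<union> B)" using idl_mono[of A "A \<union> B"] idl_mono[of B "A \<union> B"] by auto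
  from idl_add[OF this] show "p \<in> idl (A \<union> B)" by simp
qed

lemma idl_single_iff: "q \<in> idl {b} \<longleftrightarrow> (\<exists>c. q = c * b)"
proof
  show "q \<in> idl {b} \<Longrightarrow> \<exists>c. q = c * b"
  proof (induction q rule: idl.induct)
    case (step a p c)
    then obtain d where "p = d * b" by blast
    then have "c * a + p = (c + d) * b" using step by (simp add: distrib_right)
    then show ?case by blast
  qed (auto intro: exI[of _ 0])
qed (auto intro: idl_mult idl_gen)

lemma idl_row_iff: "p \<in> idl (A \<union> a ` {..<m}) \<longleftrightarrow> (\<exists>w. p - mapp (\<lambda>_. a) m w 0 \<in> idl A)"
proof (induction m arbitrary: p)
  case 0
  then show ?case by simp
next
  case (Suc m)
  have eq: "A \<union> a ` {..<Suc m} = (A \<union> a ` {..<m}) \<union> {a m}" by (auto simp: lessThan_Suc)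
  have "p \<in> idl (A \<union> a ` {..<Suc m}) \<longleftrightarrow> (\<exists>q\<in>idl {a m}. p - q \<in> idl (A \<union> a ` {..<m}))"
    unfolding eq by (rule idl_union_iff)
  also have "\<dots> \<longleftrightarrow> (\<exists>c w. p - c * a m - mapp (\<lambda>_. a) m w 0 \<in> idl A)"
    unfolding Suc.IH Bex_def idl_single_iff by blast
  also have "\<dots> \<longleftrightarrow> (\<exists>w. p - mapp (\<lambda>_. a) (Suc m) w 0 \<in> idl A)"
  proof
    assume "\<exists>c w. p - c * a m - mapp (\<lambda>_. a) m w 0 \<in> idl A"
    then obtain c w where cw: "p - c * a m - mapp (\<lambda>_. a) m w 0 \<in> idl A" by blast
    have "mapp (\<lambda>_. a) (Suc m) (\<lambda>j. if j = m then c else w j) 0 = c * a m + mapp (\<lambda>_. a) m w 0"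
      by (simp add: mapp_def mult.commute add.commute)
    then have "p - mapp (\<lambda>_. a) (Suc m) (\<lambda>j. if j = m then c else w j) 0 \<in> idl A"
      using cw by (simp add: diff_diff_eq)
    then show "\<exists>w. p - mapp (\<lambda>_. a) (Suc m) w 0 \<in> idl A" by blast
  next
    assume "\<exists>w. p - mapp (\<lambda>_. a) (Suc m) w 0 \<in> idl A"
    then obtain w where "p - mapp (\<lambda>_. a) (Suc m) w 0 \<in> idl A" by blast
    then have "p - w m * a m - mapp (\<lambda>_. a) m w 0 \<in> idl A" by (simp add: mapp_def algebra_simps)
    then show "\<exists>c w. p - c * a m - mapp (\<lambda>_. a) m w 0 \<in> idl A" by blast
  qed
  finally show ?case .
qed

interpretation gr: graded "homc :: nat \<Rightarrow> ('k::field) mpoly \<Rightarrow> _" by (rule graded_homc)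

lemma hideal_idl:
  assumes "\<And>a. a \<in> A \<Longrightarrow> \<exists>e. homc e a = (a :: ('k::field) mpoly)"
  shows "gr.hideal (idl A)"
  unfolding gr.hideal_def
proof (intro conjI ballI allI)
  fix p d assume "p \<in> idl A"
  then show "homc d p \<in> idl A"
  proof (induction p rule: idl.induct)
    case (step a p c)
    obtain e where "homc e a = a" using assms step by blast
    then have "homc d (a * c) = (if e \<le> d then a * homc (d - e) c else 0)" by (rule gr.hc_mult)
    moreover have "a * r \<in> idl A" for r
      by (subst mult.commute) (rule idl_mult[OF idl_gen[OF step(1)]])
    ultimately have "homc d (a * c) \<in> idl A" by (simp add: idl.zero)
    then have "homc d (c * a) \<in> idl A" by (simp only: mult.commute)
    then show ?case using step by (auto simp: gr.hc_add intro: idl_add)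
  qed (simp add: idl.zero)
qed (auto intro: idl.zero idl_add idl_mult)

lemma lookup_Var_mult: "lookup (Var v * p) (single v 1 + m) = lookup p m"
proof (induction p rule: mpoly_induct)
  case (single m' c)
  then show ?case by (simp add: Var_def mult_single lookup_single)
qed (simp_all add: distrib_left lookup_add)

lemma Var_mult_cancel: "Var v * p = Var v * q \<Longrightarrow> p = q"
  by (metis lookup_Var_mult poly_mapping_eqI)

text \<open>Splitting each coefficient into its part free of \<open>v\<close> and a multiple of
  \<open>v\<close> shows that the part of an ideal element divisible by \<open>v\<close> is
  \<open>Var v\<close> times an ideal element. A multiple of \<open>Var v\<close> has no other
  part.\<close>

lemma idl_free_variable:
  assumes free: "\<And>a. a \<in> A \<Longrightarrow> elim {v} a = a" and "Var v * q \<in> idl A"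
  shows "q \<in> idl A"
proof -
  have "\<exists>r\<in>idl A. p - elim {v} p = Var v * r" if "p \<in> idl A" for p
    using that
  proof (induction p rule: idl.induct)
    case (step a p c)
    then obtain r where r: "r \<in> idl A" "p - elim {v} p = Var v * r" by blast
    have "c - elim {v} c \<in> idl {Var v}" using elim_decomp[of c "{v}"] by simp
    then obtain w where c: "c - elim {v} c = w * Var v" unfolding idl_single_iff by blast
    have "c * a + p - elim {v} (c * a + p) = (c - elim {v} c) * a + (p - elim {v} p)"
      using free[OF step(1)] by (simp add: elim_add elim_mult algebra_simps)
    also have "\<dots> = Var v * (w * a + r)" unfolding c r by (simp add: algebra_simps)
    finally show ?case using idl.step[OF step(1) r(1)] by blast
  next
    case zero
    show ?case by (rule bexI[of _ 0]) (simp_all add: idl.zero)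
  qed
  from this[OF assms(2)] obtain r where "r \<in> idl A" "Var v * q - elim {v} (Var v * q) = Var v * r" by blast
  moreover have "elim {v} (Var v * q) = 0" by (simp add: elim_mult elim_Var)
  ultimately show ?thesis using Var_mult_cancel[of v q r] by simp
qed

section \<open>Binomial edge ideals\<close>

definition minor :: "nat \<Rightarrow> nat \<Rightarrow> ('k::comm_ring_1) mpoly" where
  "minor i j = xv i * yv j - xv j * yv i"

text \<open>The complement is taken in all natural numbers, so only the variables of
  \<open>A\<close> survive in the quotient, which is the ring of the induced subgraph on
  \<open>A\<close>.\<close>

definition gens :: "(nat \<Rightarrow> nat \<Rightarrow> bool) \<Rightarrow> nat set \<Rightarrow> ('k::comm_ring_1) mpoly set" where
  "gens E A = {minor i j | i j. i \<in> A \<and> j \<in> A \<and> E i j} \<union> (xv ` (- A) \<union> yv ` (- A))"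

abbreviation edge_ideal :: "(nat \<Rightarrow> nat \<Rightarrow> bool) \<Rightarrow> nat set \<Rightarrow> ('k::comm_ring_1) mpoly set" where
  "edge_ideal E A \<equiv> idl (gens E A)"

definition vars_off :: "nat set \<Rightarrow> (nat + nat) set" where
  "vars_off A = Inl ` (- A) \<union> Inr ` (- A)"

lemma gensE:
  assumes "a \<in> gens E A"
  obtains i j where "a = minor i j" "i \<in> A" "j \<in> A" "E i j"
    | w where "w \<notin> A" "a = xv w" | w where "w \<notin> A" "a = yv w"
  using assms unfolding gens_def by blast

lemma gensI:
  "i \<in> A \<Longrightarrow> j \<in> A \<Longrightarrow> E i j \<Longrightarrow> minor i j \<in> gens E A"
  "w \<notin> A \<Longrightarrow> xv w \<in> gens E A" "w \<notin> A \<Longrightarrow> yv w \<in> gens E A"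
  unfolding gens_def by blast+

lemmas edge_idealI = gensI[THEN idl_gen]

lemma minor_swap: "minor j i = - minor i j"
  by (simp add: minor_def algebra_simps)

lemma homc_minor: "homc 2 (minor i j :: ('k::field) mpoly) = minor i j"
  by (simp add: minor_def xv_def yv_def homc_def Var_def mult_single flt_diff flt_single mdeg_add)

lemma hideal_edge_ideal: "gr.hideal (edge_ideal E A :: ('k::field) mpoly set)"
proof (rule hideal_idl)
  fix a :: "'k mpoly" assume "a \<in> gens E A"
  then show "\<exists>e. homc e a = a"
    by (cases rule: gensE) (use homc_minor homc_Var in \<open>auto simp: xv_def yv_def\<close>)
qed

lemma minor_in_idl: "xv i \<in> idl S \<Longrightarrow> yv i \<in> idl S \<Longrightarrow> minor i j \<in> idl S \<and> minor j i \<in> idl S"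
  using idl_mult[of "xv i" S "yv j"] idl_mult[of "yv i" S "xv j"]
  by (auto simp: minor_def mult.commute intro: idl_diff)

lemma edge_ideal_antimono:
  assumes "B \<subseteq> A"
  shows "edge_ideal E A \<subseteq> edge_ideal E B"
proof (rule idl_subset)
  fix a assume "a \<in> gens E A"
  then show "a \<in> edge_ideal E B"
  proof (cases rule: gensE)
    case (1 i j)
    show ?thesis
    proof (cases "i \<in> B \<and> j \<in> B")
      case False
      then have "minor i j \<in> edge_ideal E B"
        using minor_in_idl[OF edge_idealI(2,3)] by blast
      then show ?thesis using 1 by simp
    qed (use 1 in \<open>auto intro: edge_idealI\<close>)
  qed (use assms in \<open>auto intro: edge_idealI\<close>)
qed

lemma elim_vars_off:
  "elim (vars_off B) (xv i) = (if i \<in> B then xv i else 0)"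
  "elim (vars_off B) (yv i) = (if i \<in> B then yv i else 0)"
  "elim (vars_off B) (minor i j) = (if i \<in> B \<and> j \<in> B then minor i j else 0)"
  by (auto simp: xv_def yv_def minor_def elim_diff elim_mult elim_Var vars_off_def)

text \<open>Minors of the induced subgraph on \<open>B\<close> are minors for \<open>A\<close>, and
  the other variables go to 0. With \<open>edge_ideal_antimono\<close> this makes the quotient for
  \<open>B\<close> an algebra retract of the one for \<open>A\<close>.\<close>

lemma elim_edge_ideal:
  assumes "B \<subseteq> A" "p \<in> edge_ideal E B"
  shows "elim (vars_off B) p \<in> edge_ideal E A"
  using assms(2)
proof (rule idl_elim)
  fix a assume "a \<in> gens E B"
  then show "elim (vars_off B) a \<in> edge_ideal E A"
    by (cases rule: gensE) (use assms(1) in \<open>auto simp: elim_vars_off intro: edge_idealI idl.zero\<close>)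
qed

lemma elim_vars_off_diff: "p - elim (vars_off B) p \<in> edge_ideal E B"
proof -
  have "Var ` vars_off B \<subseteq> gens E B" unfolding vars_off_def gens_def xv_def yv_def by auto
  then show ?thesis using elim_decomp idl_mono by blast
qed

definition complete_nbhd :: "(nat \<Rightarrow> nat \<Rightarrow> bool) \<Rightarrow> nat set \<Rightarrow> nat \<Rightarrow> nat \<Rightarrow> nat \<Rightarrow> bool" where
  "complete_nbhd E A w a b \<longleftrightarrow> E a b \<or> a \<in> A \<and> b \<in> A \<and> E w a \<and> E w b \<and> a \<noteq> b"

text \<open>The 3 by 3 determinant on columns \<open>w\<close>, \<open>a\<close>, \<open>b\<close>
  with a repeated row vanishes; expanding along that row expresses the product by minors of edges at
  \<open>w\<close>.\<close>

lemma mult_minor_nbr: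
  assumes "w \<in> A" "a \<in> A" "b \<in> A" "E w a" "E w b"
  shows "xv w * minor a b \<in> edge_ideal E A" "yv w * minor a b \<in> edge_ideal E A"
proof -
  have eqs: "xv w * minor a b = xv a * minor w b - xv b * minor w a"
    "yv w * minor a b = yv a * minor w b - yv b * minor w a"
    by (simp_all add: minor_def algebra_simps)
  show "xv w * minor a b \<in> edge_ideal E A" "yv w * minor a b \<in> edge_ideal E A"
    unfolding eqs by (intro idl_diff idl_mult edge_idealI(1) assms)+
qed

text \<open>Ohtani's decomposition. Modulo the edge ideal the new minors are killed by \<open>x\<^sub>w\<close> and \<open>y\<^sub>w\<close>,
  so their coefficients may be taken free of these variables.\<close>
lemma edge_ideal_complete_nbhd_inter:
  fixes f :: "('k::comm_ring_1) mpoly"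
  assumes w: "w \<in> A" "\<not> E w w" and f: "f \<in> edge_ideal (complete_nbhd E A w) A" "f \<in> edge_ideal E (A - {w})"
  shows "f \<in> edge_ideal E A"
proof -
  let ?\<rho> = "elim {Inl w, Inr w} :: 'k mpoly \<Rightarrow> 'k mpoly"
  let ?J = "edge_ideal E A :: 'k mpoly set"
  have xy: "?\<rho> (xv u) = (if u = w then 0 else xv u)" "?\<rho> (yv u) = (if u = w then 0 else yv u)" for u
    by (simp_all add: xv_def yv_def elim_Var)
  have minor: "?\<rho> (minor a b) = (minor a b :: 'k mpoly)" if "a \<noteq> w" "b \<noteq> w" for a b
    using that by (simp add: minor_def xv_def yv_def elim_diff elim_mult elim_Var)
  have "\<exists>h. p - h \<in> ?J \<and> ?\<rho> h = h" if "p \<in> edge_ideal (complete_nbhd E A w) A" for p :: "'k mpoly"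
    using that
  proof (induction p rule: idl.induct)
    case zero
    then show ?case by (auto intro!: exI[of _ 0] idl.zero)
  next
    case (step a p c)
    then obtain h where h: "p - h \<in> ?J" "?\<rho> h = h" by blast
    show ?case
    proof (cases "a \<in> gens E A")
      case True
      then have "c * a + (p - h) \<in> ?J" by (rule idl.step[OF _ h(1)])
      then show ?thesis using h(2) by (intro exI[of _ h]) (simp add: algebra_simps)
    next
      case False
      with step(1) obtain i j where ij: "a = minor i j" "i \<in> A" "j \<in> A" "E w i" "E w j"
        by (cases rule: gensE) (auto simp: complete_nbhd_def intro: gensI)
      have iw: "i \<noteq> w" "j \<noteq> w" using ij w by auto
      have "a * (c - ?\<rho> c) \<in> ?J"
      proof (rule idl_mult_subset[OF elim_decomp])
        fix v assume "v \<in> (Var ` {Inl w, Inr w} :: 'k mpoly set)"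
        then have "v = xv w \<or> v = yv w" by (auto simp: xv_def yv_def)
        then show "a * v \<in> ?J" using mult_minor_nbr[where E = E, OF w(1) ij(2-5)] ij(1) by (auto simp: mult.commute)
      qed
      from idl_add[OF this h(1)] have "c * a + p - (?\<rho> c * a + h) \<in> ?J" by (simp add: algebra_simps)
      moreover have "?\<rho> (?\<rho> c * a + h) = ?\<rho> c * a + h"
        using h(2) minor[OF iw] ij(1) by (simp add: elim_add elim_mult elim_elim)
      ultimately show ?thesis by blast
    qed
  qed
  then obtain h where h: "f - h \<in> ?J" "?\<rho> h = h" using f(1) by blast
  \<comment> \<open>As \<open>h\<close> is fixed by the substitution, it is the difference of the
    images of \<open>f\<close> and of \<open>f - h\<close>, and both images lie in the
    ideal.\<close>
  have "?\<rho> (f - h) \<in> ?J"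
    using h(1)
  proof (rule idl_elim)
    fix a :: "'k mpoly" assume "a \<in> gens E A"
    then show "?\<rho> a \<in> ?J"
    proof (cases rule: gensE)
      case (1 i j)
      show ?thesis
      proof (cases "i = w \<or> j = w")
        case True
        then have "?\<rho> a = 0" using 1 by (auto simp: minor_def xv_def yv_def elim_diff elim_mult elim_Var)
        then show ?thesis by (simp add: idl.zero)
      qed (use 1 minor in \<open>auto intro: edge_idealI\<close>)
    qed (auto simp: xy intro: edge_idealI idl.zero)
  qed
  moreover have "?\<rho> f \<in> ?J"
    using f(2)
  proof (rule idl_elim)
    fix a :: "'k mpoly" assume "a \<in> gens E (A - {w})"
    then show "?\<rho> a \<in> ?J"
    proof (cases rule: gensE)
      case (1 i j)
      then show ?thesis using minor[of i j] by (auto intro: edge_idealI)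
    qed (auto simp: xy intro: edge_idealI idl.zero)
  qed
  ultimately have "?\<rho> f - ?\<rho> (f - h) \<in> ?J" by (intro idl_diff)
  then have "h \<in> ?J" using h(2) by (simp add: elim_diff)
  then show ?thesis using h(1) idl_diff_iff by blast
qed

section \<open>Disjoint unions of cliques: monomials modulo the edge ideal\<close>

lemma keys_elim:
  assumes "m \<in> keys (elim U p)"
  shows "keys m \<inter> U = {}"
proof (rule ccontr)
  assume "keys m \<inter> U \<noteq> {}"
  then have "lookup (elim U p) m = 0" unfolding elim_def lookup_flt by (rule if_not_P)
  from lookup_eq_zero_in_keys_contradict[OF this] assms show False by contradiction
qed

text \<open>Coefficients of monomials with the same image under \<open>g\<close> are added. For
  \<open>clique_type\<close> this is the quotient map onto a ring with one basis element per
  type.\<close>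

definition push :: "('a \<Rightarrow> 'b) \<Rightarrow> ('a \<Rightarrow>\<^sub>0 'k::comm_monoid_add) \<Rightarrow> 'b \<Rightarrow>\<^sub>0 'k" where
  "push g p = (\<Sum>m\<in>keys p. single (g m) (lookup p m))"

lemma push_single [simp]: "push g (single m c) = single (g m) c"
  by (cases "c = 0") (simp_all add: push_def)

lemma push_zero [simp]: "push g 0 = 0"
  by (simp add: push_def)

lemma push_add: "push g (p + q) = push g p + push g q"
  unfolding push_def by (rule setsum_keys_plus_distrib) (simp_all add: single_add)

lemma push_push: "push g (push h p) = push (\<lambda>m. g (h m)) p"
  by (induction p rule: mpoly_induct) (simp_all add: push_add)

lemma push_id: "push (\<lambda>m. m) p = p"
  by (induction p rule: mpoly_induct) (simp_all add: push_add)

lemma push_Var_mult: "push g (Var v * p) = push (\<lambda>m. g (single v 1 + m)) p"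
  by (induction p rule: mpoly_induct) (simp_all add: push_add distrib_left Var_def mult_single)

text \<open>For a disjoint union of cliques, a monomial modulo the edge ideal is determined by
  the degrees of the pairs \<open>(x\<^sub>i, y\<^sub>i)\<close> and the \<open>x\<close>-degree on each clique.\<close>
definition clique_type :: "(nat \<Rightarrow> nat \<Rightarrow> bool) \<Rightarrow> nat set \<Rightarrow> ((nat + nat) \<Rightarrow>\<^sub>0 nat) \<Rightarrow> (nat \<Rightarrow> nat) \<times> (nat \<Rightarrow> nat)" where
  "clique_type E A m = (\<lambda>i. lookup m (Inl i) + lookup m (Inr i),
     \<lambda>i. if i \<in> A then \<Sum>j\<in>{j\<in>A. j = i \<or> E i j}. lookup m (Inl j) else 0)"

context
  fixes E :: "nat \<Rightarrow> nat \<Rightarrow> bool" and A :: "nat set"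
  assumes A: "finite A" and "symp E"
    and all_simplicial: "\<And>w. w \<in> A \<Longrightarrow> simplicial E A w"
begin

lemma sym: "E a b \<Longrightarrow> E b a"
  using \<open>symp E\<close> by (rule sympD)

text \<open>When all vertices are simplicial, being equal or adjacent is an equivalence relation on
  \<open>A\<close>, whose classes are cliques.\<close>

lemma same_clique:
  assumes "i \<in> A" "j \<in> A" "E i j" "k \<in> A"
  shows "k = i \<or> E k i \<longleftrightarrow> k = j \<or> E k j"
  using all_simplicial assms sym unfolding simplicial_def by metis

lemma clique_type_add:
  "clique_type E A (m + m') = ((\<lambda>i. fst (clique_type E A m) i + fst (clique_type E A m') i),
     (\<lambda>i. snd (clique_type E A m) i + snd (clique_type E A m') i))"
  by (auto simp: clique_type_def lookup_add fun_eq_iff sum.distrib)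

lemma clique_type_swap:
  assumes "i \<in> A" "j \<in> A" "E i j"
  shows "clique_type E A (single (Inl i) 1 + single (Inr j) 1) =
    clique_type E A (single (Inl j) 1 + single (Inr i) 1)"
proof -
  have x: "(\<Sum>l\<in>{l\<in>A. l = k \<or> E k l}. lookup (single (Inl a) (1::nat)) (Inl l :: nat + nat)) =
      (if k = a \<or> E k a then 1 else 0)" if "a \<in> A" for k a
    using A that by (auto simp: lookup_single when_def)
  have y: "lookup (single (Inr a) (1::nat)) (Inl l :: nat + nat) = 0" for a l
    by (simp add: lookup_single)
  show ?thesis
    unfolding clique_type_def prod.inject
  proof (intro conjI ext)
    fix k
    let ?s = "\<lambda>m :: (nat + nat) \<Rightarrow>\<^sub>0 nat. if k \<in> A then \<Sum>l\<in>{l\<in>A. l = k \<or> E k l}. lookup m (Inl l) else 0"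
    show "?s (single (Inl i) 1 + single (Inr j) 1) =
      ?s (single (Inl j) 1 + single (Inr i) 1)"
      unfolding lookup_add sum.distrib x[OF assms(1)] x[OF assms(2)] y
      using same_clique[OF assms, of k] by simp
  qed (auto simp: lookup_add lookup_single when_def)
qed

text \<open>If the x-degrees differ, some \<open>i\<close> has a surplus and some \<open>j\<close>
  in the same clique a deficit, because the clique totals agree; y_j occurs in \<open>m\<close>
  because the degrees of the pair at \<open>j\<close> agree. Replacing x_i y_j by x_j y_i costs a
  multiple of a minor. The measure uses truncated subtraction and so counts the surplus
  only.\<close>

lemma exchange:
  assumes "clique_type E A m = clique_type E A m'"
    "keys m \<inter> vars_off A = {}" "keys m' \<inter> vars_off A = {}"
  shows "single m c - single m' (c :: 'k::comm_ring_1) \<in> edge_ideal E A"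
  using assms
proof (induction "\<Sum>i\<in>A. lookup m (Inl i) - lookup m' (Inl i)" arbitrary: m rule: less_induct)
  case less
  let ?l = lookup
  have pair: "?l m (Inl i) + ?l m (Inr i) = ?l m' (Inl i) + ?l m' (Inr i)" for i
    using less.prems(1) by (simp add: clique_type_def fun_eq_iff)
  have cl: "(\<Sum>j\<in>{j\<in>A. j = i \<or> E i j}. ?l m (Inl j)) = (\<Sum>j\<in>{j\<in>A. j = i \<or> E i j}. ?l m' (Inl j))"
    if "i \<in> A" for i
    using less.prems(1) that unfolding clique_type_def by (auto simp: fun_eq_iff split: if_splits)
  have off: "?l m (Inl i) = 0" "?l m (Inr i) = 0" "?l m' (Inl i) = 0" "?l m' (Inr i) = 0" if "i \<notin> A" for i
    using less.prems(2,3) that by (auto simp: vars_off_def in_keys_iff)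
  show ?case
  proof (cases "\<exists>i\<in>A. ?l m (Inl i) \<noteq> ?l m' (Inl i)")
    case False
    have "m = m'"
    proof (rule poly_mapping_eqI)
      fix v
      show "?l m v = ?l m' v"
      proof (cases v)
        case (Inl i)
        then show ?thesis using False off[of i] by (cases "i \<in> A") auto
      next
        case (Inr i)
        then show ?thesis using False off[of i] pair[of i] by (cases "i \<in> A") auto
      qed
    qed
    then show ?thesis by (simp add: idl.zero)
  next
    case True
    then obtain i0 where i0: "i0 \<in> A" "?l m (Inl i0) \<noteq> ?l m' (Inl i0)" by blast
    let ?K = "{j\<in>A. j = i0 \<or> E i0 j}"
    have fK: "finite ?K" using A by simp
    have "\<exists>i\<in>?K. ?l m (Inl i) > ?l m' (Inl i)"
    proof (rule ccontr)
      assume "\<not> ?thesis"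
      then have "(\<Sum>j\<in>?K. ?l m (Inl j)) < (\<Sum>j\<in>?K. ?l m' (Inl j))"
        using i0 by (intro sum_strict_mono_ex1[OF fK]) (force simp: not_less)+
      then show False using cl[OF i0(1)] by simp
    qed
    then obtain i where i: "i \<in> ?K" "?l m (Inl i) > ?l m' (Inl i)" by blast
    have "\<exists>j\<in>?K. ?l m (Inl j) < ?l m' (Inl j)"
    proof (rule ccontr)
      assume "\<not> ?thesis"
      then have "(\<Sum>j\<in>?K. ?l m' (Inl j)) < (\<Sum>j\<in>?K. ?l m (Inl j))"
        using i by (intro sum_strict_mono_ex1[OF fK]) (force simp: not_less)+
      then show False using cl[OF i0(1)] by simp
    qed
    then obtain j where j: "j \<in> ?K" "?l m (Inl j) < ?l m' (Inl j)" by blast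
    have ij: "i \<in> A" "j \<in> A" "i \<noteq> j" using i j by auto
    then have Eij: "E i j"
      using i j i0(1) all_simplicial[OF i0(1)] sym unfolding simplicial_def by blast
    have yj: "?l m (Inr j) > 0" using pair[of j] j(2) by simp
    let ?e = "single (Inl i) 1 + single (Inr j) 1 :: (nat + nat) \<Rightarrow>\<^sub>0 nat"
    let ?e' = "single (Inl j) 1 + single (Inr i) 1 :: (nat + nat) \<Rightarrow>\<^sub>0 nat"
    define m1 where "m1 = m - ?e"
    have m: "m = m1 + ?e"
      unfolding m1_def
      by (rule poly_mapping_eqI) (use i(2) yj in \<open>auto simp: lookup_add lookup_minus lookup_single when_def\<close>)
    define m2 where "m2 = m1 + ?e'"
    have "single m c - single m2 c = single m1 c * minor i j"
      unfolding m m2_def minor_def xv_def yv_def Var_def by (simp add: mult_single right_diff_distrib)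
    then have 1: "single m c - single m2 c \<in> edge_ideal E A"
      using ij Eij by (simp add: idl_mult edge_idealI)
    have "single m2 c - single m' c \<in> edge_ideal E A"
    proof (rule less.hyps)
      show "clique_type E A m2 = clique_type E A m'"
        using less.prems(1) clique_type_swap[OF ij(1,2) Eij]
        unfolding m m2_def clique_type_add[of m1] by simp
      show "keys m2 \<inter> vars_off A = {}"
        using less.prems(2) ij unfolding m m2_def by (auto simp: keys_add_nat vars_off_def)
      have l2: "?l m2 (Inl k) = (if k = i then ?l m (Inl i) - 1 else if k = j then ?l m (Inl j) + 1 else ?l m (Inl k))" for k
        using ij unfolding m2_def m by (auto simp: lookup_add lookup_single when_def)
      show "(\<Sum>k\<in>A. ?l m2 (Inl k) - ?l m' (Inl k)) < (\<Sum>k\<in>A. ?l m (Inl k) - ?l m' (Inl k))"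
      proof (rule sum_strict_mono_ex1[OF A])
        show "\<forall>k\<in>A. ?l m2 (Inl k) - ?l m' (Inl k) \<le> ?l m (Inl k) - ?l m' (Inl k)"
          using j(2) by (auto simp: l2)
        show "\<exists>k\<in>A. ?l m2 (Inl k) - ?l m' (Inl k) < ?l m (Inl k) - ?l m' (Inl k)"
          using i(2) ij by (intro bexI[of _ i]) (auto simp: l2)
      qed
    qed (use less.prems(3) in simp)
    from idl_add[OF 1 this] show ?thesis by simp
  qed
qed

text \<open>The two terms of a minor have the same type and cancel. Conversely,
  \<open>exchange\<close> replaces each monomial by a representative \<open>h\<close> of its type,
  after which only the image under \<open>push\<close> matters.\<close>

lemma edge_ideal_iff_cliques:
  "p \<in> edge_ideal E A \<longleftrightarrow> push (clique_type E A) (elim (vars_off A) p) = (0 :: _ \<Rightarrow>\<^sub>0 'k::comm_ring_1)"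
proof
  let ?\<tau> = "clique_type E A"
  show "push ?\<tau> (elim (vars_off A) p) = 0" if "p \<in> edge_ideal E A"
    using that
  proof (induction p rule: idl.induct)
    case (step a p c)
    have "push ?\<tau> (elim (vars_off A) (c * a)) = 0"
      using step(1)
    proof (cases rule: gensE)
      case (1 i j)
      have "push ?\<tau> (q * minor i j) = 0" for q :: "'k mpoly"
      proof (induction q rule: mpoly_induct)
        case (single m c)
        have "push ?\<tau> (single m c * minor i j + single m c * (xv j * yv i)) =
            push ?\<tau> (single m c * (xv i * yv j))"
          by (simp add: minor_def algebra_simps)
        then have "push ?\<tau> (single m c * minor i j) +
            single (?\<tau> (m + (single (Inl j) 1 + single (Inr i) 1))) c =
            single (?\<tau> (m + (single (Inl i) 1 + single (Inr j) 1))) c"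
          by (simp add: push_add xv_def yv_def Var_def mult_single)
        then show ?case using clique_type_swap[OF 1(2-4)] by (simp add: clique_type_add[of m])
      qed (simp_all add: push_add distrib_right)
      then show ?thesis using 1 by (simp add: elim_mult elim_vars_off)
    qed (simp_all add: elim_mult elim_vars_off)
    then show ?case using step by (simp add: elim_add push_add)
  qed simp
next
  let ?\<tau> = "clique_type E A"
  let ?p = "elim (vars_off A) p"
  assume 0: "push ?\<tau> ?p = 0"
  define h where "h t = (SOME m. keys m \<inter> vars_off A = {} \<and> ?\<tau> m = t)" for t
  have "?p - push (\<lambda>m. h (?\<tau> m)) ?p = (\<Sum>m\<in>keys ?p. single m (lookup ?p m) -
      single (h (?\<tau> m)) (lookup ?p m))"
    unfolding push_def sum_subtractf using mpoly_sum_single[of ?p] by simp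
  also have "\<dots> \<in> edge_ideal E A"
  proof (rule idl_sum)
    fix m assume "m \<in> keys ?p"
    then have m: "keys m \<inter> vars_off A = {}" by (rule keys_elim)
    then have "\<exists>m'. keys m' \<inter> vars_off A = {} \<and> ?\<tau> m' = ?\<tau> m" by blast
    from someI_ex[OF this]
    have "keys (h (?\<tau> m)) \<inter> vars_off A = {} \<and> ?\<tau> (h (?\<tau> m)) = ?\<tau> m"
      unfolding h_def .
    then show "single m (lookup ?p m) -
      single (h (?\<tau> m)) (lookup ?p m) \<in> edge_ideal E A"
      using m by (intro exchange) auto
  qed
  also have "push (\<lambda>m. h (?\<tau> m)) ?p = 0" unfolding push_push[symmetric] 0 by simp
  finally have "?p \<in> edge_ideal E A" by simp
  then show "p \<in> edge_ideal E A" using elim_vars_off_diff idl_diff_iff by blast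
qed

text \<open>Multiplication by x_v translates all types by a fixed one. This is injective, so
  distinct types never merge and nothing new cancels.\<close>

lemma regular_cliques:
  assumes v: "v \<in> A" and f: "xv v * f \<in> edge_ideal E A"
  shows "(f :: ('k::comm_ring_1) mpoly) \<in> edge_ideal E A"
proof -
  let ?\<tau> = "clique_type E A"
  let ?f = "elim (vars_off A) f"
  define \<sigma> where "\<sigma> t = ((\<lambda>i. fst (?\<tau> (single (Inl v) 1)) i + fst t i),
     (\<lambda>i. snd (?\<tau> (single (Inl v) 1)) i + snd t i))" for t
  have "inj \<sigma>" by (rule injI) (auto simp: \<sigma>_def fun_eq_iff prod_eq_iff)
  have "0 = push ?\<tau> (xv v * ?f)"
    using f v unfolding edge_ideal_iff_cliques by (simp add: elim_mult elim_vars_off)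
  also have "\<dots> = push (\<lambda>m. \<sigma> (?\<tau> m)) ?f"
    unfolding xv_def push_Var_mult clique_type_add \<sigma>_def ..
  also have "\<dots> = push \<sigma> (push ?\<tau> ?f)" by (simp add: push_push)
  finally have "push (inv \<sigma>) (push \<sigma> (push ?\<tau> ?f)) = 0" by simp
  then have "push ?\<tau> ?f = 0" using \<open>inj \<sigma>\<close> by (simp add: push_push push_id)
  then show ?thesis unfolding edge_ideal_iff_cliques .
qed

end

section \<open>Regularity of x_v for a simplicial vertex v\<close>

lemma simplicial_mono: "simplicial E A u \<Longrightarrow> B \<subseteq> A \<Longrightarrow> simplicial E B u"
  unfolding simplicial_def by blast

lemma simplicial_complete_nbhd:
  assumes "symp E" "w \<in> A" "\<not> E w w"
  shows "simplicial (complete_nbhd E A w) A w"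
    and "u \<in> A \<Longrightarrow> simplicial E A u \<Longrightarrow> simplicial (complete_nbhd E A w) A u"
proof -
  have sym: "E a b \<Longrightarrow> E b a" for a b using assms(1) by (rule sympD)
  show "simplicial (complete_nbhd E A w) A w"
    unfolding simplicial_def complete_nbhd_def using assms(2,3) by blast
  assume u: "u \<in> A" "simplicial E A u"
  show "simplicial (complete_nbhd E A w) A u"
    unfolding simplicial_def
  proof (intro ballI impI)
    fix a b assume ab: "a \<in> A" "b \<in> A" "complete_nbhd E A w u a" "complete_nbhd E A w u b" "a \<noteq> b"
    \<comment> \<open>An old edge from \<open>u\<close> to \<open>a\<close> and a new one to
      \<open>b\<close>: then \<open>u\<close> also sees \<open>w\<close>, so \<open>a\<close> is
      \<open>w\<close> or adjacent to \<open>w\<close>, and completion joins it to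
      \<open>b\<close>.\<close>
    have mixed: "complete_nbhd E A w a b" if "a \<in> A" "b \<in> A" "E u a" "E w u" "E w b" "a \<noteq> b" for a b
    proof (cases "a = w")
      case False
      then have "E w a" using u(2) that assms(2) sym unfolding simplicial_def by blast
      then show ?thesis using that unfolding complete_nbhd_def by blast
    qed (use that in \<open>simp add: complete_nbhd_def\<close>)
    have s: "complete_nbhd E A w b a \<Longrightarrow> complete_nbhd E A w a b"
      using sym unfolding complete_nbhd_def by blast
    show "complete_nbhd E A w a b"
      using ab u(2) mixed[of a b] mixed[of b a] s unfolding simplicial_def complete_nbhd_def by metis
  qed
qed

text \<open>A vertex \<open>w\<close> that is not simplicial exhibits the edge ideal as the
  intersection of two others: one for the completed neighbourhood of \<open>w\<close>, one for
  \<open>w\<close> deleted. Both graphs have fewer non-simplicial vertices and keep \<open>v\<close>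
  simplicial, so the claim descends to disjoint unions of cliques.\<close>

theorem regular_simplicial:
  assumes "finite A" "symp E" "\<And>a. \<not> E a a" "v \<in> A" "simplicial E A v"
    "xv v * f \<in> edge_ideal E A"
  shows "(f :: ('k::comm_ring_1) mpoly) \<in> edge_ideal E A"
  using assms
proof (induction "card {w\<in>A. \<not> simplicial E A w}" arbitrary: E A rule: less_induct)
  case less
  show ?case
  proof (cases "\<exists>w\<in>A. \<not> simplicial E A w")
    case False
    then show ?thesis using regular_cliques[OF less.prems(1,2) _ less.prems(4,6)] by blast
  next
    case True
    then obtain w where w: "w \<in> A" "\<not> simplicial E A w" by blast
    have wv: "w \<noteq> v" using w less.prems(5) by auto
    let ?E = "complete_nbhd E A w"
    note sc = simplicial_complete_nbhd[OF less.prems(2) w(1) less.prems(3)]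
    have fin: "finite {w\<in>A. \<not> simplicial E A w}" using less.prems(1) by simp
    have "f \<in> edge_ideal ?E A"
    proof (rule less.hyps)
      show "card {u\<in>A. \<not> simplicial ?E A u} < card {u\<in>A. \<not> simplicial E A u}"
        by (rule psubset_card_mono[OF fin]) (use sc w in blast)
      show "simplicial ?E A v" using sc(2) less.prems(4,5) by blast
      show "symp ?E" using sympD[OF less.prems(2)] by (auto intro!: sympI simp: complete_nbhd_def)
      show "\<not> ?E a a" for a using less.prems(3) unfolding complete_nbhd_def by blast
      have "gens E A \<subseteq> gens ?E A" unfolding gens_def complete_nbhd_def by blast
      then show "xv v * f \<in> edge_ideal ?E A" using less.prems(6) idl_mono by blast
    qed (use less.prems in auto)
    moreover have "f \<in> edge_ideal E (A - {w})"
    proof (rule less.hyps)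
      have "{u\<in>A - {w}. \<not> simplicial E (A - {w}) u} \<subseteq> {u\<in>A. \<not> simplicial E A u} - {w}"
        using simplicial_mono[of E A _ "A - {w}"] by blast
      then show "card {u\<in>A - {w}. \<not> simplicial E (A - {w}) u} < card {u\<in>A. \<not> simplicial E A u}"
        by (intro psubset_card_mono[OF fin]) (use w in blast)
      show "xv v * f \<in> edge_ideal E (A - {w})"
        using less.prems(6) edge_ideal_antimono[of "A - {w}" A E] by blast
    qed (use less.prems wv simplicial_mono[of E A v "A - {w}"] in auto)
    ultimately show ?thesis
      by (rule edge_ideal_complete_nbhd_inter[OF w(1) less.prems(3)])
  qed
qed

section \<open>Free modules, finite generation, and the colon ideal at v\<close>

context graded
begin

lemma pres_free: "hideal I \<Longrightarrow> pres I b {u. \<forall>i<b. u i \<in> I} 0 A \<and> kern I b 0 A = UNIV"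
  by (auto simp: pres_def kern_def intro: hidealD(1))

lemma lin_free:
  assumes "hideal I"
  shows "lin I b {u. \<forall>i<b. u i \<in> I}"
proof -
  have "lin I c N" if "N = {u. \<forall>i<c. u i \<in> I}" for c N
    using that
  proof (coinduction arbitrary: c N)
    case (lin c N)
    have "kern I c 0 (\<lambda>_ _. 0) = {u. \<forall>i<0. u i \<in> I}" using pres_free[OF assms, of c] by simp
    then show ?case using pres_free[OF assms, of c "\<lambda>_ _. 0"] lin by blast
  qed
  then show ?thesis by blast
qed

end

text \<open>All variables other than the finitely many of \<open>A\<close> lie in the ideal.\<close>

lemma fin_gen1_edge_ideal:
  assumes "finite A"
  shows "gr.fin_gen1 (edge_ideal E A :: ('k::field) mpoly set)"
proof -
  let ?I = "edge_ideal E A :: 'k mpoly set"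
  obtain vs where vs: "set vs = Inl ` A \<union> Inr ` A"
    using finite_list[of "Inl ` A \<union> Inr ` A :: (nat + nat) set"] assms by auto
  define q where "q = length vs"
  define t :: "nat \<Rightarrow> 'k mpoly" where "t j = Var (vs ! j)" for j
  define Z where "Z p \<longleftrightarrow> (\<exists>w. gr.const_vec w \<and> p - mapp (\<lambda>_. t) q w 0 \<in> ?I)" for p
  have Z_add: "Z (p + p')" if "Z p" "Z p'" for p p'
  proof -
    obtain w w' where w: "gr.const_vec w" "p - mapp (\<lambda>_. t) q w 0 \<in> ?I"
      "gr.const_vec w'" "p' - mapp (\<lambda>_. t) q w' 0 \<in> ?I"
      using \<open>Z p\<close> \<open>Z p'\<close> unfolding Z_def by blast
    have eq: "p + p' - mapp (\<lambda>_. t) q (\<lambda>j. w j + w' j) 0 =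
      (p - mapp (\<lambda>_. t) q w 0) + (p' - mapp (\<lambda>_. t) q w' 0)" by (simp add: mapp_add)
    have "p + p' - mapp (\<lambda>_. t) q (\<lambda>j. w j + w' j) 0 \<in> ?I"
      unfolding eq by (rule idl_add[OF w(2,4)])
    then show ?thesis unfolding Z_def
      using w by (intro exI[of _ "\<lambda>j. w j + w' j"]) (simp add: gr.hc_add)
  qed
  have Z_sum: "Z (sum g X)" if "\<And>x. x \<in> X \<Longrightarrow> Z (g x)" for g :: "_ \<Rightarrow> 'k mpoly" and X :: "((nat + nat) \<Rightarrow>\<^sub>0 nat) set"
    using that
  proof (induction X rule: infinite_finite_induct)
    case (insert x X)
    then show ?case by (simp add: Z_add)
  qed (auto simp: Z_def intro!: exI[of _ "\<lambda>_. 0"] idl.zero)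
  have Z_mon: "Z (single m c)" if "mdeg m = 1" for m c
  proof -
    from mdeg_eq_1[OF that] obtain v where v: "m = single v 1" by blast
    have eq: "single m c = single 0 c * Var v"
      by (simp add: v Var_def mult_single)
    show ?thesis
    proof (cases "v \<in> set vs")
      case True
      then obtain j where j: "j < q" "v = vs ! j" by (auto simp: in_set_conv_nth q_def)
      have "mapp (\<lambda>_. t) q (\<lambda>i. if i = j then single 0 c else 0) 0 = single m c"
        unfolding mapp_unit[OF j(1)] eq t_def j(2) ..
      then show ?thesis unfolding Z_def
        by (intro exI[of _ "\<lambda>i. if i = j then single 0 c else 0"])
          (simp add: homc_def flt_single idl.zero)
    next
      case False
      then have "Var v \<in> ?I"
        using vs by (cases v) (auto simp flip: xv_def yv_def intro!: edge_idealI)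
      then have "single m c \<in> ?I" unfolding eq by (rule idl_mult)
      then show ?thesis unfolding Z_def by (intro exI[of _ "\<lambda>_. 0"]) simp
    qed
  qed
  have "Z p" if "homc 1 p = p" for p
  proof -
    have "\<forall>m\<in>keys p. mdeg m = 1" using that unfolding homc_def flt_eq_self_iff .
    then show ?thesis by (subst mpoly_sum_single) (intro Z_sum Z_mon, blast)
  qed
  then show ?thesis unfolding gr.fin_gen1_def Z_def by blast
qed

lemma edge_ideal_delete_iff:
  assumes "v \<in> A"
  shows "p \<in> edge_ideal E (A - {v}) \<longleftrightarrow> (\<exists>q1 q2. p - xv v * q1 - yv v * q2 \<in> edge_ideal E A)"
proof
  assume p: "p \<in> edge_ideal E (A - {v})"
  let ?a = "\<lambda>j::nat. if j = 0 then xv v else yv v"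
  have "?a ` {..<2} = {xv v, yv v}" by (auto simp: numeral_2_eq_2 lessThan_Suc)
  then have "gens E (A - {v}) \<subseteq> gens E A \<union> ?a ` {..<2}"
    unfolding gens_def by auto
  then have "p \<in> idl (gens E A \<union> ?a ` {..<2})" using p idl_mono by blast
  then obtain w where "p - mapp (\<lambda>_. ?a) 2 w 0 \<in> edge_ideal E A" unfolding idl_row_iff by blast
  then have "p - xv v * w 0 - yv v * w 1 \<in> edge_ideal E A"
    by (simp add: mapp_def numeral_2_eq_2 diff_diff_eq)
  then show "\<exists>q1 q2. p - xv v * q1 - yv v * q2 \<in> edge_ideal E A" by blast
next
  assume "\<exists>q1 q2. p - xv v * q1 - yv v * q2 \<in> edge_ideal E A"
  then obtain q1 q2 where q: "p - xv v * q1 - yv v * q2 \<in> edge_ideal E A" by blast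
  have "xv v * q1 \<in> edge_ideal E (A - {v})" "yv v * q2 \<in> edge_ideal E (A - {v})"
    using idl_mult[OF edge_idealI(2), of v "A - {v}" q1] idl_mult[OF edge_idealI(3), of v "A - {v}" q2]
    by (simp_all add: mult.commute)
  moreover have "p - xv v * q1 - yv v * q2 \<in> edge_ideal E (A - {v})"
    using q edge_ideal_antimono[of "A - {v}" A E] by blast
  ultimately have "(p - xv v * q1 - yv v * q2) + (xv v * q1 + yv v * q2) \<in> edge_ideal E (A - {v})"
    by (intro idl_add)
  then show "p \<in> edge_ideal E (A - {v})" by (simp add: algebra_simps)
qed

definition nbhd_ideal :: "(nat \<Rightarrow> nat \<Rightarrow> bool) \<Rightarrow> nat set \<Rightarrow> nat \<Rightarrow> ('k::comm_ring_1) mpoly set" where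
  "nbhd_ideal E A v = idl (gens E A \<union> xv ` {u\<in>A. u = v \<or> E v u})"

text \<open>This computes the colon ideal (x_v) : y_v modulo the edge ideal. Neighbours
  \<open>u\<close> enter through y_v x_u = y_u x_v - \<open>minor v u\<close>.\<close>

lemma nbhd_ideal_iff:
  fixes q :: "('k::comm_ring_1) mpoly"
  assumes "symp E" "\<And>a. \<not> E a a" "v \<in> A"
  shows "q \<in> nbhd_ideal E A v \<longleftrightarrow> (\<exists>p. xv v * p + yv v * q \<in> edge_ideal E A)"
proof
  let ?K = "{u\<in>A. u = v \<or> E v u}"
  assume q: "q \<in> nbhd_ideal E A v"
  have "yv v * q \<in> idl (gens E A \<union> (\<lambda>_::nat. xv v) ` {..<1})"
    using q unfolding nbhd_ideal_def
  proof (rule idl_mult_subset)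
    fix a :: "'k mpoly" assume "a \<in> gens E A \<union> xv ` ?K"
    then consider "a \<in> gens E A" | "a = xv v" | u where "u \<in> A" "E v u" "a = xv u" by blast
    then show "yv v * a \<in> idl (gens E A \<union> (\<lambda>_::nat. xv v) ` {..<1})"
    proof cases
      case 3
      have eq: "yv v * a = yv u * xv v - minor v u" unfolding 3 minor_def by (simp add: algebra_simps)
      have "minor v u \<in> gens E A" using 3 assms(3) by (intro gensI)
      then show ?thesis unfolding eq by (intro idl_diff[OF idl_mult[OF idl_gen] idl_gen]) auto
    qed (rule idl_mult[OF idl_gen]; simp)+
  qed
  then obtain w where "yv v * q - mapp (\<lambda>_ _. xv v) 1 w 0 \<in> edge_ideal E A" unfolding idl_row_iff by blast
  then have "xv v * - w 0 + yv v * q \<in> edge_ideal E A" by (simp add: mapp_def)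
  then show "\<exists>p. xv v * p + yv v * q \<in> edge_ideal E A" by blast
next
  let ?K = "{u\<in>A. u = v \<or> E v u}"
  assume "\<exists>p. xv v * p + yv v * q \<in> edge_ideal E A"
  then obtain p where p: "xv v * p + yv v * q \<in> edge_ideal E A" by blast
  \<comment> \<open>generators of \<open>nbhd_ideal E A v\<close> free of \<open>y\<^sub>v\<close>, which makes \<open>y\<^sub>v\<close> regular\<close>
  define S :: "'k mpoly set" where
    "S = {minor i j | i j. i \<in> A - {v} \<and> j \<in> A - {v} \<and> E i j} \<union> xv ` (- A) \<union> yv ` (- A) \<union> xv ` ?K"
  have SK: "xv u \<in> idl S" if "u \<in> ?K" for u using that unfolding S_def by (intro idl_gen) blast
  have sub: "edge_ideal E A \<subseteq> idl S"
  proof (rule idl_subset)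
    fix a :: "'k mpoly" assume "a \<in> gens E A"
    then show "a \<in> idl S"
    proof (cases rule: gensE)
      case (1 i j)
      show ?thesis
      proof (cases "i = v \<or> j = v")
        case True
        then have "i \<in> ?K" "j \<in> ?K" using 1 sympD[OF assms(1)] by auto
        then have "yv j * xv i - yv i * xv j \<in> idl S" by (intro idl_diff idl_mult SK)
        then show ?thesis unfolding 1 minor_def by (simp add: mult.commute)
      next
        case False
        then show ?thesis using 1 unfolding S_def by (intro idl_gen) blast
      qed
    qed (auto simp: S_def intro!: idl_gen)
  qed
  have "p * xv v \<in> idl S" using assms(3) by (intro idl_mult SK) simp
  then have "(xv v * p + yv v * q) - p * xv v \<in> idl S" using p sub by (intro idl_diff) auto
  then have "Var (Inr v) * q \<in> idl S" by (simp add: yv_def algebra_simps)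
  then have "q \<in> idl S"
  proof (rule idl_free_variable[rotated])
    fix a assume "a \<in> S"
    then show "elim {Inr v} a = a"
      using assms(3) by (auto simp: S_def minor_def elim_diff elim_mult xv_def yv_def elim_Var)
  qed
  moreover have "S \<subseteq> gens E A \<union> xv ` ?K" unfolding S_def gens_def by blast
  ultimately show "q \<in> nbhd_ideal E A v" unfolding nbhd_ideal_def using idl_mono by blast
qed

section \<open>Linear resolution of the residue field\<close>

context strongly_chordal_claw_free
begin

lemma symp_E: "symp E" using sym by (rule sympI)

text \<open>The closed neighbourhood is a clique, so the minor of \<open>s j\<close> and
  \<open>s i\<close> trades x at \<open>s j\<close> times y at \<open>s i\<close> for a multiple of
  x at \<open>s i\<close>; this puts the y-variables of earlier vertices into the colon ideal.
  Nothing more enters, because \<open>s j\<close> is simplicial in the remaining graph and its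
  x-variable is regular there.\<close>

lemma colon_elimination_order:
  fixes p :: "('k::comm_ring_1) mpoly"
  assumes A: "finite A" and s: "inj_on s {..<m}" "s 0 \<in> A" "s ` {..<m} = {u\<in>A. u = s 0 \<or> E (s 0) u}"
    and simp: "\<And>j. j < m \<Longrightarrow> simplicial E (A - s ` {..<j}) (s j)" and j: "j < m"
  shows "(\<exists>w. mapp (\<lambda>_ i. xv (s i)) j w 0 + xv (s j) * p \<in> edge_ideal E A) \<longleftrightarrow>
    p \<in> edge_ideal E (A - s ` {..<j})"
proof -
  let ?B = "A - s ` {..<j}"
  have adj: "E (s i) (s k)" if "i < m" "k < m" "i \<noteq> k" for i k
  proof -
    have ne: "s i \<noteq> s k" using inj_onD[OF s(1)] that by blast
    have i: "s i \<in> A" "s i = s 0 \<or> E (s 0) (s i)" and k: "s k \<in> A" "s k = s 0 \<or> E (s 0) (s k)"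
      using s(3) that by blast+
    have simp0: "simplicial E A (s 0)" using simp[of 0] j by simp
    from i(2) k(2) ne consider "s i = s 0" "E (s 0) (s k)" | "s k = s 0" "E (s 0) (s i)"
      | "E (s 0) (s i)" "E (s 0) (s k)" by argo
    then show ?thesis
    proof cases
      case 2
      then show ?thesis using sym[of "s 0" "s i"] by simp
    next
      case 3
      then show ?thesis using simp0 i(1) k(1) ne unfolding simplicial_def by blast
    qed simp
  qed
  have sA: "s i \<in> A" if "i < m" for i using s(3) that by blast
  have "(\<exists>w. mapp (\<lambda>_ i. xv (s i)) j w 0 + xv (s j) * p \<in> edge_ideal E A) \<longleftrightarrow>
      (\<exists>w. xv (s j) * p - mapp (\<lambda>_ i. xv (s i)) j w 0 \<in> edge_ideal E A)"
  proof -
    have eq: "mapp (\<lambda>_ i. xv (s i)) j (\<lambda>i. - 1 * w i) 0 = - 1 * mapp (\<lambda>_ i. xv (s i)) j w 0"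
      for w :: "nat \<Rightarrow> 'k mpoly" by (rule mapp_scale)
    show ?thesis
    proof safe
      fix w assume w: "mapp (\<lambda>_ i. xv (s i)) j w 0 + xv (s j) * p \<in> edge_ideal E A"
      have "xv (s j) * p - mapp (\<lambda>_ i. xv (s i)) j (\<lambda>i. - 1 * w i) 0 \<in> edge_ideal E A"
        unfolding eq using w by (simp add: add.commute)
      then show "\<exists>w. xv (s j) * p - mapp (\<lambda>_ i. xv (s i)) j w 0 \<in> edge_ideal E A" by blast
    next
      fix w assume w: "xv (s j) * p - mapp (\<lambda>_ i. xv (s i)) j w 0 \<in> edge_ideal E A"
      have "mapp (\<lambda>_ i. xv (s i)) j (\<lambda>i. - 1 * w i) 0 + xv (s j) * p \<in> edge_ideal E A"
        unfolding eq using w by simp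
      then show "\<exists>w. mapp (\<lambda>_ i. xv (s i)) j w 0 + xv (s j) * p \<in> edge_ideal E A" by blast
    qed
  qed
  also have "\<dots> \<longleftrightarrow> xv (s j) * p \<in> idl (gens E A \<union> (\<lambda>i. xv (s i)) ` {..<j})"
    by (simp only: idl_row_iff)
  also have "\<dots> \<longleftrightarrow> p \<in> edge_ideal E ?B"
  proof
    assume p: "xv (s j) * p \<in> idl (gens E A \<union> (\<lambda>i. xv (s i)) ` {..<j})"
    have "(idl (gens E A \<union> (\<lambda>i. xv (s i)) ` {..<j}) :: 'k mpoly set) \<subseteq> edge_ideal E ?B"
    proof (rule idl_subset)
      fix a :: "'k mpoly" assume "a \<in> gens E A \<union> (\<lambda>i. xv (s i)) ` {..<j}"
      then show "a \<in> edge_ideal E ?B"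
        using edge_ideal_antimono[of ?B A E] idl_gen[of a "gens E A"] by (auto intro: edge_idealI)
    qed
    then have "xv (s j) * p \<in> edge_ideal E ?B" using p by blast
    moreover have "s j \<in> ?B" using sA[OF j] inj_onD[OF s(1)] j by force
    ultimately show "p \<in> edge_ideal E ?B"
      using regular_simplicial[OF _ symp_E irrefl _ simp[OF j]] A by blast
  next
    assume "p \<in> edge_ideal E ?B"
    then show "xv (s j) * p \<in> idl (gens E A \<union> (\<lambda>i. xv (s i)) ` {..<j})"
    proof (rule idl_mult_subset)
      fix a :: "'k mpoly" assume "a \<in> gens E ?B"
      then show "xv (s j) * a \<in> idl (gens E A \<union> (\<lambda>i. xv (s i)) ` {..<j})" (is "_ \<in> ?L")
      proof (cases rule: gensE)
        case (1 i k)
        then show ?thesis by (intro idl_mult[OF idl_gen]) (auto intro: gensI)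
      next
        case (2 w)
        then show ?thesis by (intro idl_mult[OF idl_gen]) (auto intro: gensI)
      next
        case (3 w)
        show ?thesis
        proof (cases "w \<in> A")
          case False
          then show ?thesis using 3 by (intro idl_mult[OF idl_gen]) (auto intro: gensI)
        next
          case True
          then obtain i where i: "i < j" "w = s i" using 3 by blast
          have "xv (s j) * a = minor (s j) (s i) + yv (s j) * xv (s i)"
            unfolding 3 i minor_def by (simp add: algebra_simps)
          also have "minor (s j) (s i) \<in> ?L"
            using adj[of j i] i j sA by (intro idl_gen) (auto intro: gensI)
          then have "minor (s j) (s i) + yv (s j) * xv (s i) \<in> ?L"
            by (rule idl_add[OF _ idl_mult[OF idl_gen]]) (use i in auto)
          finally show ?thesis .
        qed
      qed
    qed
  qed
  finally show ?thesis .
qed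

lemma lin_edge_ideal:
  assumes "finite A"
  shows "gr.lin (edge_ideal E A :: ('k::field) mpoly set) 1 gr.irrelevant_ideal"
  using assms
proof (induction "card A" arbitrary: A rule: less_induct)
  case less
  let ?J = "\<lambda>A. edge_ideal E A :: 'k mpoly set"
  show ?case
  proof (cases "A = {}")
    case True
    \<comment> \<open>Without vertices all variables are in the ideal, so the residue field is the
      ring itself, free of rank 1.\<close>
    have "p \<in> ?J {} \<longleftrightarrow> homc 0 p = 0" for p
    proof
      show "homc 0 p = 0" if "p \<in> ?J {}"
        using that
      proof (induction p rule: idl.induct)
        case (step a p c)
        have "homc 1 a = a" using step(1) by (cases rule: gensE) (auto simp: xv_def yv_def homc_Var[simplified])
        then have "homc 0 (a * c) = 0" by (simp add: gr.hc_mult[of 1])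
        then show ?case using step by (simp add: gr.hc_add mult.commute)
      qed simp
      have "vars_off {} = UNIV" unfolding vars_off_def by (metis Compl_empty_eq UNIV_sum)
      then have "elim (vars_off {}) p = homc 0 p"
        by (simp add: elim_def homc_def mdeg_eq_0_iff)
      then show "p \<in> ?J {}" if "homc 0 p = 0"
        using elim_vars_off_diff[of p "{}" E] that by simp
    qed
    then have irr: "gr.irrelevant_ideal = {u. \<forall>i<1. u i \<in> ?J {}}" by auto
    show ?thesis unfolding True irr by (rule gr.lin_free[OF hideal_edge_ideal])
  next
    case False
    obtain s :: "nat \<Rightarrow> nat" and m where s: "0 < m" "s 0 \<in> A" "inj_on s {..<m}"
      "s ` {..<m} = {u\<in>A. u = s 0 \<or> E (s 0) u}"
      "\<And>j. j < m \<Longrightarrow> simplicial E (A - s ` {..<j}) (s j)"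
      by (rule simple_elimination_order[OF less.prems False]) (rule that)
    let ?v = "s 0"
    let ?I = "?J A" and ?I' = "?J (A - {?v})" and ?Q = "nbhd_ideal E A ?v :: 'k mpoly set"
    have hom: "homc 1 (xv i :: 'k mpoly) = xv i" "homc 1 (yv i :: 'k mpoly) = yv i" for i
      unfolding xv_def yv_def by (rule homc_Var)+
    have hQ: "gr.hideal ?Q"
      unfolding nbhd_ideal_def
    proof (rule hideal_idl)
      fix a :: "'k mpoly" assume "a \<in> gens E A \<union> xv ` {u\<in>A. u = ?v \<or> E ?v u}"
      then show "\<exists>e. homc e a = a"
        by (auto elim!: gensE intro: homc_minor hom)
    qed
    have hI: "gr.hideal ?I" and hI': "gr.hideal ?I'" by (rule hideal_edge_ideal)+
    have IQ: "?I \<subseteq> ?Q" unfolding nbhd_ideal_def by (intro idl_mono) blast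
    \<comment> \<open>The zero module, R, R/Q and the modules with a linear resolution over R'; the
      zero module occurs as the syzygy module of a free module.\<close>
    define X where "X b N \<longleftrightarrow> b = 0 \<and> N = UNIV \<or> b = 1 \<and> N = {u. u 0 \<in> ?I} \<or>
      b = 1 \<and> N = {u. u 0 \<in> ?Q} \<or> gr.lin ?I' b N" for b N
    have IH: "gr.lin (?J B) 1 gr.irrelevant_ideal" if "B \<subseteq> A - {?v}" for B
    proof (rule less.hyps)
      show "card B < card A" using that s(2) less.prems by (intro psubset_card_mono) auto
      show "finite B" using that less.prems finite_subset by blast
    qed
    have retract: "gr.lin ?I' 1 {u. u 0 \<in> ?J B}" if B: "B \<subseteq> A - {?v}" for B
    proof (rule gr.lin_retract[where \<rho> = "elim (vars_off B)"])
      show "gr.fin_gen1 ?I'" using fin_gen1_edge_ideal less.prems by blast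
      show "?I' \<subseteq> ?J B" by (rule edge_ideal_antimono[OF B])
      show "elim (vars_off B) p \<in> ?I'" if "p \<in> ?J B" for p by (rule elim_edge_ideal[OF B that])
    qed (use B IH in \<open>simp_all only: hideal_edge_ideal elim_vars_off_diff elim_add elim_mult elim_homc subset_refl\<close>)
    have X0: "gr.exts ?I X 0 UNIV" and XI: "gr.exts ?I X 1 {u. u 0 \<in> ?I}"
      and XQ: "gr.exts ?I X 1 {u. u 0 \<in> ?Q}"
      and Xlin: "\<And>b N. gr.lin ?I' b N \<Longrightarrow> X b N"
      unfolding X_def by (rule gr.exts.base; simp)+ simp
    have regular: "xv ?v * p \<in> ?I \<longleftrightarrow> p \<in> ?I" for p
      using regular_simplicial[OF less.prems symp_E irrefl s(2)] s(5)[OF s(1)] idl_mult by auto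
    have row: "gr.exts ?I X m (gr.kern ?I 1 m (\<lambda>_ j. xv (s j)))"
    proof (rule gr.exts_row[OF hI X0])
      fix j assume j: "j < m"
      have "{u :: nat \<Rightarrow> 'k mpoly. \<exists>v. mapp (\<lambda>_ i. xv (s i)) j v 0 + xv (s j) * u 0 \<in> ?I} = {u. u 0 \<in> ?J (A - s ` {..<j})}"
        using colon_elimination_order[OF less.prems s(3,2,4,5) j] by blast
      moreover have "gr.exts ?I X 1 {u. u 0 \<in> ?J (A - s ` {..<j})}"
      \<comment> \<open>For \<open>j = 0\<close> nothing is deleted and the quotient is R itself;
        for larger \<open>j\<close> the vertex \<open>s 0\<close> is gone, so the quotient is a
        retract of R'.\<close>
      proof (cases "j = 0")
        case False
        then have "gr.lin ?I' 1 {u. u 0 \<in> ?J (A - s ` {..<j})}" by (intro retract) auto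
        then show ?thesis by (intro gr.exts.base Xlin)
      qed (use XI in simp)
      ultimately show "gr.exts ?I X 1 {u. \<exists>v. mapp (\<lambda>_ i. xv (s i)) j v 0 + xv (s j) * u 0 \<in> ?I}"
        by simp
    qed (rule hom)
    have syzygies: "\<exists>c M. gr.pres ?I b N c M \<and> gr.exts ?I X c (gr.kern ?I b c M)" if X: "X b N" for b N
    proof -
      consider "b = 0" "N = UNIV" | "b = 1" "N = {u. u 0 \<in> ?I}" | "b = 1" "N = {u. u 0 \<in> ?Q}"
        | "gr.lin ?I' b N" using X unfolding X_def by blast
      then show ?thesis
      proof cases
        case 1
        then show ?thesis using gr.pres_free[OF hI, of 0 "\<lambda>_ _. 0"] X0
          by (intro exI[of _ 0] exI[of _ "\<lambda>_ _. 0"]) simp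
      next
        case 2
        then show ?thesis using gr.pres_free[OF hI, of 1 "\<lambda>_ _. 0"] X0
          by (intro exI[of _ 0] exI[of _ "\<lambda>_ _. 0"]) simp
      next
        case 3
        have "gr.pres ?I 1 {u. u 0 \<in> ?Q} m (\<lambda>_ j. xv (s j))"
          unfolding gr.pres_def
        proof (intro conjI allI)
          fix u :: "nat \<Rightarrow> 'k mpoly"
          have eq: "(gens E A :: 'k mpoly set) \<union> xv ` {u\<in>A. u = ?v \<or> E ?v u} = gens E A \<union> (\<lambda>j. xv (s j)) ` {..<m}"
            unfolding s(4)[symmetric] by (simp add: image_image)
          show "u \<in> {u. u 0 \<in> ?Q} \<longleftrightarrow> (\<exists>w. \<forall>r<1. u r - mapp (\<lambda>_ j. xv (s j)) m w r \<in> ?I)"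
            unfolding nbhd_ideal_def eq by (simp add: idl_row_iff)
        qed (use hom in simp)
        then show ?thesis using row 3 by blast
      next
        case 4
        then obtain c M where M: "gr.pres ?I' b N c M" "gr.lin ?I' c (gr.kern ?I' b c M)"
          by (cases rule: gr.lin.cases) blast
        show ?thesis
          by (rule gr.pres_change_ring[OF hI hI' hQ IQ hom(1)[of ?v] hom(2)[of ?v] edge_ideal_delete_iff[OF s(2)] regular
                nbhd_ideal_iff[OF symp_E irrefl s(2)] X0 XI XQ Xlin[OF M(2)] M(1)])
      qed
    qed
    show ?thesis
    proof (rule gr.exts_lin[OF hI])
      show "gr.exts ?I X 1 gr.irrelevant_ideal" by (intro gr.exts.base Xlin IH subset_refl)
    qed (rule syzygies)
  qed
qed

end

section \<open>Return to the polynomial ring in finitely many variables\<close>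

lemma in_ring_iff: "in_ring V p \<longleftrightarrow> elim (- V) p = p"
  unfolding in_ring_def elim_def flt_eq_self_iff by blast

lemma mat_app_eq_mapp: "mat_app A c v r = mapp A c v r"
  by (simp add: mat_app_def mapp_def)

lemma elim_mapp:
  "elim U (mapp A c v r) = mapp (\<lambda>r j. elim U (A r j)) c (\<lambda>j. elim U (v j)) r"
  unfolding mapp_def elim_def flt_sum by (simp add: elim_mult[unfolded elim_def])

lemma ideal_gen_zero: "0 \<in> ideal_gen V A"
  unfolding ideal_gen_def by (auto intro!: exI[of _ "{}"])

lemma ideal_gen_add:
  assumes "p \<in> ideal_gen V A" "q \<in> ideal_gen V A"
  shows "p + q \<in> ideal_gen V A"
proof -
  obtain F c where F: "finite F" "F \<subseteq> A" "\<forall>g\<in>F. in_ring V (c g)" "p = (\<Sum>g\<in>F. c g * g)"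
    using assms(1) unfolding ideal_gen_def by blast
  obtain F' c' where F': "finite F'" "F' \<subseteq> A" "\<forall>g\<in>F'. in_ring V (c' g)" "q = (\<Sum>g\<in>F'. c' g * g)"
    using assms(2) unfolding ideal_gen_def by blast
  define d where "d g = (if g \<in> F then c g else 0) + (if g \<in> F' then c' g else 0)" for g
  have "in_ring V (d g)" for g
    using F(3) F'(3) by (simp add: d_def in_ring_iff elim_add)
  moreover have "p + q = (\<Sum>g\<in>F \<union> F'. d g * g)"
  proof -
    have "p = (\<Sum>g\<in>F \<union> F'. (if g \<in> F then c g else 0) * g)"
      unfolding F(4) using F(1) F'(1) by (intro sum.mono_neutral_cong_left) auto
    moreover have "q = (\<Sum>g\<in>F \<union> F'. (if g \<in> F' then c' g else 0) * g)"
      unfolding F'(4) using F(1) F'(1) by (intro sum.mono_neutral_cong_left) auto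
    ultimately show ?thesis by (simp add: d_def distrib_right sum.distrib)
  qed
  ultimately show ?thesis
    unfolding ideal_gen_def using F(1,2) F'(1,2) by (intro CollectI exI[of _ "F \<union> F'"] exI[of _ d]) auto
qed

lemma ideal_gen_gen:
  assumes "in_ring V c" "a \<in> A"
  shows "c * a \<in> ideal_gen V A"
  unfolding ideal_gen_def
  by (intro CollectI exI[of _ "{a}"] exI[of _ "\<lambda>_. c"]) (use assms in auto)

text \<open>Substituting 0 for the variables outside \<open>vars_S n\<close> fixes \<open>p\<close>,
  kills the extra generators and moves all coefficients into the finite ring. A minor with its
  indices in decreasing order is replaced by its negative.\<close>

lemma binomial_edge_ideal_iff:
  fixes p :: "('k::comm_ring_1) mpoly"
  assumes E: "simple_graph_on n E" and p: "in_ring (vars_S n) p"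
  shows "p \<in> binomial_edge_ideal n E \<longleftrightarrow> p \<in> edge_ideal E {1..n}"
proof
  assume "p \<in> binomial_edge_ideal n E"
  then obtain F c where F: "F \<subseteq> {xv i * yv j - xv j * yv i | i j. i \<in> {1..n} \<and> j \<in> {1..n} \<and> i < j \<and> E i j}"
    "p = (\<Sum>g\<in>F. c g * g)"
    unfolding binomial_edge_ideal_def ideal_gen_def by blast
  have "F \<subseteq> gens E {1..n}" using F(1) unfolding gens_def minor_def by blast
  then show "p \<in> edge_ideal E {1..n}" unfolding F(2) by (intro idl_sum idl_mult idl_gen) blast
next
  let ?U = "- vars_S n"
  assume "p \<in> edge_ideal E {1..n}"
  then have "elim ?U p \<in> binomial_edge_ideal n E"
  proof (induction p rule: idl.induct)
    case zero
    then show ?case by (simp add: binomial_edge_ideal_def ideal_gen_zero)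
  next
    case (step a p c)
    have c: "in_ring (vars_S n) (elim ?U c)" "in_ring (vars_S n) (- elim ?U c)"
      using elim_diff[of ?U 0 "elim ?U c"] by (simp_all add: in_ring_iff elim_elim)
    have off: "elim ?U (xv i) = (if i \<in> {1..n} then xv i else 0)"
      "elim ?U (yv i) = (if i \<in> {1..n} then yv i else (0 :: 'k mpoly))" for i
      by (auto simp: xv_def yv_def elim_Var vars_S_def)
    have "elim ?U (c * a) \<in> binomial_edge_ideal n E"
      using step(1)
    proof (cases rule: gensE)
      case (1 i j)
      then have a: "elim ?U (c * a) = elim ?U c * minor i j"
        by (simp add: elim_mult minor_def elim_diff off)
      have "i \<noteq> j" using 1(4) E unfolding simple_graph_on_def by blast
      then consider "i < j" | "j < i" by linarith
      then show ?thesis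
      proof cases
        case 1
        then show ?thesis unfolding a binomial_edge_ideal_def minor_def
          using c \<open>i \<in> {1..n}\<close> \<open>j \<in> {1..n}\<close> \<open>E i j\<close> by (intro ideal_gen_gen) blast+
      next
        case 2
        have "E j i" using \<open>E i j\<close> E unfolding simple_graph_on_def by blast
        have "elim ?U (c * a) = - elim ?U c * minor j i"
          unfolding a minor_swap[of i j] by simp
        then show ?thesis unfolding binomial_edge_ideal_def minor_def
          using c 2 \<open>i \<in> {1..n}\<close> \<open>j \<in> {1..n}\<close> \<open>E j i\<close> by (simp only:) (intro ideal_gen_gen, blast+)
      qed
    qed (auto simp: elim_mult off binomial_edge_ideal_def ideal_gen_zero)
    then show ?case using step(3) unfolding elim_add binomial_edge_ideal_def by (intro ideal_gen_add)
  qed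
  then show "p \<in> binomial_edge_ideal n E" using p by (simp add: in_ring_iff)
qed

text \<open>Replacing all matrix entries and witnesses by representatives in k[V] changes nothing
  modulo \<open>J\<close>. The shift \<open>i - 1\<close> reconciles two conventions:
  \<open>gr.reso\<close> numbers a differential by its target,
  \<open>linear_resolution_of_field\<close> by its source.\<close>

lemma linear_resolution_of_reso:
  fixes F :: "nat \<Rightarrow> nat \<Rightarrow> nat \<Rightarrow> ('k::field) mpoly"
  assumes F: "gr.reso J f F" and J: "gr.hideal J"
    and elim: "\<And>p. p - elim (- V) p \<in> J"
    and I: "\<And>p. in_ring V p \<Longrightarrow> p \<in> I \<longleftrightarrow> p \<in> J"
  shows "linear_resolution_of_field V I f (\<lambda>i r c. elim (- V) (F (i - 1) r c))"
proof -
  let ?\<rho> = "elim (- V) :: 'k mpoly \<Rightarrow> 'k mpoly"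
  note Jd = gr.hidealD[OF J] and R = gr.resoD[OF F]
  define M where "M i r c = ?\<rho> (F i r c)" for i r c
  have ring_\<rho>: "in_ring V (?\<rho> p)" for p by (simp add: in_ring_iff elim_elim)
  have ring_diff: "in_ring V p \<Longrightarrow> in_ring V q \<Longrightarrow> in_ring V (p - q)" for p q :: "'k mpoly"
    by (simp add: in_ring_iff elim_diff)
  have ring_mapp: "in_ring V (mapp (M i) m w r)" if "vec_in_ring V m w" for i m w r
  proof -
    have "?\<rho> (mapp (M i) m w r) = mapp (M i) m w r"
      unfolding elim_mapp using that
      by (intro mapp_cong) (auto simp: M_def elim_elim vec_in_ring_def in_ring_iff fun_eq_iff)
    then show ?thesis by (simp add: in_ring_iff)
  qed
  have MF: "mapp (F i) m w r - mapp (M i) m w r \<in> J" for i m w r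
    unfolding mapp_def sum_subtractf[symmetric] M_def
    by (intro gr.hideal_sum[OF J]) (simp add: left_diff_distrib[symmetric] Jd(7) elim)
  have M\<rho>: "mapp (M i) m w r - mapp (M i) m (\<lambda>j. ?\<rho> (w j)) r \<in> J" for i m w r
    unfolding mapp_diff[symmetric] by (intro gr.hideal_mapp[OF J] elim)
  have iff: "p \<in> J \<longleftrightarrow> q \<in> J" if "p - q \<in> J" for p q
    using Jd(2)[of "p - q" q] Jd(6)[of p "p - q"] that by auto
  have iffM: "x - mapp (F i) m w r \<in> J \<longleftrightarrow> x - mapp (M i) m w r \<in> J" for x i m w r
    by (rule iff) (use Jd(5)[OF MF[of i m w r]] in simp)
  have iffM': "mapp (F i) m w r \<in> J \<longleftrightarrow> mapp (M i) m w r \<in> J" for i m w r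
    by (rule iff[OF MF])
  have lift: "\<exists>w. vec_in_ring V m w \<and> (\<forall>r\<in>X. x r - mapp (M i) m w r \<in> J)"
    if "\<forall>r\<in>X. x r - mapp (F i) m w r \<in> J" for X x i m w
  proof (intro exI[of _ "\<lambda>j. ?\<rho> (w j)"] conjI ballI)
    show "vec_in_ring V m (\<lambda>j. ?\<rho> (w j))" by (simp add: vec_in_ring_def ring_\<rho>)
    fix r assume "r \<in> X"
    then have "x r - mapp (M i) m w r \<in> J" using that iffM by blast
    from Jd(2)[OF this M\<rho>[of i m w r]] show "x r - mapp (M i) m (\<lambda>j. ?\<rho> (w j)) r \<in> J" by simp
  qed
  have const: "homc 0 p = 0 \<longleftrightarrow> lookup p 0 = 0" for p :: "'k mpoly"
  proof -
    have l: "lookup (homc 0 p) m = (if m = 0 then lookup p 0 else 0)" for m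
      by (simp add: homc_def lookup_flt mdeg_eq_0_iff)
    show ?thesis
    proof
      assume "homc 0 p = 0"
      then show "lookup p 0 = 0" using l[of 0] by simp
    qed (intro poly_mapping_eqI, simp add: l)
  qed
  have "linear_resolution_of_field V I f (\<lambda>i. M (i - 1))"
    unfolding linear_resolution_of_field_def mat_app_eq_mapp
  proof (intro conjI allI impI)
    show "f 0 = 1" by (rule R(1))
  next
    fix i r c :: nat assume i: "1 \<le> i" and r: "r < f (i - 1)" "c < f i"
    then have "homc 1 (F (i - 1) r c) = F (i - 1) r c" using R(2)[of r "i - 1" c] by simp
    then have "homc 1 (M (i - 1) r c) = M (i - 1) r c" unfolding M_def by (simp only: elim_homc)
    then show "linear_form V (M (i - 1) r c)"
      unfolding linear_form_def homc_def flt_eq_self_iff by (simp add: M_def ring_\<rho>)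
  next
    fix p :: "'k mpoly" assume p: "in_ring V p"
    have "p \<in> max_ideal V \<longleftrightarrow> homc 0 p = 0" unfolding max_ideal_def const using p by simp
    also have "\<dots> \<longleftrightarrow> (\<exists>w. p - mapp (F 0) (f 1) w 0 \<in> J)" using R(3,4) by blast
    also have "\<dots> \<longleftrightarrow> (\<exists>w. vec_in_ring V (f 1) w \<and> p - mapp (M 0) (f 1) w 0 \<in> J)"
      using lift[of "{0}" "\<lambda>_. p"] iffM by auto
    also have "\<dots> \<longleftrightarrow> (\<exists>w. vec_in_ring V (f 1) w \<and> p - mapp (M 0) (f 1) w 0 \<in> I)"
      using I ring_diff[OF p ring_mapp] by blast
    finally show "p \<in> max_ideal V \<longleftrightarrow> (\<exists>w. vec_in_ring V (f 1) w \<and> p - mapp (M (1 - 1)) (f 1) w 0 \<in> I)"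
      by simp
  next
    fix i r and w :: "nat \<Rightarrow> 'k mpoly" assume i: "1 \<le> (i::nat)" and w: "vec_in_ring V (f (i + 1)) w" and r: "r < f (i - 1)"
    then obtain k where k: "i = Suc k" by (cases i) auto
    have "diffl f F k (diffl f M (Suc k) w) r \<in> J"
      by (rule gr.reso_cycle_mod[OF J F, of _ _ w])
        (use r k Jd(5)[OF MF[of "Suc k" "f (Suc (Suc k))" w]] in simp_all)
    then have "diffl f M k (diffl f M (Suc k) w) r \<in> J" unfolding iffM' .
    moreover have "in_ring V (diffl f M k (diffl f M (Suc k) w) r)"
      by (rule ring_mapp) (use w k ring_mapp in \<open>simp add: vec_in_ring_def\<close>)
    ultimately show "mapp (M (i - 1)) (f i) (mapp (M (i + 1 - 1)) (f (i + 1)) w) r \<in> I"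
      using I k by simp
  next
    fix i and v :: "nat \<Rightarrow> 'k mpoly" assume i: "1 \<le> (i::nat)" and v: "vec_in_ring V (f i) v"
      and cyc: "\<forall>r<f (i - 1). mapp (M (i - 1)) (f i) v r \<in> I"
    then obtain k where k: "i = Suc k" by (cases i) auto
    have "diffl f F k v r \<in> J" if "r < f k" for r
      unfolding iffM' using cyc I[OF ring_mapp] v that k by simp
    then obtain w where "\<forall>r<f (Suc k). v r - diffl f F (Suc k) w r \<in> J"
      using R(6)[of k v] by blast
    then obtain w' where w': "vec_in_ring V (f (Suc (Suc k))) w'"
      "\<forall>r\<in>{..<f (Suc k)}. v r - diffl f M (Suc k) w' r \<in> J"
      using lift[of "{..<f (Suc k)}" v "Suc k" "f (Suc (Suc k))" w] by auto
    have "v r - diffl f M (Suc k) w' r \<in> I" if "r < f (Suc k)" for r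
    proof -
      have "in_ring V (v r - diffl f M (Suc k) w' r)"
        using v k that by (intro ring_diff ring_mapp w'(1)) (simp add: vec_in_ring_def)
      then show ?thesis using I w'(2) that by simp
    qed
    then show "\<exists>w. vec_in_ring V (f (i + 1)) w \<and> (\<forall>r<f i. v r - mapp (M (i + 1 - 1)) (f (i + 1)) w r \<in> I)"
      using w'(1) k by auto
  qed
  then show ?thesis by (simp add: M_def[abs_def])
qed

theorem theorem2p1:
  fixes n :: nat and E :: "nat \<Rightarrow> nat \<Rightarrow> bool"
  assumes "simple_graph_on n E"
    and "chordal n E" and "claw_free n E" and "tent_free n E"
  shows "koszul (vars_S n) (binomial_edge_ideal n E :: ('k::field) mpoly set)"
proof -
  interpret strongly_chordal_claw_free n E by (unfold_locales) (fact assms)+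
  let ?J = "edge_ideal E {1..n} :: 'k mpoly set"
  have V: "- vars_S n = vars_off {1..n}"
  proof (rule set_eqI)
    show "x \<in> - vars_S n \<longleftrightarrow> x \<in> vars_off {1..n}" for x
      by (cases x) (auto simp: vars_S_def vars_off_def)
  qed
  have "gr.lin ?J 1 gr.irrelevant_ideal" by (rule lin_edge_ideal) simp
  then obtain f F where F: "gr.reso ?J f F" using gr.lin_reso[OF hideal_edge_ideal] by blast
  have "linear_resolution_of_field (vars_S n) (binomial_edge_ideal n E)
      f (\<lambda>i r c. elim (- vars_S n) (F (i - 1) r c))"
    by (rule linear_resolution_of_reso[OF F hideal_edge_ideal _ binomial_edge_ideal_iff[OF graph]])
      (simp_all only: V elim_vars_off_diff)
  then show ?thesis unfolding koszul_def by blast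
qed

end
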